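(* There exists a (sufficiently large) absolute constant $C_0>0$ such that the following holds. Let $\mathbf A$ be the adjacency matrix of a graph drawn from the degree-corrected stochastic block model on $n$ nodes with $r$ clusters, where $B_{aa}=p$ for all $a=1,\dots,r$ and $B_{ab}=q$ for all $1\le a<b\le r$. Suppose that for some number $\delta>0$ and tuning parameter $\lambda$, $$\max_{1\le a<b\le r}\frac{q+\delta}{H_aH_b}<\lambda<\min_{1\le a\le r}\frac{p-\delta}{H_a^2},$$ and that $$\delta>C_0\left(\frac{\sqrt{qn}}{G_{\min}}+\sqrt{\frac{p\log n}{G_{\min}\theta_{\min}}}\right).$$ Then with probability at least $1-10n^{-1}$, the solution $\widehat{\mathbf Y}$ of the convex program $$\max_{\mathbf Y}\ \langle\mathbf Y,\ \mathbf A-\lambda\mathbf d\mathbf d^\top\rangle\quad\text{subject to}\quad\mathbf Y\succeq0,\quad 0\le Y_{ij}\le1\ \ \forall i,j\in[n],\quad Y_{ii}=1\ \ \forall i\in[n]$$ is unique and equals the true partition matrix $\mathbf Y^*$.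
   Context: Degree-corrected stochastic block model (DCSBM): the node set $[n]=\{1,\dots,n\}$ is partitioned into $r$ fixed but unknown clusters $C_1^*,\dots,C_r^*$. There are a vector $\boldsymbol\theta=(\theta_1,\dots,\theta_n)^\top$ with nonnegative entries, normalized so that $\max_i\theta_i=1$, and a symmetric $r\times r$ matrix $\mathbf B$ with nonnegative entries. Each pair of distinct nodes $i\in C_a^*$, $j\in C_b^*$ is joined by an undirected edge with probability $\theta_i\theta_jB_{ab}\in[0,1]$, independently of all other pairs. $\mathbf A\in\{0,1\}^{n\times n}$ is the adjacency matrix (symmetric, zero diagonal), $d_i=\sum_{j}A_{ij}$ is the degree of node $i$, and $\mathbf d=(d_1,\dots,d_n)^\top$. The true partition matrix $\mathbf Y^*\in\{0,1\}^{n\times n}$ has $Y^*_{ij}=1$ if and only if $i$ and $j$ lie in the same cluster (in particular $Y^*_{ii}=1$). Notation: $G_a=\sum_{i\in C_a^*}\theta_i$, $H_a=\sum_{b=1}^rB_{ab}G_b$, $G_{\min}=\min_{1\le a\le r}G_a$, $\theta_{\min}=\min_{1\le i\le n}\theta_i$. The variable $\mathbf Y$ ranges over symmetric $n\times n$ real matrices, $\langle\cdot,\cdot\rangle$ is the trace inner product and $\mathbf Y\succeq0$ means positive semidefinite.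
   Formalization: The formal theorem also assumes θ_i²p ≤ 1 whenever {i} is a single-node cluster and δ < p (new only if r = 1), since the claim fails without these, and makes explicit that θ_min > 0 and q ≥ 0. *)

theory Defs
  imports "HOL-Probability.Probability" "Jordan_Normal_Form.Matrix"
begin

text \<open>
  Nodes are \<open>0, \<dots>, n - 1\<close> and cluster labels are \<open>0, \<dots>, r - 1\<close>. The clusters are the
  fibres of a labelling \<open>c\<close>. Vectors and matrices are those of
  \<open>Jordan_Normal_Form.Matrix\<close>, because the dimension \<open>n\<close> has to be quantified after the
  absolute constant. The following removes the syntax that clashes with that theory.
\<close>

unbundle no vec_syntax and no inner_syntax


subsection \<open>The degree-corrected stochastic block model\<close>

definition cluster :: "nat \<Rightarrow> (nat \<Rightarrow> nat) \<Rightarrow> nat \<Rightarrow> nat set" where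
  "cluster n c a = {i. i < n \<and> c i = a}"

text \<open>Surjectivity of \<open>c\<close> onto the labels says that each of the \<open>r\<close> clusters is nonempty.\<close>

definition dcsbm_params ::
    "nat \<Rightarrow> nat \<Rightarrow> (nat \<Rightarrow> nat) \<Rightarrow> (nat \<Rightarrow> real) \<Rightarrow> (nat \<Rightarrow> nat \<Rightarrow> real) \<Rightarrow> bool" where
  "dcsbm_params n r c \<theta> B \<longleftrightarrow>
     n > 0 \<and> c ` {..<n} = {..<r} \<and>
     (\<forall>i<n. \<theta> i \<ge> 0) \<and> Max (\<theta> ` {..<n}) = 1 \<and>
     (\<forall>a<r. \<forall>b<r. B a b = B b a \<and> B a b \<ge> 0) \<and>
     (\<forall>i<n. \<forall>j<n. i \<noteq> j \<longrightarrow> \<theta> i * \<theta> j * B (c i) (c j) \<le> 1)"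

text \<open>
  If \<open>{i}\<close> is a cluster, then no pair of distinct nodes has an edge probability involving the
  diagonal entry of \<open>B\<close> for that cluster, so \<^const>\<open>dcsbm_params\<close> leaves this entry unbounded,
  although it enters \<open>H\<close>. The next condition asks that \<open>\<theta>\<^sub>i \<theta>\<^sub>i B\<^sub>a\<^sub>a\<close> is a probability in this case
  as well. Exact recovery fails without it: take \<open>n = r\<close>, all \<open>\<theta>\<^sub>i = 1\<close>, \<open>q = 1\<close> (the complete
  graph), \<open>p = n^10\<close>, \<open>\<delta> = n^6\<close>. For large \<open>n\<close> the separation conditions hold with
  \<open>\<lambda>\<close> of order \<open>n^(-12)\<close>, but the all-ones matrix beats the identity.
\<close>

definition singleton_blocks_bounded ::
    "nat \<Rightarrow> (nat \<Rightarrow> nat) \<Rightarrow> (nat \<Rightarrow> real) \<Rightarrow> (nat \<Rightarrow> nat \<Rightarrow> real) \<Rightarrow> bool" where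
  "singleton_blocks_bounded n c \<theta> B \<longleftrightarrow>
     (\<forall>i<n. cluster n c (c i) = {i} \<longrightarrow> \<theta> i * \<theta> i * B (c i) (c i) \<le> 1)"

definition node_pairs :: "nat \<Rightarrow> (nat \<times> nat) set" where
  "node_pairs n = {(i, j). i < j \<and> j < n}"

definition adjacency :: "nat \<Rightarrow> (nat \<times> nat \<Rightarrow> bool) \<Rightarrow> real mat" where
  "adjacency n e = mat n n (\<lambda>(i, j). if i \<noteq> j \<and> e (min i j, max i j) then 1 else 0)"

text \<open>The law of the adjacency matrix: independent Bernoulli edges over unordered pairs.\<close>

definition dcsbm ::
    "nat \<Rightarrow> (nat \<Rightarrow> nat) \<Rightarrow> (nat \<Rightarrow> real) \<Rightarrow> (nat \<Rightarrow> nat \<Rightarrow> real) \<Rightarrow> real mat pmf" where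
  "dcsbm n c \<theta> B =
     map_pmf (adjacency n)
       (Pi_pmf (node_pairs n) False (\<lambda>(i, j). bernoulli_pmf (\<theta> i * \<theta> j * B (c i) (c j))))"

definition G :: "nat \<Rightarrow> (nat \<Rightarrow> nat) \<Rightarrow> (nat \<Rightarrow> real) \<Rightarrow> nat \<Rightarrow> real" where
  "G n c \<theta> a = (\<Sum>i\<in>cluster n c a. \<theta> i)"

definition H :: "nat \<Rightarrow> nat \<Rightarrow> (nat \<Rightarrow> nat) \<Rightarrow> (nat \<Rightarrow> real) \<Rightarrow> (nat \<Rightarrow> nat \<Rightarrow> real) \<Rightarrow> nat \<Rightarrow> real" where
  "H n r c \<theta> B a = (\<Sum>b<r. B a b * G n c \<theta> b)"

definition G_min :: "nat \<Rightarrow> nat \<Rightarrow> (nat \<Rightarrow> nat) \<Rightarrow> (nat \<Rightarrow> real) \<Rightarrow> real" where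
  "G_min n r c \<theta> = Min (G n c \<theta> ` {..<r})"

definition theta_min :: "nat \<Rightarrow> (nat \<Rightarrow> real) \<Rightarrow> real" where
  "theta_min n \<theta> = Min (\<theta> ` {..<n})"

text \<open>
  Division by zero yields \<open>0\<close>, so a bound such as \<open>\<delta> > C * sqrt (p * ln n / (G_min * theta_min))\<close>
  has to be accompanied by \<open>theta_min > 0\<close>. This makes every \<open>G\<close> positive, and together with
  \<open>p > 0\<close> every \<open>H\<close>.

  For \<open>r \<ge> 2\<close> the bounds \<open>(q + \<delta>) / (H\<^sub>a H\<^sub>b) < \<lambda> < (p - \<delta>) / H\<^sub>a\<^sup>2\<close> with \<open>\<delta> > 0\<close> imply \<open>\<delta> < p\<close>,
  because the first one makes \<open>\<lambda>\<close> positive. For \<open>r = 1\<close> there is no pair \<open>a < b\<close>, hence no lower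
  bound on \<open>\<lambda>\<close>, and \<open>\<delta> < p\<close> has to be required separately. Otherwise \<open>p\<close> could be tiny and
  \<open>\<delta>\<close> and \<open>-\<lambda>\<close> huge, and for the empty graph every feasible matrix is optimal.
\<close>

definition partition_matrix :: "nat \<Rightarrow> (nat \<Rightarrow> nat) \<Rightarrow> real mat" where
  "partition_matrix n c = mat n n (\<lambda>(i, j). if c i = c j then 1 else 0)"


subsection \<open>The convex program\<close>

definition degree_vec :: "real mat \<Rightarrow> real vec" where
  "degree_vec A = vec (dim_row A) (\<lambda>i. \<Sum>j<dim_col A. A $$ (i, j))"

definition outer_prod :: "real vec \<Rightarrow> real vec \<Rightarrow> real mat" where
  "outer_prod u v = mat (dim_vec u) (dim_vec v) (\<lambda>(i, j). u $ i * v $ j)"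

definition mat_trace :: "real mat \<Rightarrow> real" where
  "mat_trace M = (\<Sum>i<dim_row M. M $$ (i, i))"

definition trace_inner :: "real mat \<Rightarrow> real mat \<Rightarrow> real" where
  "trace_inner X Y = mat_trace (X\<^sup>T * Y)"

definition psd :: "nat \<Rightarrow> real mat \<Rightarrow> bool" where
  "psd n M \<longleftrightarrow> M \<in> carrier_mat n n \<and> M\<^sup>T = M \<and> (\<forall>v\<in>carrier_vec n. v \<bullet> (M *\<^sub>v v) \<ge> 0)"

definition feasible :: "nat \<Rightarrow> real mat set" where
  "feasible n = {Y. psd n Y \<and> (\<forall>i<n. \<forall>j<n. 0 \<le> Y $$ (i, j) \<and> Y $$ (i, j) \<le> 1) \<and>
                    (\<forall>i<n. Y $$ (i, i) = 1)}"

definition objective :: "real \<Rightarrow> real mat \<Rightarrow> real mat \<Rightarrow> real" where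
  "objective lam A Y = trace_inner Y (A - lam \<cdot>\<^sub>m outer_prod (degree_vec A) (degree_vec A))"

definition solutions :: "nat \<Rightarrow> real \<Rightarrow> real mat \<Rightarrow> real mat set" where
  "solutions n lam A =
     {Y \<in> feasible n. \<forall>Z\<in>feasible n. objective lam A Z \<le> objective lam A Y}"

end

theory Submission
  imports Defs
begin

text \<open>
  Write \<open>W = A - E A\<close> (with zero diagonal) and \<open>\<Delta> = Y - Y*\<close>. Concentration of the degrees makes the
  entries of \<open>E A - \<lambda> d d\<^sup>T\<close> at least \<open>\<delta>/2 \<theta>\<^sub>i \<theta>\<^sub>j\<close> inside and at most \<open>-\<delta>/2 \<theta>\<^sub>i \<theta>\<^sub>j\<close> across clusters,
  so the signal part of the objective drops by \<open>\<delta>/2 \<Sum> \<theta>\<^sub>i \<theta>\<^sub>j |\<Delta>\<^sub>i\<^sub>j|\<close>. To see that \<open>\<langle>\<Delta>, W\<rangle>\<close> is at most half of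
  this, factor \<open>Y\<close> as a Gram matrix and subtract from each factor its \<open>\<theta>\<close>-weighted cluster means. The
  means only see averages of \<open>W\<close> over clusters (Chernoff); the centred remainder is controlled by
  \<open>W \<le> \<kappa> diag(G\<^sub>i \<theta>\<^sub>i)\<close>, because \<open>Y\<^sub>i\<^sub>i = 1\<close> turns the weighted variances into
  \<open>\<Sum> \<theta>\<^sub>i \<theta>\<^sub>j |\<Delta>\<^sub>i\<^sub>j|\<close> over pairs inside clusters.

  The spectral bound must not lose a logarithm in the variance term. Following Bandeira and
  van Handel, closed walks of length \<open>2k\<close> in which every edge occurs at least twice are compared with
  those on only \<open>2k\<close> vertices; this loses constants only, once \<open>k\<close> exceeds \<open>log n\<close> and the row variance
  relative to the squared entry bound. The number of such walks on \<open>2k\<close> vertices is at most the trace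
  moment of a \<open>2k \<times> 2k\<close> matrix with bounded entries, which a lattice net controls.
\<close>


section \<open>Deterministic noise bound\<close>

text \<open>The maximiser depends on the graph, so the noise has to be bounded for all feasible
  \<open>Y\<close> at once; entrywise tail bounds do not suffice and operator norm estimates are
  needed. The two terms of the hypothesis on \<open>\<delta>\<close> dictate how the noise matrix is
  cut. Across clusters its row variance is at most \<open>q * n\<close>, and the term with
  \<open>sqrt (q * n)\<close> carries no logarithm, so that matrix Bernstein bounds are too weak
  there. Inside a cluster of m nodes the row variance is at most p m, where m is at most G /
  \<open>theta_min\<close> for the weight G of the cluster, and the term with \<open>ln n\<close>
  pays for it. Origin of 2^50: on \<open>2 * k\<close> vertices, a net of 2^(36 k) points for each
  of the two arguments together with the moments of a fixed bilinear form gives the trace bound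
  (2^82 k)^k, up to the dimension. A factor 16^k for Markov's inequality makes it 2^86. Rounding
  \<open>k\<close> up to a power of two and the margin 1/16 in the deviation cost 2 * 2^8, so the
  squared threshold carries 2^95, for which (2^50)^2 leaves room.\<close>

lemma gram_decomposition:
  fixes Y :: "nat \<Rightarrow> nat \<Rightarrow> real"
  assumes "\<And>i j. i < n \<Longrightarrow> j < n \<Longrightarrow> Y i j = Y j i"
    and "\<And>x. (\<Sum>i<n. \<Sum>j<n. Y i j * x i * x j) \<ge> 0"
  shows "\<exists>v. \<forall>i<n. \<forall>j<n. Y i j = (\<Sum>l<n. v l i * v l j)"
  using assms
proof (induction n arbitrary: Y)
  case (Suc n)
  have expand: "(\<Sum>i<Suc n. \<Sum>j<Suc n. Y i j * x i * x j) =
      (\<Sum>i<n. \<Sum>j<n. Y i j * x i * x j) + 2 * x n * (\<Sum>i<n. Y i n * x i) + Y n n * (x n)\<^sup>2" for x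
  proof -
    have "(\<Sum>j<n. Y n j * x n * x j) = x n * (\<Sum>i<n. Y i n * x i)"
      unfolding sum_distrib_left using Suc.prems(1) by (intro sum.cong) auto
    moreover have "(\<Sum>i<n. Y i n * x i * x n) = x n * (\<Sum>i<n. Y i n * x i)"
      unfolding sum_distrib_left by (intro sum.cong) auto
    ultimately show ?thesis by (simp add: sum.distrib power2_eq_square)
  qed
  have pos: "(\<Sum>i<n. \<Sum>j<n. Y i j * x i * x j) + 2 * t * (\<Sum>i<n. Y i n * x i) + Y n n * t\<^sup>2 \<ge> 0" for x t
    using Suc.prems(2)[of "x(n := t)"] unfolding expand by simp
  have a0: "Y n n \<ge> 0" using pos[of "\<lambda>_. 0" 1] by simp
  have symn: "Y i j = Y j i" if "i < n" "j < n" for i j using Suc.prems(1) that by simp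
  \<comment> \<open>Cholesky factorisation. A positive last pivot is eliminated, and the Schur
    complement is again positive semidefinite; if the last pivot is zero, the whole last column
    vanishes.\<close>
  show ?case
  proof (cases "Y n n = 0")
    case True
    have zero: "Y j n = 0" if j: "j < n" for j
    proof (rule ccontr)
      assume nz: "Y j n \<noteq> 0"
      have s: "(\<Sum>i<n. Y i n * (if i = j then 1 else 0)) = Y j n"
        using j by (simp add: if_distrib[of "(*) _"] cong: if_cong)
      define q where "q = (\<Sum>i<n. \<Sum>k<n. Y i k * (if i = j then 1 else 0) * (if k = j then 1 else 0))"
      have "q + 2 * t * Y j n \<ge> 0" for t
        using pos[of "\<lambda>i. if i = j then 1 else 0" t] True unfolding s q_def by simp
      \<comment> \<open>The form is affine in \<open>t\<close>, and this \<open>t\<close> gives it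
        the value -1.\<close>
      from this[of "- (q + 1) / (2 * Y j n)"] show False using nz by (simp add: field_simps)
    qed
    have "(\<Sum>i<n. \<Sum>j<n. Y i j * x i * x j) \<ge> 0" for x using pos[of x 0] by simp
    from Suc.IH[OF symn this] obtain v
      where v: "\<forall>i<n. \<forall>j<n. Y i j = (\<Sum>l<n. v l i * v l j)" by blast
    have "Y i j = (\<Sum>l<Suc n. (if i < n \<and> l < n then v l i else 0) * (if j < n \<and> l < n then v l j else 0))"
      if "i < Suc n" "j < Suc n" for i j
    proof (cases "i < n \<and> j < n")
      case True
      then show ?thesis using v by simp
    next
      case F: False
      have "Y i j = 0"
        using F that zero[of i] zero[of j] True Suc.prems(1)[of i j] by (cases "i = n"; cases "j = n") auto
      moreover have "(\<Sum>l<Suc n. (if i < n \<and> l < n then v l i else 0) * (if j < n \<and> l < n then v l j else 0)) = 0"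
        by (intro sum.neutral) (use F in auto)
      ultimately show ?thesis by simp
    qed
    then show ?thesis by (intro exI[of _ "\<lambda>l i. if i < n \<and> l < n then v l i else 0"]) simp
  next
    case False
    define a where "a = Y n n"
    have a: "a > 0" using False a0 by (simp add: a_def)
    define Y' where "Y' = (\<lambda>i j. Y i j - Y i n * Y j n / a)"
    have "(\<Sum>i<n. \<Sum>j<n. Y' i j * x i * x j) \<ge> 0" for x
    proof -
      define s where "s = (\<Sum>i<n. Y i n * x i)"
      have "(\<Sum>i<n. \<Sum>j<n. Y' i j * x i * x j) = (\<Sum>i<n. \<Sum>j<n. Y i j * x i * x j) - s * s / a"
        unfolding s_def sum_product sum_divide_distrib
        unfolding Y'_def sum_subtractf[symmetric] by (intro sum.cong refl) (simp add: algebra_simps)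
      \<comment> \<open>\<open>- s / a\<close> minimises the form over the last coordinate; the
        minimum is the form of the Schur complement.\<close>
      moreover have "0 \<le> (\<Sum>i<n. \<Sum>j<n. Y i j * x i * x j) + 2 * (- s / a) * s + a * (- s / a)\<^sup>2"
        using pos[of x "- s / a"] unfolding s_def a_def .
      moreover have "2 * (- s / a) * s + a * (- s / a)\<^sup>2 = - (s * s / a)"
        using a by (simp add: power2_eq_square)
      ultimately show ?thesis by simp
    qed
    from Suc.IH[of Y', OF _ this] obtain v
      where v: "\<forall>i<n. \<forall>j<n. Y' i j = (\<Sum>l<n. v l i * v l j)"
      using symn by (auto simp: Y'_def mult.commute)
    define w where "w = (\<lambda>l i. if l < n then (if i < n then v l i else 0) else Y i n / sqrt a)"
    have "Y i j = (\<Sum>l<Suc n. w l i * w l j)" if "i < Suc n" "j < Suc n" for i j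
    proof -
      have last: "w n i * w n j = Y i n * Y j n / a" using a by (simp add: w_def)
      show ?thesis
      proof (cases "i < n \<and> j < n")
        case True
        then have "(\<Sum>l<n. w l i * w l j) = Y' i j" using v by (simp add: w_def)
        then show ?thesis using last by (simp add: Y'_def)
      next
        case F: False
        have "(\<Sum>l<n. w l i * w l j) = 0" by (intro sum.neutral) (use F in \<open>auto simp: w_def\<close>)
        moreover have "Y i n * Y j n / a = Y i j"
          using F that a Suc.prems(1)[of i j] by (cases "i = n"; cases "j = n") (auto simp: a_def)
        ultimately show ?thesis using last by simp
      qed
    qed
    then show ?thesis by blast
  qed
qed simp

lemma G_eq_sum: "G n c \<theta> a = (\<Sum>k<n. if c k = a then \<theta> k else 0)"
  unfolding G_def cluster_def by (subst sum.inter_filter[symmetric]) auto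

text \<open>The matrix of the projection onto vectors constant on clusters, orthogonal for the
  weights \<open>\<theta>\<close>.\<close>

definition cluster_proj :: "nat \<Rightarrow> (nat \<Rightarrow> nat) \<Rightarrow> (nat \<Rightarrow> real) \<Rightarrow> nat \<Rightarrow> nat \<Rightarrow> real" where
  "cluster_proj n c \<theta> i k = (if c k = c i then \<theta> k / G n c \<theta> (c i) else 0)"

definition cluster_mean :: "nat \<Rightarrow> (nat \<Rightarrow> nat) \<Rightarrow> (nat \<Rightarrow> real) \<Rightarrow> (nat \<Rightarrow> real) \<Rightarrow> nat \<Rightarrow> real" where
  "cluster_mean n c \<theta> y i = (\<Sum>k<n. cluster_proj n c \<theta> i k * y k)"

lemma G_cluster_pos:
  assumes "\<And>i. i < n \<Longrightarrow> \<theta> i > 0" "i < n"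
  shows "G n c \<theta> (c i) > 0"
  unfolding G_eq_sum by (rule sum_pos2[of _ i]) (use assms in \<open>auto simp: less_imp_le\<close>)

text \<open>The weighted variance inside the clusters: both sides equal
  \<open>\<Sum>\<^sub>a G\<^sub>a\<^sup>2 Var\<^sub>a(y)\<close> for the weights \<open>\<theta>\<close> normalised on each cluster.\<close>

lemma weighted_variance:
  assumes pos: "\<And>i. i < n \<Longrightarrow> \<theta> i > 0"
  shows "(\<Sum>i<n. G n c \<theta> (c i) * \<theta> i * (y i - cluster_mean n c \<theta> y i)\<^sup>2) =
    (\<Sum>i<n. \<Sum>j<n. if c i = c j then \<theta> i * \<theta> j * ((y i)\<^sup>2 + (y j)\<^sup>2 - 2 * (y i * y j)) / 2 else 0)"
proof -
  define m where "m = cluster_mean n c \<theta> y"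
  define g where "g = (\<lambda>i. G n c \<theta> (c i))"
  define S where "S = (\<lambda>i j. if c i = c j then 1 else (0::real))"
  have gS: "g i = (\<Sum>j<n. S i j * \<theta> j)" for i
    unfolding g_def S_def G_eq_sum by (intro sum.cong) auto
  have gm: "g i * m i = (\<Sum>k<n. S i k * \<theta> k * y k)" if "i < n" for i
  proof -
    have "g i \<noteq> 0" using G_cluster_pos[of n \<theta> i c, OF pos that] that by (simp add: g_def)
    then show ?thesis
      unfolding m_def cluster_mean_def sum_distrib_left
      by (intro sum.cong) (auto simp: cluster_proj_def S_def g_def)
  qed
  have mm: "S i k * m i = S i k * m k" for i k
    by (auto simp: S_def m_def cluster_mean_def cluster_proj_def intro!: sum.cong)
  have Ssym: "S i k = S k i" for i k by (simp add: S_def eq_commute)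
  \<comment> \<open>The mean is an orthogonal projection for these weights, so its squared norm
    equals its inner product with \<open>y\<close>.\<close>
  have "(\<Sum>i<n. g i * \<theta> i * (m i)\<^sup>2) = (\<Sum>i<n. \<Sum>k<n. \<theta> i * m i * (S i k * \<theta> k * y k))"
    by (intro sum.cong refl) (simp add: gm[symmetric] sum_distrib_left[symmetric] power2_eq_square)
  also have "\<dots> = (\<Sum>k<n. \<Sum>i<n. \<theta> i * m i * (S i k * \<theta> k * y k))" by (rule sum.swap)
  also have "\<dots> = (\<Sum>k<n. \<Sum>i<n. \<theta> k * y k * m k * (S k i * \<theta> i))"
  proof (intro sum.cong refl)
    fix k i
    have "\<theta> i * m i * (S i k * \<theta> k * y k) = \<theta> i * \<theta> k * y k * (S i k * m i)" by simp
    also have "\<dots> = \<theta> i * \<theta> k * y k * (S k i * m k)" using mm[of i k] Ssym[of i k] by simp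
    also have "\<dots> = \<theta> k * y k * m k * (S k i * \<theta> i)" by simp
    finally show "\<theta> i * m i * (S i k * \<theta> k * y k) = \<theta> k * y k * m k * (S k i * \<theta> i)" .
  qed
  also have "\<dots> = (\<Sum>k<n. g k * \<theta> k * y k * m k)"
    unfolding gS sum_distrib_left sum_distrib_right by (intro sum.cong refl) simp
  finally have sq: "(\<Sum>i<n. g i * \<theta> i * (m i)\<^sup>2) = (\<Sum>k<n. g k * \<theta> k * y k * m k)" .
  have "(\<Sum>i<n. g i * \<theta> i * (y i - m i)\<^sup>2) =
      (\<Sum>i<n. g i * \<theta> i * (y i)\<^sup>2) - 2 * (\<Sum>i<n. g i * \<theta> i * y i * m i) + (\<Sum>i<n. g i * \<theta> i * (m i)\<^sup>2)"
    unfolding sum_distrib_left sum_subtractf[symmetric] sum.distrib[symmetric]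
    by (intro sum.cong refl) (simp add: power2_eq_square algebra_simps)
  also have "\<dots> = (\<Sum>i<n. g i * \<theta> i * (y i)\<^sup>2) - (\<Sum>i<n. g i * \<theta> i * y i * m i)"
    unfolding sq by simp
  also have "(\<Sum>i<n. g i * \<theta> i * y i * m i) = (\<Sum>i<n. \<Sum>j<n. S i j * (\<theta> i * \<theta> j * (y i * y j)))"
  proof (intro sum.cong refl)
    fix i assume "i \<in> {..<n}"
    then have "g i * \<theta> i * y i * m i = \<theta> i * y i * (\<Sum>k<n. S i k * \<theta> k * y k)"
      using gm[of i] by (simp add: mult_ac)
    then show "g i * \<theta> i * y i * m i = (\<Sum>j<n. S i j * (\<theta> i * \<theta> j * (y i * y j)))"
      by (simp add: sum_distrib_left mult_ac)
  qed
  also have "(\<Sum>i<n. g i * \<theta> i * (y i)\<^sup>2) =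
      ((\<Sum>i<n. \<Sum>j<n. S i j * (\<theta> i * \<theta> j * (y i)\<^sup>2)) + (\<Sum>i<n. \<Sum>j<n. S i j * (\<theta> i * \<theta> j * (y j)\<^sup>2))) / 2"
  proof -
    have 1: "(\<Sum>i<n. g i * \<theta> i * (y i)\<^sup>2) = (\<Sum>i<n. \<Sum>j<n. S i j * (\<theta> i * \<theta> j * (y i)\<^sup>2))"
      unfolding gS sum_distrib_right by (intro sum.cong refl) simp
    have "(\<Sum>i<n. \<Sum>j<n. S i j * (\<theta> i * \<theta> j * (y j)\<^sup>2)) = (\<Sum>j<n. \<Sum>i<n. S i j * (\<theta> i * \<theta> j * (y j)\<^sup>2))"
      by (rule sum.swap)
    also have "\<dots> = (\<Sum>i<n. g i * \<theta> i * (y i)\<^sup>2)"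
      unfolding 1 by (intro sum.cong refl) (simp add: Ssym)
    finally show ?thesis using 1 by simp
  qed
  also have "((\<Sum>i<n. \<Sum>j<n. S i j * (\<theta> i * \<theta> j * (y i)\<^sup>2)) + (\<Sum>i<n. \<Sum>j<n. S i j * (\<theta> i * \<theta> j * (y j)\<^sup>2))) / 2
      - (\<Sum>i<n. \<Sum>j<n. S i j * (\<theta> i * \<theta> j * (y i * y j)))
      = (\<Sum>i<n. \<Sum>j<n. S i j * (\<theta> i * \<theta> j * ((y i)\<^sup>2 + (y j)\<^sup>2 - 2 * (y i * y j)) / 2))"
    unfolding sum.distrib[symmetric] sum_divide_distrib sum_subtractf[symmetric]
    by (intro sum.cong refl) (simp add: field_simps)
  also have "\<dots> = (\<Sum>i<n. \<Sum>j<n. if c i = c j then \<theta> i * \<theta> j * ((y i)\<^sup>2 + (y j)\<^sup>2 - 2 * (y i * y j)) / 2 else 0)"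
    by (intro sum.cong refl) (simp add: S_def)
  finally show ?thesis unfolding m_def[symmetric] g_def .
qed

lemma cluster_mean_noise:
  fixes W :: "nat \<Rightarrow> nat \<Rightarrow> real" and n c \<theta> y
  assumes "\<And>i j. W i j = W j i"
  defines "m \<equiv> cluster_mean n c \<theta> y"
  shows "(\<Sum>i<n. \<Sum>j<n. W i j * (y i * y j)) =
    2 * (\<Sum>i<n. \<Sum>j<n. W i j * (m i * y j)) - (\<Sum>i<n. \<Sum>j<n. W i j * (m i * m j)) +
    (\<Sum>i<n. \<Sum>j<n. W i j * ((y i - m i) * (y j - m j)))"
proof -
  have "(\<Sum>i<n. \<Sum>j<n. W i j * (y i * m j)) = (\<Sum>i<n. \<Sum>j<n. W i j * (m i * y j))"
    by (subst sum.swap) (simp add: assms(1) mult_ac)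
  then show ?thesis
    by (simp add: algebra_simps sum.distrib sum_subtractf)
qed

text \<open>The noise form splits into two terms that only see the averages of \<open>W\<close> over clusters, and a
  remainder \<open>z\<^sup>T W z\<close> in vectors with vanishing cluster means, which the spectral bound controls.\<close>

lemma noise_bound:
  fixes W :: "nat \<Rightarrow> nat \<Rightarrow> real" and c :: "nat \<Rightarrow> nat"
  assumes pos: "\<And>i. i < n \<Longrightarrow> \<theta> i > 0"
    and sym: "\<And>i j. W i j = W j i"
    and avg: "\<And>k j. k < n \<Longrightarrow> j < n \<Longrightarrow>
      \<bar>\<Sum>i<n. if c i = c k then W i j else 0\<bar> \<le> \<epsilon> * (G n c \<theta> (c k) * \<theta> j)"
    and spec: "\<And>z. (\<Sum>i<n. \<Sum>j<n. W i j * (z i * z j)) \<le> \<kappa> * (\<Sum>i<n. G n c \<theta> (c i) * \<theta> i * (z i)\<^sup>2)"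
    and gram: "\<And>i j. i < n \<Longrightarrow> j < n \<Longrightarrow> Y i j = (\<Sum>l<n. v l i * v l j)"
    and diag: "\<And>i. i < n \<Longrightarrow> Y i i = 1"
    and \<kappa>: "\<kappa> \<ge> 0"
  defines "Ys \<equiv> \<lambda>i j. if c i = c j then 1 else (0::real)"
  shows "(\<Sum>i<n. \<Sum>j<n. W i j * (Y i j - Ys i j)) \<le>
    (3 * \<epsilon> + \<kappa>) * (\<Sum>i<n. \<Sum>j<n. \<theta> i * \<theta> j * \<bar>Y i j - Ys i j\<bar>)"
proof -
  define P where "P = cluster_proj n c \<theta>"
  define m where "m = (\<lambda>l. cluster_mean n c \<theta> (v l))"
  \<comment> \<open>As matrices, \<open>U\<close> is the transpose of \<open>P\<close> times
    \<open>W\<close>, and \<open>V\<close> is \<open>U\<close> times \<open>P\<close>: noise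
    averaged over clusters in one or in both indices.\<close>
  define U where "U = (\<lambda>k j. \<Sum>i<n. W i j * P i k)"
  define V where "V = (\<lambda>k h. \<Sum>j<n. U k j * P j h)"
  have gpos: "G n c \<theta> (c k) > 0" if "k < n" for k
    using G_cluster_pos[of n \<theta> k c, OF pos that] .
  have U: "\<bar>U k j\<bar> \<le> \<epsilon> * (\<theta> k * \<theta> j)" if kj: "k < n" "j < n" for k j
  proof -
    have "U k j = \<theta> k / G n c \<theta> (c k) * (\<Sum>i<n. if c i = c k then W i j else 0)"
      unfolding U_def P_def cluster_proj_def sum_distrib_left by (intro sum.cong) auto
    then have "\<bar>U k j\<bar> = \<theta> k / G n c \<theta> (c k) * \<bar>\<Sum>i<n. if c i = c k then W i j else 0\<bar>"
      using pos[OF kj(1)] gpos[OF kj(1)] by (simp add: abs_mult)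
    also have "\<dots> \<le> \<theta> k / G n c \<theta> (c k) * (\<epsilon> * (G n c \<theta> (c k) * \<theta> j))"
      using pos[OF kj(1)] gpos[OF kj(1)] avg[OF kj] by (intro mult_left_mono) auto
    finally show ?thesis using gpos[OF kj(1)] by (simp add: mult_ac)
  qed
  have P_nonneg: "P j h \<ge> 0" if "j < n" "h < n" for j h
    using gpos[OF that(1)] pos[OF that(2)] by (simp add: P_def cluster_proj_def)
  \<comment> \<open>The transpose of \<open>P\<close> fixes \<open>\<theta>\<close>, so averaging
    the second index preserves the bound on \<open>U\<close>.\<close>
  have V: "\<bar>V k h\<bar> \<le> \<epsilon> * (\<theta> k * \<theta> h)" if kh: "k < n" "h < n" for k h
  proof -
    have "\<bar>V k h\<bar> \<le> (\<Sum>j<n. \<epsilon> * (\<theta> k * \<theta> j) * P j h)"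
      unfolding V_def using U[OF kh(1)] P_nonneg kh(2)
      by (intro order_trans[OF sum_abs] sum_mono) (auto simp: abs_mult intro!: mult_right_mono)
    also have "\<dots> = \<epsilon> * \<theta> k * (\<theta> h / G n c \<theta> (c h)) * (\<Sum>j<n. if c j = c h then \<theta> j else 0)"
      unfolding sum_distrib_left by (intro sum.cong) (auto simp: P_def cluster_proj_def)
    also have "\<dots> = \<epsilon> * (\<theta> k * \<theta> h)"
      using gpos[OF kh(2)] unfolding G_eq_sum[symmetric] by simp
    finally show ?thesis .
  qed
  have quad1: "(\<Sum>i<n. \<Sum>j<n. W i j * (\<Sum>k<n. P i k * Z k j)) = (\<Sum>k<n. \<Sum>j<n. Z k j * U k j)" for Z
  proof -
    have "(\<Sum>i<n. \<Sum>j<n. W i j * (\<Sum>k<n. P i k * Z k j)) = (\<Sum>i<n. \<Sum>j<n. \<Sum>k<n. Z k j * (W i j * P i k))"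
      by (simp add: sum_distrib_left mult_ac)
    also have "\<dots> = (\<Sum>i<n. \<Sum>k<n. \<Sum>j<n. Z k j * (W i j * P i k))"
      by (intro sum.cong refl sum.swap)
    also have "\<dots> = (\<Sum>k<n. \<Sum>i<n. \<Sum>j<n. Z k j * (W i j * P i k))" by (rule sum.swap)
    also have "\<dots> = (\<Sum>k<n. \<Sum>j<n. \<Sum>i<n. Z k j * (W i j * P i k))"
      by (intro sum.cong refl sum.swap)
    finally show ?thesis by (simp add: U_def sum_distrib_left)
  qed
  have quad2: "(\<Sum>i<n. \<Sum>j<n. W i j * (\<Sum>k<n. P i k * (\<Sum>h<n. P j h * Z k h))) =
      (\<Sum>k<n. \<Sum>h<n. Z k h * V k h)" for Z
  proof -
    have "(\<Sum>j<n. (\<Sum>h<n. P j h * Z k h) * U k j) = (\<Sum>h<n. Z k h * V k h)" for k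
    proof -
      have "(\<Sum>j<n. (\<Sum>h<n. P j h * Z k h) * U k j) = (\<Sum>j<n. \<Sum>h<n. Z k h * (U k j * P j h))"
        by (simp add: sum_distrib_left sum_distrib_right mult_ac)
      also have "\<dots> = (\<Sum>h<n. \<Sum>j<n. Z k h * (U k j * P j h))" by (rule sum.swap)
      finally show ?thesis by (simp add: V_def sum_distrib_left)
    qed
    then show ?thesis unfolding quad1 by simp
  qed
  have PYs: "(\<Sum>k<n. P i k * Ys k j) = Ys i j" if "i < n" "j < n" for i j
  proof -
    have "(\<Sum>k<n. P i k * Ys k j) = Ys i j * (\<Sum>k<n. if c k = c i then \<theta> k else 0) / G n c \<theta> (c i)"
      unfolding sum_distrib_left sum_divide_distrib
      by (intro sum.cong) (auto simp: P_def cluster_proj_def Ys_def)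
    then show ?thesis using gpos[OF that(1)] unfolding G_eq_sum[symmetric] by simp
  qed
  have Ys_sym: "Ys i j = Ys j i" for i j by (simp add: Ys_def eq_commute)
  \<comment> \<open>\<open>Ys\<close> is constant on clusters in both indices, hence fixed by
    averaging. Its splitting has the same two terms as the one of \<open>Y\<close> below, but no
    remainder, so the difference of the two involves \<open>Y - Ys\<close> only.\<close>
  have WYs: "(\<Sum>i<n. \<Sum>j<n. W i j * Ys i j) =
      2 * (\<Sum>k<n. \<Sum>j<n. Ys k j * U k j) - (\<Sum>k<n. \<Sum>j<n. Ys k j * V k j)"
  proof -
    have "(\<Sum>k<n. \<Sum>j<n. Ys k j * U k j) = (\<Sum>i<n. \<Sum>j<n. W i j * Ys i j)"
      unfolding quad1[symmetric] by (intro sum.cong refl) (simp add: PYs)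
    moreover have "(\<Sum>h<n. P j h * Ys k h) = Ys k j" if "k < n" "j < n" for j k
      using PYs[of j k] that by (simp add: Ys_sym)
    then have "(\<Sum>k<n. \<Sum>j<n. Ys k j * V k j) = (\<Sum>i<n. \<Sum>j<n. W i j * Ys i j)"
      unfolding quad2[symmetric] by (intro sum.cong refl) (simp add: PYs)
    ultimately show ?thesis by simp
  qed
  have msum: "(\<Sum>l<n. m l i * v l j) = (\<Sum>k<n. P i k * Y k j)" if "j < n" for i j
  proof -
    have "(\<Sum>l<n. m l i * v l j) = (\<Sum>l<n. \<Sum>k<n. P i k * (v l k * v l j))"
      by (simp add: m_def cluster_mean_def P_def sum_distrib_left sum_distrib_right mult_ac)
    also have "\<dots> = (\<Sum>k<n. \<Sum>l<n. P i k * (v l k * v l j))" by (rule sum.swap)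
    finally show ?thesis using that by (simp add: gram sum_distrib_left)
  qed
  have mmsum: "(\<Sum>l<n. m l i * m l j) = (\<Sum>k<n. P i k * (\<Sum>h<n. P j h * Y k h))" for i j
  proof -
    have "(\<Sum>l<n. m l i * m l j) = (\<Sum>l<n. \<Sum>h<n. P j h * (m l i * v l h))"
      by (subst (2) m_def) (simp add: cluster_mean_def P_def sum_distrib_left mult_ac)
    also have "\<dots> = (\<Sum>h<n. \<Sum>l<n. P j h * (m l i * v l h))" by (rule sum.swap)
    also have "\<dots> = (\<Sum>h<n. P j h * (\<Sum>k<n. P i k * Y k h))"
      by (simp add: msum sum_distrib_left[symmetric])
    also have "\<dots> = (\<Sum>h<n. \<Sum>k<n. P i k * (P j h * Y k h))"
      by (simp add: sum_distrib_left mult_ac)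
    also have "\<dots> = (\<Sum>k<n. \<Sum>h<n. P i k * (P j h * Y k h))" by (rule sum.swap)
    finally show ?thesis by (simp add: sum_distrib_left)
  qed
  have swap3: "(\<Sum>l<n. \<Sum>i<n. \<Sum>j<n. W i j * F l i j) = (\<Sum>i<n. \<Sum>j<n. W i j * (\<Sum>l<n. F l i j))"
    for F :: "nat \<Rightarrow> nat \<Rightarrow> nat \<Rightarrow> real"
  proof -
    have "(\<Sum>l<n. \<Sum>i<n. \<Sum>j<n. W i j * F l i j) = (\<Sum>i<n. \<Sum>l<n. \<Sum>j<n. W i j * F l i j)"
      by (rule sum.swap)
    also have "\<dots> = (\<Sum>i<n. \<Sum>j<n. \<Sum>l<n. W i j * F l i j)" by (intro sum.cong refl sum.swap)
    finally show ?thesis by (simp add: sum_distrib_left)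
  qed
  define rem where "rem = (\<Sum>l<n. \<Sum>i<n. \<Sum>j<n. W i j * ((v l i - m l i) * (v l j - m l j)))"
  have "(\<Sum>i<n. \<Sum>j<n. W i j * Y i j) = (\<Sum>l<n. \<Sum>i<n. \<Sum>j<n. W i j * (v l i * v l j))"
    unfolding swap3 by (intro sum.cong refl) (simp add: gram)
  also have "\<dots> = 2 * (\<Sum>l<n. \<Sum>i<n. \<Sum>j<n. W i j * (m l i * v l j))
      - (\<Sum>l<n. \<Sum>i<n. \<Sum>j<n. W i j * (m l i * m l j)) + rem"
  proof -
    have "(\<Sum>i<n. \<Sum>j<n. W i j * (v l i * v l j)) =
        2 * (\<Sum>i<n. \<Sum>j<n. W i j * (m l i * v l j)) - (\<Sum>i<n. \<Sum>j<n. W i j * (m l i * m l j)) +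
        (\<Sum>i<n. \<Sum>j<n. W i j * ((v l i - m l i) * (v l j - m l j)))" for l
      unfolding m_def by (rule cluster_mean_noise[OF sym])
    then show ?thesis
      unfolding rem_def by (simp only: sum.distrib sum_subtractf sum_distrib_left[symmetric])
  qed
  also have "(\<Sum>l<n. \<Sum>i<n. \<Sum>j<n. W i j * (m l i * v l j)) = (\<Sum>k<n. \<Sum>j<n. Y k j * U k j)"
    unfolding swap3 quad1[symmetric] by (intro sum.cong refl) (simp add: msum)
  also have "(\<Sum>l<n. \<Sum>i<n. \<Sum>j<n. W i j * (m l i * m l j)) = (\<Sum>k<n. \<Sum>j<n. Y k j * V k j)"
    unfolding swap3 quad2[symmetric] by (intro sum.cong refl) (simp add: mmsum)
  finally have WY: "(\<Sum>i<n. \<Sum>j<n. W i j * Y i j) =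
      2 * (\<Sum>k<n. \<Sum>j<n. Y k j * U k j) - (\<Sum>k<n. \<Sum>j<n. Y k j * V k j) + rem" .
  define N where "N = (\<Sum>i<n. \<Sum>j<n. \<theta> i * \<theta> j * \<bar>Y i j - Ys i j\<bar>)"
  have rem: "rem \<le> \<kappa> * N"
  proof -
    have "rem \<le> (\<Sum>l<n. \<kappa> * (\<Sum>i<n. G n c \<theta> (c i) * \<theta> i * (v l i - m l i)\<^sup>2))"
      unfolding rem_def by (intro sum_mono spec)
    also have "\<dots> = \<kappa> * (\<Sum>l<n. \<Sum>i<n. \<Sum>j<n. if c i = c j then
        \<theta> i * \<theta> j * ((v l i)\<^sup>2 + (v l j)\<^sup>2 - 2 * (v l i * v l j)) / 2 else 0)"
      unfolding m_def by (simp add: weighted_variance[OF pos] sum_distrib_left)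
    also have "(\<Sum>l<n. \<Sum>i<n. \<Sum>j<n. if c i = c j then
        \<theta> i * \<theta> j * ((v l i)\<^sup>2 + (v l j)\<^sup>2 - 2 * (v l i * v l j)) / 2 else 0) =
      (\<Sum>i<n. \<Sum>j<n. \<Sum>l<n. if c i = c j then
        \<theta> i * \<theta> j * ((v l i)\<^sup>2 + (v l j)\<^sup>2 - 2 * (v l i * v l j)) / 2 else 0)"
      by (subst sum.swap) (intro sum.cong refl sum.swap)
    also have "\<dots> = (\<Sum>i<n. \<Sum>j<n. if c i = c j then \<theta> i * \<theta> j * (Y i i + Y j j - 2 * Y i j) / 2 else 0)"
    proof (intro sum.cong refl)
      fix i j assume "i \<in> {..<n}" "j \<in> {..<n}"
      then have "Y i i + Y j j - 2 * Y i j = (\<Sum>l<n. (v l i)\<^sup>2 + (v l j)\<^sup>2 - 2 * (v l i * v l j))"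
        by (simp add: gram sum.distrib sum_subtractf sum_distrib_left power2_eq_square)
      then show "(\<Sum>l<n. if c i = c j then \<theta> i * \<theta> j * ((v l i)\<^sup>2 + (v l j)\<^sup>2 - 2 * (v l i * v l j)) / 2 else 0)
          = (if c i = c j then \<theta> i * \<theta> j * (Y i i + Y j j - 2 * Y i j) / 2 else 0)"
        by (simp add: sum_distrib_left sum_divide_distrib)
    qed
    also have "\<dots> \<le> N"
      unfolding N_def
    proof (intro sum_mono)
      fix i j assume ij: "i \<in> {..<n}" "j \<in> {..<n}"
      have "(1 - Y i j) \<le> \<bar>Y i j - Ys i j\<bar>" if "c i = c j" using that by (simp add: Ys_def)
      then show "(if c i = c j then \<theta> i * \<theta> j * (Y i i + Y j j - 2 * Y i j) / 2 else 0)
          \<le> \<theta> i * \<theta> j * \<bar>Y i j - Ys i j\<bar>"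
        using ij pos[of i] pos[of j] diag[of i] diag[of j] by auto
    qed
    finally show ?thesis using \<kappa> by (simp add: mult_left_mono)
  qed
  have bnd: "\<bar>\<Sum>k<n. \<Sum>j<n. (Y k j - Ys k j) * T k j\<bar> \<le> \<epsilon> * N"
    if T: "\<And>k j. k < n \<Longrightarrow> j < n \<Longrightarrow> \<bar>T k j\<bar> \<le> \<epsilon> * (\<theta> k * \<theta> j)" for T
  proof -
    have "\<bar>\<Sum>k<n. \<Sum>j<n. (Y k j - Ys k j) * T k j\<bar> \<le> (\<Sum>k<n. \<Sum>j<n. \<bar>(Y k j - Ys k j) * T k j\<bar>)"
      by (intro order_trans[OF sum_abs] sum_mono sum_abs)
    also have "\<dots> \<le> (\<Sum>k<n. \<Sum>j<n. \<epsilon> * (\<theta> k * \<theta> j * \<bar>Y k j - Ys k j\<bar>))"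
    proof (intro sum_mono)
      fix k j assume "k \<in> {..<n}" "j \<in> {..<n}"
      then have "\<bar>Y k j - Ys k j\<bar> * \<bar>T k j\<bar> \<le> \<bar>Y k j - Ys k j\<bar> * (\<epsilon> * (\<theta> k * \<theta> j))"
        using T by (intro mult_left_mono) auto
      then show "\<bar>(Y k j - Ys k j) * T k j\<bar> \<le> \<epsilon> * (\<theta> k * \<theta> j * \<bar>Y k j - Ys k j\<bar>)"
        by (simp add: abs_mult mult_ac)
    qed
    finally show ?thesis by (simp add: N_def sum_distrib_left)
  qed
  have "(\<Sum>i<n. \<Sum>j<n. W i j * (Y i j - Ys i j)) =
      2 * (\<Sum>k<n. \<Sum>j<n. (Y k j - Ys k j) * U k j) - (\<Sum>k<n. \<Sum>j<n. (Y k j - Ys k j) * V k j) + rem"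
    using WY WYs by (simp add: algebra_simps sum_subtractf)
  then show ?thesis
    using bnd[of U, OF U] bnd[of V, OF V] rem unfolding N_def[symmetric] by (simp add: algebra_simps)
qed


section \<open>Bernoulli sums\<close>

text \<open>The factors will be powers of centred entries, which take both signs; integrability is
  assumed instead of nonnegativity.\<close>

lemma expectation_prod_Pi_pmf_signed:
  fixes f :: "'a \<Rightarrow> 'b \<Rightarrow> real"
  assumes "finite A" and "\<And>x. x \<in> A \<Longrightarrow> integrable (measure_pmf (p x)) (f x)"
  shows "measure_pmf.expectation (Pi_pmf A dflt p) (\<lambda>y. \<Prod>x\<in>A. f x (y x)) =
    (\<Prod>x\<in>A. measure_pmf.expectation (p x) (f x))"
proof -
  have comp: "map_pmf (\<lambda>y. y x) (Pi_pmf A dflt p) = p x" if "x \<in> A" for x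
    using Pi_pmf_component[OF assms(1), of x dflt p] that by simp
  have int: "integrable (measure_pmf (Pi_pmf A dflt p)) (\<lambda>y. f x (y x))" if "x \<in> A" for x
    using assms(2)[OF that] unfolding comp[OF that, symmetric]
    by (simp add: map_pmf_rep_eq integrable_distr_eq)
  have "prob_space.indep_vars (measure_pmf (Pi_pmf A dflt p)) (\<lambda>_. borel)
      (\<lambda>x y. f x (y x)) A"
    using prob_space.indep_vars_compose2[OF measure_pmf.prob_space_axioms indep_vars_Pi_pmf[OF assms(1)], of f "\<lambda>_. borel" dflt p]
    by simp
  then have "measure_pmf.expectation (Pi_pmf A dflt p) (\<lambda>y. \<Prod>x\<in>A. f x (y x)) =
      (\<Prod>x\<in>A. measure_pmf.expectation (Pi_pmf A dflt p) (\<lambda>y. f x (y x)))"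
    by (intro prob_space.indep_vars_lebesgue_integral[OF measure_pmf.prob_space_axioms] assms(1) int)
  also have "\<dots> = (\<Prod>x\<in>A. measure_pmf.expectation (p x) (f x))"
    by (intro prod.cong refl, subst comp[symmetric]) auto
  finally show ?thesis .
qed

lemma expectation_bernoulli:
  fixes f :: "bool \<Rightarrow> real"
  assumes "0 \<le> q" "q \<le> 1"
  shows "measure_pmf.expectation (bernoulli_pmf q) f = q * f True + (1 - q) * f False"
  using assms by (subst integral_measure_pmf[of UNIV]) (auto simp: UNIV_bool)

lemma exp_le_quadratic:
  fixes u :: real
  assumes "\<bar>u\<bar> \<le> 1"
  shows "exp u \<le> 1 + u + u\<^sup>2"
proof (cases "u \<ge> 0")
  case True
  then show ?thesis using exp_bound[of u] assms by simp
next
  case False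
  define x where "x = - u"
  have x: "x > 0" "x \<le> 1" using False assms by (auto simp: x_def)
  have "exp u = 1 / exp x" by (simp add: x_def exp_minus divide_simps)
  also have "\<dots> \<le> 1 / (1 + x)" using x exp_ge_add_one_self[of x] by (intro divide_left_mono) auto
  also have "\<dots> \<le> 1 - x + x\<^sup>2"
  proof -
    have "(1 - x + x\<^sup>2) * (1 + x) = 1 + x ^ 3" by (simp add: algebra_simps power2_eq_square power3_eq_cube)
    then show ?thesis using x by (simp add: pos_divide_le_eq)
  qed
  finally show ?thesis by (simp add: x_def)
qed

text \<open>The factor \<open>q\<close> in the exponent keeps track of the variance; Hoeffding's
  lemma would give a bound that does not improve for sparse edges.\<close>

lemma bernoulli_centered_mgf:
  fixes q u :: real
  assumes "0 \<le> q" "q \<le> 1" "\<bar>u\<bar> \<le> 1"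
  shows "measure_pmf.expectation (bernoulli_pmf q) (\<lambda>b. exp (u * (of_bool b - q))) \<le> exp (q * u\<^sup>2)"
proof -
  have "measure_pmf.expectation (bernoulli_pmf q) (\<lambda>b. exp (u * (of_bool b - q))) =
      exp (- u * q) * (1 + q * (exp u - 1))"
    using assms by (simp add: expectation_bernoulli algebra_simps exp_diff exp_minus exp_add field_simps)
  also have "\<dots> \<le> exp (- u * q) * exp (q * (exp u - 1))"
    by (intro mult_left_mono exp_ge_add_one_self) simp
  also have "\<dots> = exp (q * (exp u - 1 - u))"
    by (simp add: exp_add[symmetric] algebra_simps)
  also have "\<dots> \<le> exp (q * u\<^sup>2)"
    using exp_le_quadratic[OF assms(3)] assms(1) by (auto intro!: mult_left_mono)
  finally show ?thesis .
qed

lemma finite_set_Pi_bool [simp]: "finite I \<Longrightarrow> finite (set_pmf (Pi_pmf I d p))"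
  for p :: "'a \<Rightarrow> bool pmf"
  by (rule finite_subset[OF set_Pi_pmf_subset']) (auto intro!: finite_PiE_dflt)

text \<open>Chernoff's method with deviations relative to an upper bound \<open>V\<close> of the
  mean; the sign \<open>\<sigma>\<close> treats both tails at once.\<close>

lemma bernoulli_sum_upper_tail:
  fixes P :: "'a \<Rightarrow> real" and \<sigma> :: real
  assumes "finite I" "F \<subseteq> I" "\<And>e. e \<in> I \<Longrightarrow> 0 \<le> P e \<and> P e \<le> 1"
    and "(\<Sum>e\<in>F. P e) \<le> V" "0 \<le> \<eta>" "\<eta> \<le> 1" "\<bar>\<sigma>\<bar> = 1"
  shows "measure_pmf.prob (Pi_pmf I False (\<lambda>e. bernoulli_pmf (P e)))
    {\<omega>. \<eta> * V \<le> \<sigma> * (\<Sum>e\<in>F. of_bool (\<omega> e) - P e)} \<le> exp (- \<eta>\<^sup>2 * V / 4)"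
proof -
  \<comment> \<open>This minimises \<open>V * s\<^sup>2 - s * \<eta> * V\<close>, and
    \<open>\<eta> \<le> 1\<close> keeps it in the range of the quadratic bound for
    \<open>exp\<close>.\<close>
  define s where "s = \<eta> / 2"
  define M where "M = Pi_pmf I False (\<lambda>e. bernoulli_pmf (P e))"
  have fin: "finite F" using assms finite_subset by auto
  have int: "integrable (measure_pmf M) h" for h :: "_ \<Rightarrow> real"
    unfolding M_def using assms(1) by (intro integrable_measure_pmf_finite) simp
  have u: "\<bar>\<sigma> * s\<bar> \<le> 1" using assms by (simp add: s_def abs_mult)
  have u2: "(\<sigma> * s)\<^sup>2 = s\<^sup>2" using assms(7) by (metis mult_1 power2_abs abs_mult)
  have "measure_pmf.expectation M (\<lambda>\<omega>. exp (s * (\<sigma> * (\<Sum>e\<in>F. of_bool (\<omega> e) - P e)))) =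
      measure_pmf.expectation M (\<lambda>\<omega>. \<Prod>e\<in>I. (if e \<in> F then exp (\<sigma> * s * (of_bool (\<omega> e) - P e)) else 1))"
  proof (intro Bochner_Integration.integral_cong refl)
    fix \<omega> :: "'a \<Rightarrow> bool"
    have "exp (s * (\<sigma> * (\<Sum>e\<in>F. of_bool (\<omega> e) - P e))) = (\<Prod>e\<in>F. exp (\<sigma> * s * (of_bool (\<omega> e) - P e)))"
      by (simp add: exp_sum[OF fin, symmetric] sum_distrib_left mult_ac)
    also have "\<dots> = (\<Prod>e\<in>I. (if e \<in> F then exp (\<sigma> * s * (of_bool (\<omega> e) - P e)) else 1))"
      using assms(1,2) by (intro prod.mono_neutral_cong_left) auto
    finally show "exp (s * (\<sigma> * (\<Sum>e\<in>F. of_bool (\<omega> e) - P e))) = \<dots>" .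
  qed
  also have "\<dots> = (\<Prod>e\<in>I. measure_pmf.expectation (bernoulli_pmf (P e))
      (\<lambda>b. if e \<in> F then exp (\<sigma> * s * (of_bool b - P e)) else 1))"
    unfolding M_def by (intro expectation_prod_Pi_pmf_signed assms(1) integrable_measure_pmf_finite) simp
  also have "\<dots> \<le> (\<Prod>e\<in>I. if e \<in> F then exp (P e * s\<^sup>2) else 1)"
    using bernoulli_centered_mgf[OF _ _ u] assms(3) unfolding u2
    by (intro prod_mono) (auto intro!: integral_nonneg)
  also have "\<dots> = (\<Prod>e\<in>F. exp (P e * s\<^sup>2))"
    using assms(1,2) by (intro prod.mono_neutral_cong_right) auto
  also have "\<dots> = exp ((\<Sum>e\<in>F. P e) * s\<^sup>2)"
    by (simp add: exp_sum[OF fin, symmetric] sum_distrib_right)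
  also have "\<dots> \<le> exp (V * s\<^sup>2)" using assms(4) by (simp add: mult_right_mono)
  finally have E: "measure_pmf.expectation M (\<lambda>\<omega>. exp (s * (\<sigma> * (\<Sum>e\<in>F. of_bool (\<omega> e) - P e)))) \<le> exp (V * s\<^sup>2)" .
  have "measure_pmf.prob M {\<omega>. \<eta> * V \<le> \<sigma> * (\<Sum>e\<in>F. of_bool (\<omega> e) - P e)}
      \<le> measure_pmf.prob M {\<omega> \<in> space (measure_pmf M). exp (s * (\<eta> * V)) \<le> exp (s * (\<sigma> * (\<Sum>e\<in>F. of_bool (\<omega> e) - P e)))}"
    using assms(5) by (intro measure_pmf.finite_measure_mono) (auto simp: s_def mult_left_mono)
  also have "\<dots> \<le> measure_pmf.expectation M (\<lambda>\<omega>. exp (s * (\<sigma> * (\<Sum>e\<in>F. of_bool (\<omega> e) - P e)))) / exp (s * (\<eta> * V))"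
    by (intro integral_Markov_inequality_measure[where A = "{}"] int) auto
  also have "\<dots> \<le> exp (V * s\<^sup>2) / exp (s * (\<eta> * V))" using E by (intro divide_right_mono) auto
  also have "\<dots> = exp (- \<eta>\<^sup>2 * V / 4)"
    by (simp add: exp_diff[symmetric] s_def power2_eq_square field_simps)
  finally show ?thesis by (simp add: M_def)
qed

lemma bernoulli_sum_tail:
  fixes P :: "'a \<Rightarrow> real"
  assumes "finite I" "F \<subseteq> I" "\<And>e. e \<in> I \<Longrightarrow> 0 \<le> P e \<and> P e \<le> 1"
    and "(\<Sum>e\<in>F. P e) \<le> V" "0 \<le> \<eta>" "\<eta> \<le> 1"
  shows "measure_pmf.prob (Pi_pmf I False (\<lambda>e. bernoulli_pmf (P e)))
    {\<omega>. \<eta> * V \<le> \<bar>\<Sum>e\<in>F. of_bool (\<omega> e) - P e\<bar>} \<le> 2 * exp (- \<eta>\<^sup>2 * V / 4)"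
proof -
  let ?M = "Pi_pmf I False (\<lambda>e. bernoulli_pmf (P e))"
  let ?A = "\<lambda>\<sigma>. {\<omega>. \<eta> * V \<le> \<sigma> * (\<Sum>e\<in>F. of_bool (\<omega> e) - P e)}"
  have "measure_pmf.prob ?M {\<omega>. \<eta> * V \<le> \<bar>\<Sum>e\<in>F. of_bool (\<omega> e) - P e\<bar>} \<le> measure_pmf.prob ?M (?A 1 \<union> ?A (-1))"
    by (intro measure_pmf.finite_measure_mono) auto
  also have "\<dots> \<le> measure_pmf.prob ?M (?A 1) + measure_pmf.prob ?M (?A (-1))"
    by (intro measure_Un_le) auto
  also have "\<dots> \<le> exp (- \<eta>\<^sup>2 * V / 4) + exp (- \<eta>\<^sup>2 * V / 4)"
    by (intro add_mono bernoulli_sum_upper_tail assms) auto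
  finally show ?thesis by simp
qed


section \<open>Comparison of closed walks\<close>

definition sym_edge :: "nat \<Rightarrow> nat \<Rightarrow> nat \<times> nat" where
  "sym_edge i j = (min i j, max i j)"

definition sym_entry :: "(nat \<times> nat \<Rightarrow> real) \<Rightarrow> nat \<Rightarrow> nat \<Rightarrow> real" where
  "sym_entry x i j = (if i = j then 0 else x (sym_edge i j))"

lemma sym_edge_eq_iff: "sym_edge i j = sym_edge k l \<longleftrightarrow> (i = k \<and> j = l) \<or> (i = l \<and> j = k)"
  by (auto simp: sym_edge_def min_def max_def split: if_splits)

lemma sym_entry_commute: "sym_entry x i j = sym_entry x j i"
  by (simp add: sym_entry_def sym_edge_def min.commute max.commute)

text \<open>The endpoint is stored although it repeats the start, so that step \<open>t\<close>
  always leads from \<open>u t\<close> to \<open>u (Suc t)\<close> without reduction modulo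
  \<open>L\<close>.\<close>

definition closed_walks :: "nat set \<Rightarrow> nat \<Rightarrow> (nat \<Rightarrow> nat) set" where
  "closed_walks S L = {u \<in> {..L} \<rightarrow>\<^sub>E S. u L = u 0}"

definition walk_edge :: "(nat \<Rightarrow> nat) \<Rightarrow> nat \<Rightarrow> nat \<times> nat" where
  "walk_edge u t = sym_edge (u t) (u (Suc t))"

text \<open>Only loop-free walks without edges of multiplicity one contribute to the trace moments of a
  matrix with independent centred entries and zero diagonal.\<close>

definition doubled :: "nat \<Rightarrow> (nat \<Rightarrow> nat) \<Rightarrow> bool" where
  "doubled L u \<longleftrightarrow> (\<forall>t<L. u t \<noteq> u (Suc t) \<and> (\<exists>s<L. s \<noteq> t \<and> walk_edge u s = walk_edge u t))"

lemma finite_closed_walks [simp]: "finite S \<Longrightarrow> finite (closed_walks S L)"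
  unfolding closed_walks_def by (rule finite_subset[of _ "{..L} \<rightarrow>\<^sub>E S"]) (auto intro: finite_PiE)

text \<open>A step to a new vertex uses a new edge, because earlier edges have both ends among the
  vertices visited before.\<close>

lemma walk_vertices_le_edges: "card (u ` {..L}) \<le> Suc (card (walk_edge u ` {..<L}))"
proof (induction L)
  case (Suc L)
  show ?case
  proof (cases "u (Suc L) \<in> u ` {..L}")
    case True
    then have "u ` {..Suc L} = u ` {..L}" by (auto simp: atMost_Suc)
    moreover have "card (walk_edge u ` {..<L}) \<le> card (walk_edge u ` {..<Suc L})"
      by (intro card_mono) auto
    ultimately show ?thesis using Suc by simp
  next
    case False
    have "walk_edge u L \<notin> walk_edge u ` {..<L}"
    proof
      assume "walk_edge u L \<in> walk_edge u ` {..<L}"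
      then obtain t where t: "t < L" "walk_edge u L = walk_edge u t" by auto
      then have "u (Suc L) = u t \<or> u (Suc L) = u (Suc t)"
        by (auto simp: walk_edge_def sym_edge_eq_iff)
      then show False using False t by auto
    qed
    then have "card (walk_edge u ` {..<Suc L}) = Suc (card (walk_edge u ` {..<L}))"
      by (simp add: lessThan_Suc)
    moreover have "card (u ` {..Suc L}) = Suc (card (u ` {..L}))"
      using False by (simp add: atMost_Suc)
    ultimately show ?thesis using Suc by simp
  qed
qed simp

lemma walk_product_multiplicity:
  fixes x :: "nat \<times> nat \<Rightarrow> real"
  assumes "finite I" "walk_edge u ` {..<L} \<subseteq> I"
  shows "(\<Prod>t<L. x (walk_edge u t)) = (\<Prod>e\<in>I. x e ^ card {t\<in>{..<L}. walk_edge u t = e})"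
proof -
  have "(\<Prod>t<L. x (walk_edge u t)) = (\<Prod>e\<in>I. \<Prod>t\<in>{t\<in>{..<L}. walk_edge u t = e}. x (walk_edge u t))"
    using assms by (intro prod.group[symmetric]) auto
  also have "\<dots> = (\<Prod>e\<in>I. \<Prod>t\<in>{t\<in>{..<L}. walk_edge u t = e}. x e)"
    by (intro prod.cong refl) auto
  finally show ?thesis by simp
qed

lemma doubled_multiplicity:
  assumes "doubled L u" "e \<in> walk_edge u ` {..<L}"
  shows "card {t\<in>{..<L}. walk_edge u t = e} \<ge> 2"
proof -
  obtain t where t: "t < L" "walk_edge u t = e" using assms(2) by auto
  then obtain s where s: "s < L" "s \<noteq> t" "walk_edge u s = e"
    using assms(1) unfolding doubled_def by metis
  have "card {s, t} \<le> card {t\<in>{..<L}. walk_edge u t = e}"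
    using s t by (intro card_mono) auto
  then show ?thesis using s by simp
qed

lemma not_doubled_multiplicity:
  assumes "\<not> doubled L u" "\<forall>t<L. u t \<noteq> u (Suc t)"
  obtains e where "e \<in> walk_edge u ` {..<L}" "card {t\<in>{..<L}. walk_edge u t = e} = 1"
proof -
  obtain t where t: "t < L" "\<And>s. s < L \<Longrightarrow> s \<noteq> t \<Longrightarrow> walk_edge u s \<noteq> walk_edge u t"
    using assms unfolding doubled_def by blast
  then have "{s\<in>{..<L}. walk_edge u s = walk_edge u t} = {t}" by auto
  then show ?thesis using that[of "walk_edge u t"] t by simp
qed

lemma doubled_edges_le:
  assumes "doubled (2 * k) u"
  shows "card (walk_edge u ` {..<2 * k}) \<le> k"
proof -
  let ?E = "walk_edge u ` {..<2 * k}"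
  have "2 * card ?E = (\<Sum>e\<in>?E. 2)" by simp
  also have "\<dots> \<le> (\<Sum>e\<in>?E. card {t\<in>{..<2 * k}. walk_edge u t = e})"
    using doubled_multiplicity[OF assms] by (intro sum_mono) auto
  also have "\<dots> = (\<Sum>e\<in>?E. \<Sum>t\<in>{t\<in>{..<2 * k}. walk_edge u t = e}. 1)" by simp
  also have "\<dots> = (\<Sum>t<2 * k. 1)" by (intro sum.group) auto
  finally show ?thesis by simp
qed

text \<open>Serves for two matrices: the rescaled noise of the block model, whose trace moment is
  bounded above by walk counts, and the small comparison matrix, whose trace moment bounds walk
  counts.\<close>

locale random_entries =
  fixes I :: "(nat \<times> nat) set" and P :: "nat \<times> nat \<Rightarrow> real"
    and f :: "nat \<times> nat \<Rightarrow> bool \<Rightarrow> real" and S :: "nat set"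
  assumes finite_I: "finite I" and finite_S: "finite S"
    and edges: "\<And>i j. i \<in> S \<Longrightarrow> j \<in> S \<Longrightarrow> i < j \<Longrightarrow> (i, j) \<in> I"
    and centred: "\<And>e. e \<in> I \<Longrightarrow> measure_pmf.expectation (bernoulli_pmf (P e)) (f e) = 0"
begin

definition "M = Pi_pmf I False (\<lambda>e. bernoulli_pmf (P e))"

definition X :: "(nat \<times> nat \<Rightarrow> bool) \<Rightarrow> nat \<Rightarrow> nat \<Rightarrow> real" where
  "X \<omega> = sym_entry (\<lambda>e. f e (\<omega> e))"

lemma integrable_M [simp]: "integrable (measure_pmf M) (h :: _ \<Rightarrow> real)"
  unfolding M_def using finite_I by (intro integrable_measure_pmf_finite) simp

lemma walk_edge_in_I:
  assumes "u \<in> closed_walks S L" "\<forall>t<L. u t \<noteq> u (Suc t)"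
  shows "walk_edge u ` {..<L} \<subseteq> I"
proof (intro subsetI, elim imageE)
  fix e t assume e: "e = walk_edge u t" "t \<in> {..<L}"
  then have "u t \<in> S" "u (Suc t) \<in> S" "u t \<noteq> u (Suc t)"
    using assms by (auto simp: closed_walks_def PiE_def Pi_def)
  then show "e \<in> I" unfolding e walk_edge_def sym_edge_def
    using edges[of "u t" "u (Suc t)"] edges[of "u (Suc t)" "u t"]
    by (cases "u t < u (Suc t)") (auto simp: min_def max_def)
qed

lemma walk_expectation:
  assumes "u \<in> closed_walks S L" "\<forall>t<L. u t \<noteq> u (Suc t)"
  shows "measure_pmf.expectation M (\<lambda>\<omega>. \<Prod>t<L. X \<omega> (u t) (u (Suc t))) =
    (\<Prod>e\<in>walk_edge u ` {..<L}. measure_pmf.expectation (bernoulli_pmf (P e))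
       (\<lambda>b. f e b ^ card {t\<in>{..<L}. walk_edge u t = e}))"
proof -
  have "(\<Prod>t<L. X \<omega> (u t) (u (Suc t))) = (\<Prod>e\<in>I. f e (\<omega> e) ^ card {t\<in>{..<L}. walk_edge u t = e})" for \<omega>
  proof -
    have "(\<Prod>t<L. X \<omega> (u t) (u (Suc t))) = (\<Prod>t<L. (\<lambda>e. f e (\<omega> e)) (walk_edge u t))"
      using assms(2) by (intro prod.cong refl) (simp add: X_def sym_entry_def walk_edge_def)
    then show ?thesis
      using walk_product_multiplicity[OF finite_I walk_edge_in_I[OF assms], of "\<lambda>e. f e (\<omega> e)"] by simp
  qed
  then have "measure_pmf.expectation M (\<lambda>\<omega>. \<Prod>t<L. X \<omega> (u t) (u (Suc t))) =
      (\<Prod>e\<in>I. measure_pmf.expectation (bernoulli_pmf (P e)) (\<lambda>b. f e b ^ card {t\<in>{..<L}. walk_edge u t = e}))"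
    unfolding M_def
    by (simp, intro expectation_prod_Pi_pmf_signed[OF finite_I] integrable_measure_pmf_finite) simp
  also have "\<dots> = (\<Prod>e\<in>walk_edge u ` {..<L}. measure_pmf.expectation (bernoulli_pmf (P e))
       (\<lambda>b. f e b ^ card {t\<in>{..<L}. walk_edge u t = e}))"
  proof (intro prod.mono_neutral_right finite_I walk_edge_in_I[OF assms] ballI)
    fix e assume "e \<in> I - walk_edge u ` {..<L}"
    then have "{t\<in>{..<L}. walk_edge u t = e} = {}" by auto
    then have "card {t\<in>{..<L}. walk_edge u t = e} = 0" by (simp only: card.empty)
    then show "measure_pmf.expectation (bernoulli_pmf (P e)) (\<lambda>b. f e b ^ card {t\<in>{..<L}. walk_edge u t = e}) = 1"
      by (simp only: power_0) simp
  qed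
  finally show ?thesis .
qed

text \<open>A loop meets the zero diagonal. Otherwise some edge is passed exactly once and
  contributes, by independence, the vanishing mean of its entry as a factor.\<close>

lemma walk_expectation_not_doubled:
  assumes "u \<in> closed_walks S L" "\<not> doubled L u"
  shows "measure_pmf.expectation M (\<lambda>\<omega>. \<Prod>t<L. X \<omega> (u t) (u (Suc t))) = 0"
proof (cases "\<exists>t<L. u t = u (Suc t)")
  case True
  then have "(\<Prod>t<L. X \<omega> (u t) (u (Suc t))) = 0" for \<omega>
    by (intro prod_zero) (auto simp: X_def sym_entry_def)
  then show ?thesis by (simp only:) simp
next
  case False
  then have ne: "\<forall>t<L. u t \<noteq> u (Suc t)" by auto
  obtain e where e: "e \<in> walk_edge u ` {..<L}" "card {t\<in>{..<L}. walk_edge u t = e} = 1"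
    using not_doubled_multiplicity[OF assms(2) ne] by blast
  then have "e \<in> I" using walk_edge_in_I[OF assms(1) ne] by auto
  then have "measure_pmf.expectation (bernoulli_pmf (P e)) (\<lambda>b. f e b ^ card {t\<in>{..<L}. walk_edge u t = e}) = 0"
    unfolding e(2) using centred by simp
  then show ?thesis unfolding walk_expectation[OF assms(1) ne]
    using e(1) by (intro prod_zero) auto
qed

lemma trace_expectation:
  "measure_pmf.expectation M (\<lambda>\<omega>. \<Sum>u\<in>closed_walks S L. \<Prod>t<L. X \<omega> (u t) (u (Suc t))) =
   (\<Sum>u\<in>{u\<in>closed_walks S L. doubled L u}. measure_pmf.expectation M (\<lambda>\<omega>. \<Prod>t<L. X \<omega> (u t) (u (Suc t))))"
proof -
  have "measure_pmf.expectation M (\<lambda>\<omega>. \<Sum>u\<in>closed_walks S L. \<Prod>t<L. X \<omega> (u t) (u (Suc t))) =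
      (\<Sum>u\<in>closed_walks S L. measure_pmf.expectation M (\<lambda>\<omega>. \<Prod>t<L. X \<omega> (u t) (u (Suc t))))"
    by (intro Bochner_Integration.integral_sum) simp
  then show ?thesis
    using finite_S walk_expectation_not_doubled
    by (simp, intro sum.mono_neutral_right) auto
qed

text \<open>Each edge of a doubled walk costs one factor \<open>\<rho>\<close>, whatever its
  multiplicity. The exponent is weakened from edges to vertices, using
  \<open>\<rho> \<le> 1\<close>, because the number of walks of a given shape depends on the number
  of vertices.\<close>

lemma trace_expectation_upper:
  assumes "0 \<le> \<rho>" "\<rho> \<le> 1"
    and "\<And>e j. e \<in> I \<Longrightarrow> j \<ge> 2 \<Longrightarrow> \<bar>measure_pmf.expectation (bernoulli_pmf (P e)) (\<lambda>b. f e b ^ j)\<bar> \<le> \<rho>"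
  shows "measure_pmf.expectation M (\<lambda>\<omega>. \<Sum>u\<in>closed_walks S L. \<Prod>t<L. X \<omega> (u t) (u (Suc t))) \<le>
    (\<Sum>u\<in>{u\<in>closed_walks S L. doubled L u}. \<rho> ^ (card (u ` {..L}) - 1))"
  unfolding trace_expectation
proof (intro sum_mono)
  fix u assume "u \<in> {u\<in>closed_walks S L. doubled L u}"
  then have u: "u \<in> closed_walks S L" "doubled L u" by auto
  then have ne: "\<forall>t<L. u t \<noteq> u (Suc t)" by (auto simp: doubled_def)
  have "measure_pmf.expectation M (\<lambda>\<omega>. \<Prod>t<L. X \<omega> (u t) (u (Suc t))) \<le>
      (\<Prod>e\<in>walk_edge u ` {..<L}. \<bar>measure_pmf.expectation (bernoulli_pmf (P e))
       (\<lambda>b. f e b ^ card {t\<in>{..<L}. walk_edge u t = e})\<bar>)"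
    unfolding walk_expectation[OF u(1) ne] abs_prod[symmetric] by (rule abs_ge_self)
  also have "\<dots> \<le> (\<Prod>e\<in>walk_edge u ` {..<L}. \<rho>)"
    using assms(3) doubled_multiplicity[OF u(2)] walk_edge_in_I[OF u(1) ne]
    by (intro prod_mono conjI abs_ge_zero) blast
  also have "\<dots> = \<rho> ^ card (walk_edge u ` {..<L})" by simp
  also have "\<dots> \<le> \<rho> ^ (card (u ` {..L}) - 1)"
    using assms(1,2) walk_vertices_le_edges[of u L] by (intro power_decreasing) auto
  finally show "measure_pmf.expectation M (\<lambda>\<omega>. \<Prod>t<L. X \<omega> (u t) (u (Suc t))) \<le> \<rho> ^ (card (u ` {..L}) - 1)" .
qed

text \<open>Turns a moment estimate for a random matrix into an upper bound for a purely
  combinatorial count.\<close>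

lemma trace_expectation_lower:
  assumes "\<And>e j. e \<in> I \<Longrightarrow> j \<ge> 2 \<Longrightarrow> measure_pmf.expectation (bernoulli_pmf (P e)) (\<lambda>b. f e b ^ j) \<ge> 1"
  shows "real (card {u\<in>closed_walks S L. doubled L u}) \<le>
    measure_pmf.expectation M (\<lambda>\<omega>. \<Sum>u\<in>closed_walks S L. \<Prod>t<L. X \<omega> (u t) (u (Suc t)))"
proof -
  have "1 \<le> measure_pmf.expectation M (\<lambda>\<omega>. \<Prod>t<L. X \<omega> (u t) (u (Suc t)))"
    if u: "u \<in> closed_walks S L" "doubled L u" for u
  proof -
    have ne: "\<forall>t<L. u t \<noteq> u (Suc t)" using u by (auto simp: doubled_def)
    show ?thesis unfolding walk_expectation[OF u(1) ne]
      using assms doubled_multiplicity[OF u(2)] walk_edge_in_I[OF u(1) ne]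
      by (intro prod_ge_1) blast
  qed
  then have "(\<Sum>u\<in>{u\<in>closed_walks S L. doubled L u}. 1) \<le>
      (\<Sum>u\<in>{u\<in>closed_walks S L. doubled L u}. measure_pmf.expectation M (\<lambda>\<omega>. \<Prod>t<L. X \<omega> (u t) (u (Suc t))))"
    by (intro sum_mono) auto
  then show ?thesis unfolding trace_expectation by simp
qed

end

section \<open>Shapes of walks and their injective relabellings\<close>

definition same_shape :: "nat \<Rightarrow> (nat \<Rightarrow> nat) \<Rightarrow> (nat \<Rightarrow> nat) \<Rightarrow> bool" where
  "same_shape L u w \<longleftrightarrow> (\<forall>s\<le>L. \<forall>t\<le>L. u s = u t \<longleftrightarrow> w s = w t)"

lemma same_shape_sym: "same_shape L u w \<longleftrightarrow> same_shape L w u"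
  by (auto simp: same_shape_def)

lemma same_shape_relabel:
  assumes "same_shape L u w"
  obtains g where "inj_on g (u ` {..L})" "\<And>t. t \<le> L \<Longrightarrow> w t = g (u t)"
proof -
  define g where "g = (\<lambda>a. w (SOME t. t \<le> L \<and> u t = a))"
  have g: "g (u t) = w t" if "t \<le> L" for t
  proof -
    have "(SOME s. s \<le> L \<and> u s = u t) \<le> L \<and> u (SOME s. s \<le> L \<and> u s = u t) = u t"
      by (rule someI[of _ t]) (use that in simp)
    then show ?thesis using assms that unfolding g_def same_shape_def by blast
  qed
  have "inj_on g (u ` {..L})"
    using assms by (auto simp: inj_on_def g same_shape_def)
  then show ?thesis using that[of g] g by simp
qed

lemma same_shape_card:
  assumes "same_shape L u w"
  shows "card (w ` {..L}) = card (u ` {..L})"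
proof -
  obtain g where g: "inj_on g (u ` {..L})" "\<And>t. t \<le> L \<Longrightarrow> w t = g (u t)"
    using same_shape_relabel[OF assms] by blast
  have "w ` {..L} = g ` u ` {..L}" using g(2) by (auto simp: image_image)
  then show ?thesis using card_image[OF g(1)] by simp
qed

lemma same_shape_doubled:
  assumes "same_shape L u w" "doubled L u"
  shows "doubled L w"
proof -
  have eq: "u s = u t \<longleftrightarrow> w s = w t" if "s \<le> L" "t \<le> L" for s t
    using assms(1) that by (simp add: same_shape_def)
  have "walk_edge u s = walk_edge u t \<longleftrightarrow> walk_edge w s = walk_edge w t" if "s < L" "t < L" for s t
    unfolding walk_edge_def sym_edge_eq_iff using that by (simp add: eq)
  moreover have "u t = u (Suc t) \<longleftrightarrow> w t = w (Suc t)" if "t < L" for t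
    using that by (simp add: eq)
  ultimately show ?thesis using assms(2) unfolding doubled_def by (metis (no_types))
qed

lemma same_shape_count_upper:
  assumes "finite S"
  shows "card {w\<in>closed_walks S L. same_shape L u w} \<le> card S ^ card (u ` {..L})"
proof -
  let ?R = "\<lambda>g. \<lambda>t\<in>{..L}. g (u t)"
  have "{w\<in>closed_walks S L. same_shape L u w} \<subseteq> ?R ` (u ` {..L} \<rightarrow>\<^sub>E S)"
  proof
    fix w assume "w \<in> {w\<in>closed_walks S L. same_shape L u w}"
    then have w: "w \<in> {..L} \<rightarrow>\<^sub>E S" "same_shape L u w" by (auto simp: closed_walks_def)
    obtain g where g: "inj_on g (u ` {..L})" "\<And>t. t \<le> L \<Longrightarrow> w t = g (u t)"
      using same_shape_relabel[OF w(2)] by blast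
    have "w = ?R (restrict g (u ` {..L}))"
      using w(1) g(2) by (intro ext) (auto simp: PiE_def extensional_def)
    moreover have "restrict g (u ` {..L}) \<in> u ` {..L} \<rightarrow>\<^sub>E S"
      using w(1) g(2) by (auto simp: PiE_def Pi_def)
    ultimately show "w \<in> ?R ` (u ` {..L} \<rightarrow>\<^sub>E S)" by blast
  qed
  then have "card {w\<in>closed_walks S L. same_shape L u w} \<le> card (?R ` (u ` {..L} \<rightarrow>\<^sub>E S))"
    using assms by (intro card_mono finite_imageI finite_PiE) auto
  also have "\<dots> \<le> card (u ` {..L} \<rightarrow>\<^sub>E S)" by (intro card_image_le finite_PiE) (use assms in auto)
  also have "\<dots> = card S ^ card (u ` {..L})" by (simp add: card_PiE)
  finally show ?thesis .
qed

text \<open>Points are added one at a time: the first may take any value, and each later one avoids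
  at most \<open>k\<close> values already taken.\<close>

lemma card_injections_ge:
  assumes "finite A" "A \<noteq> {}" "finite T" "card A \<le> Suc k" "k \<le> card T"
  shows "card T * (card T - k) ^ (card A - 1) \<le> card {g \<in> A \<rightarrow>\<^sub>E T. inj_on g A}"
  using assms(1,2,4)
proof (induction A rule: finite_ne_induct)
  case (singleton x)
  have "{g \<in> {x} \<rightarrow>\<^sub>E T. inj_on g {x}} = {x} \<rightarrow>\<^sub>E T" by auto
  then show ?case by (simp add: card_PiE)
next
  case (insert x A)
  let ?J = "{g \<in> A \<rightarrow>\<^sub>E T. inj_on g A}"
  have finJ: "finite ?J" 
    by (rule finite_subset[OF _ finite_PiE[of A "\<lambda>_. T"]]) (use insert.hyps assms(3) in auto)
  have "card T * (card T - k) ^ (card (insert x A) - 1) = card T * (card T - k) ^ (card A - 1) * (card T - k)"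
    using insert by (simp add: card_gt_0_iff flip: power_Suc2)
  also have "\<dots> \<le> card ?J * (card T - k)" using insert by (intro mult_right_mono) auto
  also have "\<dots> = (\<Sum>g\<in>?J. card T - k)" by simp
  also have "\<dots> \<le> (\<Sum>g\<in>?J. card (T - g ` A))"
  proof (intro sum_mono)
    fix g assume g: "g \<in> ?J"
    have "card T - card (g ` A) \<le> card (T - g ` A)"
      using insert.hyps(1) by (intro diff_card_le_card_Diff) auto
    moreover have "card (g ` A) \<le> k" using g insert.prems insert.hyps card_image[of g A] by auto
    ultimately show "card T - k \<le> card (T - g ` A)" by linarith
  qed
  also have "\<dots> = card (SIGMA g:?J. T - g ` A)" using finJ assms(3) by simp
  also have "\<dots> = card ((\<lambda>(g, y). g(x := y)) ` (SIGMA g:?J. T - g ` A))"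
  proof (intro card_image[symmetric] inj_onI)
    fix a b assume ab: "a \<in> (SIGMA g:?J. T - g ` A)" "b \<in> (SIGMA g:?J. T - g ` A)"
      "(\<lambda>(g, y). g(x := y)) a = (\<lambda>(g, y). g(x := y)) b"
    obtain g y h z where [simp]: "a = (g, y)" "b = (h, z)" by (cases a; cases b)
    have eq: "g(x := y) = h(x := z)" using ab by simp
    then have "y = z" by (metis fun_upd_same)
    moreover have "g t = h t" for t
    proof (cases "t = x")
      case True
      then show ?thesis using ab insert.hyps by (auto simp: PiE_def extensional_def)
    next
      case False
      then show ?thesis using eq by (metis fun_upd_other)
    qed
    ultimately show "a = b" by auto
  qed
  also have "\<dots> \<le> card {g \<in> insert x A \<rightarrow>\<^sub>E T. inj_on g (insert x A)}"
  proof (intro card_mono)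
    show "finite {g \<in> insert x A \<rightarrow>\<^sub>E T. inj_on g (insert x A)}"
      by (rule finite_subset[OF _ finite_PiE[of "insert x A" "\<lambda>_. T"]]) (use insert.hyps assms(3) in auto)
    show "(\<lambda>(g, y). g(x := y)) ` (SIGMA g:?J. T - g ` A) \<subseteq> {g \<in> insert x A \<rightarrow>\<^sub>E T. inj_on g (insert x A)}"
    proof (intro subsetI, elim imageE SigmaE)
      fix h p g y assume *: "h = (\<lambda>(g, y). g(x := y)) p" "p = (g, y)" "g \<in> ?J" "y \<in> T - g ` A"
      have "inj_on (g(x := y)) (insert x A)"
        using * insert.hyps by (auto simp: inj_on_def)
      moreover have "g(x := y) \<in> insert x A \<rightarrow>\<^sub>E T"
        using * by (auto simp: PiE_def extensional_def)
      ultimately show "h \<in> {g \<in> insert x A \<rightarrow>\<^sub>E T. inj_on g (insert x A)}" using * by simp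
    qed
  qed
  finally show ?case .
qed

lemma same_shape_count_lower:
  assumes "finite T" "u L = u 0" "card (u ` {..L}) \<le> Suc k" "k \<le> card T"
  shows "card T * (card T - k) ^ (card (u ` {..L}) - 1) \<le> card {w\<in>closed_walks T L. same_shape L u w}"
proof -
  let ?J = "{g \<in> u ` {..L} \<rightarrow>\<^sub>E T. inj_on g (u ` {..L})}"
  let ?R = "\<lambda>g. \<lambda>t\<in>{..L}. g (u t)"
  have "card T * (card T - k) ^ (card (u ` {..L}) - 1) \<le> card ?J"
    using assms by (intro card_injections_ge) auto
  also have "\<dots> = card (?R ` ?J)"
  proof (intro card_image[symmetric] inj_onI)
    fix g h assume gh: "g \<in> ?J" "h \<in> ?J" "?R g = ?R h"
    show "g = h"
    proof (rule PiE_ext[of g "u ` {..L}" "\<lambda>_. T" h])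
      show "g \<in> u ` {..L} \<rightarrow>\<^sub>E T" "h \<in> u ` {..L} \<rightarrow>\<^sub>E T" using gh by auto
      fix a assume "a \<in> u ` {..L}"
      then obtain t where t: "t \<le> L" "a = u t" by auto
      then show "g a = h a" using fun_cong[OF gh(3), of t] by simp
    qed
  qed
  also have "\<dots> \<le> card {w\<in>closed_walks T L. same_shape L u w}"
  proof (intro card_mono)
    show "finite {w\<in>closed_walks T L. same_shape L u w}" using assms(1) by simp
    show "?R ` ?J \<subseteq> {w\<in>closed_walks T L. same_shape L u w}"
      using assms(2) by (auto simp: closed_walks_def same_shape_def inj_on_eq_iff PiE_def Pi_def)
  qed
  finally show ?thesis .
qed

text \<open>Count the pairs of a walk in \<open>S\<close> and a walk of the same shape in \<open>{..<2 * k}\<close> in two ways.\<close>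

lemma doubled_walks_comparison:
  fixes \<rho> :: real
  assumes "finite S" "k > 0" "0 \<le> \<rho>" "\<rho> * card S \<le> k"
  shows "(\<Sum>u\<in>{u\<in>closed_walks S (2 * k). doubled (2 * k) u}. \<rho> ^ (card (u ` {..2 * k}) - 1)) \<le>
    card S / (2 * k) * card {w\<in>closed_walks {..<2 * k} (2 * k). doubled (2 * k) w}"
proof -
  define L where "L = 2 * k"
  define v where "v = (\<lambda>u :: nat \<Rightarrow> nat. card (u ` {..L}) - 1)"
  define D where "D = (\<lambda>S. {u\<in>closed_walks S L. doubled L u})"
  have v: "card (u ` {..L}) = Suc (v u)" for u :: "nat \<Rightarrow> nat"
    unfolding v_def using card_gt_0_iff[of "u ` {..L}"] by auto
  have finD: "finite (D S)" "finite (D {..<L})" using assms(1) by (auto simp: D_def)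
  \<comment> \<open>A doubled walk of length \<open>2 * k\<close> has at most \<open>k\<close> edges
    and hence at most \<open>k + 1\<close> vertices, so among \<open>2 * k\<close> labels at least
    \<open>k\<close> stay free for each new vertex.\<close>
  have lower: "L * real k ^ v u \<le> card {w\<in>D {..<L}. same_shape L u w}" if "u \<in> D S" for u
  proof -
    have u: "doubled L u" "u L = u 0" using that by (auto simp: D_def closed_walks_def)
    have "card (u ` {..L}) \<le> Suc k"
      using walk_vertices_le_edges[of u L] doubled_edges_le[of k u] u(1) unfolding L_def by linarith
    then have "card {..<L} * (card {..<L} - k) ^ (card (u ` {..L}) - 1) \<le> card {w\<in>closed_walks {..<L} L. same_shape L u w}"
      using u(2) by (intro same_shape_count_lower) (auto simp: L_def)
    then have "L * k ^ v u \<le> card {w\<in>closed_walks {..<L} L. same_shape L u w}"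
      by (simp add: v_def L_def)
    also have "{w\<in>closed_walks {..<L} L. same_shape L u w} = {w\<in>D {..<L}. same_shape L u w}"
      using same_shape_doubled[OF _ u(1)] by (auto simp: D_def)
    finally show ?thesis using of_nat_mono by fastforce
  qed
  have upper: "card {u\<in>D S. same_shape L u w} \<le> card S * real (card S) ^ v w" for w
  proof -
    have "card {u\<in>D S. same_shape L u w} \<le> card {u\<in>closed_walks S L. same_shape L w u}"
      using assms(1) by (intro card_mono) (auto simp: D_def same_shape_sym)
    also have "\<dots> \<le> card S ^ card (w ` {..L})" by (rule same_shape_count_upper[OF assms(1)])
    finally have "card {u\<in>D S. same_shape L u w} \<le> card S * card S ^ v w" by (simp add: v)
    then show ?thesis using of_nat_mono by fastforce
  qed
  have vsame: "v w = v u" if "same_shape L u w" for u w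
    using same_shape_card[OF that] by (simp add: v_def)
  have pos: "L * real k ^ j > 0" for j using assms(2) by (simp add: L_def)
  have "(\<Sum>u\<in>D S. \<rho> ^ v u) \<le> (\<Sum>u\<in>D S. \<Sum>w\<in>{w\<in>D {..<L}. same_shape L u w}. \<rho> ^ v u / (L * real k ^ v u))"
  proof (intro sum_mono)
    fix u assume "u \<in> D S"
    then have "\<rho> ^ v u / (L * real k ^ v u) * (L * real k ^ v u) \<le>
        \<rho> ^ v u / (L * real k ^ v u) * card {w\<in>D {..<L}. same_shape L u w}"
      using pos assms(3) lower by (intro mult_left_mono) auto
    then show "\<rho> ^ v u \<le> (\<Sum>w\<in>{w\<in>D {..<L}. same_shape L u w}. \<rho> ^ v u / (L * real k ^ v u))"
      using assms(2) by (simp add: L_def mult.commute)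
  qed
  also have "\<dots> = (\<Sum>w\<in>D {..<L}. \<Sum>u\<in>{u\<in>D S. same_shape L u w}. \<rho> ^ v u / (L * real k ^ v u))"
    by (rule sum.swap_restrict[OF finD])
  also have "\<dots> = (\<Sum>w\<in>D {..<L}. \<Sum>u\<in>{u\<in>D S. same_shape L u w}. \<rho> ^ v w / (L * real k ^ v w))"
    by (intro sum.cong refl) (auto simp: vsame)
  also have "\<dots> \<le> (\<Sum>w\<in>D {..<L}. real (card S) / L)"
  proof (intro sum_mono)
    fix w
    have "(\<Sum>u\<in>{u\<in>D S. same_shape L u w}. \<rho> ^ v w / (L * real k ^ v w)) \<le>
        (card S * real (card S) ^ v w) * (\<rho> ^ v w / (L * real k ^ v w))"
      using upper[of w] pos[of "v w"] assms(3) by (simp add: mult_right_mono divide_right_mono)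
    \<comment> \<open>Each vertex after the first changes the weight by
      \<open>\<rho> * card S / k\<close>, which is at most one; only the choice of the first vertex
      leaves the ratio \<open>card S / L\<close>.\<close>
    also have "\<dots> = card S / L * (\<rho> * card S / k) ^ v w"
      by (simp add: power_mult_distrib power_divide field_simps)
    also have "\<dots> \<le> card S / L * 1"
      using assms by (intro mult_left_mono power_le_one) auto
    finally show "(\<Sum>u\<in>{u\<in>D S. same_shape L u w}. \<rho> ^ v w / (L * real k ^ v w)) \<le> real (card S) / L" by simp
  qed
  finally show ?thesis by (simp add: D_def v_def L_def mult.commute)
qed


section \<open>Traces and quadratic forms\<close>

text \<open>Vectors and matrices are functions summed over an arbitrary finite index set, so that
  the block of a cluster needs no renumbering of its nodes.\<close>

definition mat_vec :: "nat set \<Rightarrow> (nat \<Rightarrow> nat \<Rightarrow> real) \<Rightarrow> (nat \<Rightarrow> real) \<Rightarrow> nat \<Rightarrow> real" where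
  "mat_vec S X x i = (\<Sum>j\<in>S. X i j * x j)"

definition dot :: "nat set \<Rightarrow> (nat \<Rightarrow> real) \<Rightarrow> (nat \<Rightarrow> real) \<Rightarrow> real" where
  "dot S x y = (\<Sum>i\<in>S. x i * y i)"

text \<open>The trace of the \<open>L\<close>-th power of \<open>X\<close>, expanded
  entrywise.\<close>

definition walk_trace :: "nat set \<Rightarrow> (nat \<Rightarrow> nat \<Rightarrow> real) \<Rightarrow> nat \<Rightarrow> real" where
  "walk_trace S X L = (\<Sum>u\<in>closed_walks S L. \<Prod>t<L. X (u t) (u (Suc t)))"

definition unit_at :: "nat \<Rightarrow> nat \<Rightarrow> real" where
  "unit_at i j = (if i = j then 1 else 0)"

lemma dot_self_nonneg: "dot S x x \<ge> 0"
  by (simp add: dot_def sum_nonneg)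

lemma dot_commute: "dot S x y = dot S y x"
  by (simp add: dot_def mult.commute)

lemma dot_CS: "(dot S x y)\<^sup>2 \<le> dot S x x * dot S y y"
  using Cauchy_Schwarz_ineq_sum[of x y S] by (simp add: dot_def power2_eq_square)

lemma mat_vec_symmetric:
  assumes "\<And>i j. X i j = X j i"
  shows "dot S (mat_vec S X x) y = dot S x (mat_vec S X y)"
proof -
  have "dot S (mat_vec S X x) y = (\<Sum>i\<in>S. \<Sum>j\<in>S. X i j * x j * y i)"
    by (simp add: dot_def mat_vec_def sum_distrib_right)
  also have "\<dots> = (\<Sum>j\<in>S. \<Sum>i\<in>S. X i j * x j * y i)" by (rule sum.swap)
  also have "\<dots> = dot S x (mat_vec S X y)"
    unfolding dot_def mat_vec_def sum_distrib_left by (intro sum.cong refl) (simp add: assms)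
  finally show ?thesis .
qed

lemma mat_vec_funpow_symmetric:
  assumes "\<And>i j. X i j = X j i"
  shows "dot S ((mat_vec S X ^^ m) x) y = dot S x ((mat_vec S X ^^ m) y)"
proof (induction m arbitrary: y)
  case (Suc m)
  have "dot S ((mat_vec S X ^^ Suc m) x) y = dot S ((mat_vec S X ^^ m) x) (mat_vec S X y)"
    using mat_vec_symmetric[OF assms] by simp
  also have "\<dots> = dot S x ((mat_vec S X ^^ Suc m) y)"
    unfolding Suc by (simp only: funpow_Suc_right comp_apply)
  finally show ?case .
qed simp

lemma mat_vec_funpow_split:
  assumes "\<And>i j. X i j = X j i"
  shows "dot S x ((mat_vec S X ^^ (2 * m)) x) = dot S ((mat_vec S X ^^ m) x) ((mat_vec S X ^^ m) x)"
  by (simp add: mat_vec_funpow_symmetric[OF assms] mult_2 funpow_add)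

lemma sum_extend_walk:
  fixes h :: "(nat \<Rightarrow> nat) \<Rightarrow> real"
  assumes "finite S"
  shows "(\<Sum>u\<in>{u\<in>{..Suc L} \<rightarrow>\<^sub>E S. u 0 = i}. h u) =
    (\<Sum>u\<in>{u\<in>{..L} \<rightarrow>\<^sub>E S. u 0 = i}. \<Sum>j\<in>S. h (u(Suc L := j)))"
proof -
  have "(\<Sum>u\<in>{u\<in>{..Suc L} \<rightarrow>\<^sub>E S. u 0 = i}. h u) =
      (\<Sum>(u, j)\<in>{u\<in>{..L} \<rightarrow>\<^sub>E S. u 0 = i} \<times> S. h (u(Suc L := j)))"
  proof (intro sum.reindex_bij_witness[of _ "\<lambda>(u, j). u(Suc L := j)" "\<lambda>u. (u(Suc L := undefined), u (Suc L))"])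
    fix a assume "a \<in> {u\<in>{..L} \<rightarrow>\<^sub>E S. u 0 = i} \<times> S"
    then obtain u j where a: "a = (u, j)" "u \<in> {..L} \<rightarrow>\<^sub>E S" "u 0 = i" "j \<in> S" by auto
    then have "u (Suc L) = undefined" by (auto simp: PiE_def extensional_def)
    then show "(\<lambda>u. (u(Suc L := undefined), u (Suc L))) ((\<lambda>(u, j). u(Suc L := j)) a) = a"
      using a by (auto simp: fun_upd_idem)
    show "(case a of (u, j) \<Rightarrow> u(Suc L := j)) \<in> {u\<in>{..Suc L} \<rightarrow>\<^sub>E S. u 0 = i}"
      using a by (auto simp: PiE_def extensional_def Pi_def le_Suc_eq)
  qed (auto simp: PiE_def extensional_def Pi_def)
  also have "\<dots> = (\<Sum>u\<in>{u\<in>{..L} \<rightarrow>\<^sub>E S. u 0 = i}. \<Sum>j\<in>S. h (u(Suc L := j)))"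
    by (simp add: sum.cartesian_product)
  finally show ?thesis .
qed

lemma mat_vec_funpow_walks:
  assumes "finite S" "i \<in> S"
  shows "(mat_vec S X ^^ L) y i =
    (\<Sum>u\<in>{u\<in>{..L} \<rightarrow>\<^sub>E S. u 0 = i}. (\<Prod>t<L. X (u t) (u (Suc t))) * y (u L))"
proof (induction L arbitrary: y)
  case 0
  have "{u\<in>{..0::nat} \<rightarrow>\<^sub>E S. u 0 = i} = {\<lambda>t. if t = 0 then i else undefined}"
    using assms(2) by (auto simp: PiE_def extensional_def)
  then show ?case by simp
next
  case (Suc L)
  have "(mat_vec S X ^^ Suc L) y i = (mat_vec S X ^^ L) (mat_vec S X y) i"
    by (simp add: funpow_swap1)
  also have "\<dots> = (\<Sum>u\<in>{u\<in>{..L} \<rightarrow>\<^sub>E S. u 0 = i}. (\<Prod>t<L. X (u t) (u (Suc t))) * mat_vec S X y (u L))"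
    by (rule Suc)
  also have "\<dots> = (\<Sum>u\<in>{u\<in>{..L} \<rightarrow>\<^sub>E S. u 0 = i}. \<Sum>j\<in>S. (\<Prod>t<Suc L. X ((u(Suc L := j)) t) ((u(Suc L := j)) (Suc t))) * y ((u(Suc L := j)) (Suc L)))"
  proof (intro sum.cong refl)
    fix u
    have "(\<Prod>t<Suc L. X ((u(Suc L := j)) t) ((u(Suc L := j)) (Suc t))) = (\<Prod>t<L. X (u t) (u (Suc t))) * X (u L) j" for j
      by (simp add: lessThan_Suc mult.commute)
    then show "(\<Prod>t<L. X (u t) (u (Suc t))) * mat_vec S X y (u L) =
        (\<Sum>j\<in>S. (\<Prod>t<Suc L. X ((u(Suc L := j)) t) ((u(Suc L := j)) (Suc t))) * y ((u(Suc L := j)) (Suc L)))"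
      by (simp add: mat_vec_def sum_distrib_left mult.assoc)
  qed
  also have "\<dots> = (\<Sum>u\<in>{u\<in>{..Suc L} \<rightarrow>\<^sub>E S. u 0 = i}. (\<Prod>t<Suc L. X (u t) (u (Suc t))) * y (u (Suc L)))"
    by (rule sum_extend_walk[OF assms(1), symmetric])
  finally show ?case .
qed

lemma dot_unit_at: "finite S \<Longrightarrow> i \<in> S \<Longrightarrow> dot S (unit_at i) y = y i"
  by (simp add: dot_def unit_at_def if_distrib[of "\<lambda>x. x * _"] cong: if_cong)

lemma walk_trace_eq:
  assumes "finite S"
  shows "walk_trace S X L = (\<Sum>i\<in>S. dot S (unit_at i) ((mat_vec S X ^^ L) (unit_at i)))"
proof -
  have "(\<Sum>i\<in>S. dot S (unit_at i) ((mat_vec S X ^^ L) (unit_at i))) =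
      (\<Sum>i\<in>S. \<Sum>u\<in>{u\<in>closed_walks S L. u 0 = i}. \<Prod>t<L. X (u t) (u (Suc t)))"
  proof (intro sum.cong refl)
    fix i assume i: "i \<in> S"
    have fin: "finite {u\<in>{..L} \<rightarrow>\<^sub>E S. u 0 = i}"
      by (rule finite_subset[OF _ finite_PiE[of "{..L}" "\<lambda>_. S"]]) (use assms in auto)
    show "dot S (unit_at i) ((mat_vec S X ^^ L) (unit_at i)) = (\<Sum>u\<in>{u\<in>closed_walks S L. u 0 = i}. \<Prod>t<L. X (u t) (u (Suc t)))"
      unfolding dot_unit_at[OF assms i] mat_vec_funpow_walks[OF assms i]
      using fin by (intro sum.mono_neutral_cong_right) (auto simp: unit_at_def closed_walks_def)
  qed
  also have "\<dots> = walk_trace S X L"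
    unfolding walk_trace_def
    by (intro sum.group finite_closed_walks assms) (auto simp: closed_walks_def)
  finally show ?thesis by simp
qed

lemma walk_trace_even:
  assumes "finite S" "\<And>i j. X i j = X j i"
  shows "walk_trace S X (2 * m) = (\<Sum>i\<in>S. dot S ((mat_vec S X ^^ m) (unit_at i)) ((mat_vec S X ^^ m) (unit_at i)))"
  unfolding walk_trace_eq[OF assms(1)] mat_vec_funpow_split[OF assms(2)] ..

text \<open>For symmetric \<open>X\<close> the trace of the power \<open>2 * m\<close> is the
  squared Hilbert-Schmidt norm of the power \<open>m\<close>, and this norm dominates the operator
  norm.\<close>

lemma norm_funpow_le_trace:
  assumes "finite S" "\<And>i j. X i j = X j i"
  shows "dot S x ((mat_vec S X ^^ (2 * m)) x) \<le> dot S x x * walk_trace S X (2 * m)"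
proof -
  define y where "y = (mat_vec S X ^^ m) x"
  have "(y i)\<^sup>2 \<le> dot S x x * dot S ((mat_vec S X ^^ m) (unit_at i)) ((mat_vec S X ^^ m) (unit_at i))"
    if "i \<in> S" for i
  proof -
    have "y i = dot S ((mat_vec S X ^^ m) (unit_at i)) x"
      unfolding mat_vec_funpow_symmetric[OF assms(2)] y_def by (simp add: dot_unit_at[OF assms(1) that])
    then show ?thesis using dot_CS[of S x "(mat_vec S X ^^ m) (unit_at i)"] by (simp add: dot_commute)
  qed
  then have "(\<Sum>i\<in>S. (y i)\<^sup>2) \<le> dot S x x * walk_trace S X (2 * m)"
    unfolding walk_trace_even[OF assms] sum_distrib_left by (intro sum_mono) auto
  then show ?thesis unfolding mat_vec_funpow_split[OF assms(2)] y_def[symmetric]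
    by (simp add: dot_def power2_eq_square)
qed

text \<open>Cauchy-Schwarz doubles the exponent, which replaces the spectral theorem for exponents that
  are powers of two.\<close>

lemma quadratic_form_power_double:
  assumes "\<And>i j. X i j = X j i" "m > 0" "even m"
    and "(dot S x (mat_vec S X x)) ^ m \<le> (dot S x x) ^ (m - 1) * dot S x ((mat_vec S X ^^ m) x)"
  shows "(dot S x (mat_vec S X x)) ^ (2 * m) \<le> (dot S x x) ^ (2 * m - 1) * dot S x ((mat_vec S X ^^ (2 * m)) x)"
proof -
  define d where "d = dot S x x"
  define a where "a = dot S x (mat_vec S X x)"
  define q where "q = dot S x ((mat_vec S X ^^ m) x)"
  define q' where "q' = dot S x ((mat_vec S X ^^ (2 * m)) x)"
  have q: "q\<^sup>2 \<le> d * q'"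
    using dot_CS[of S x "(mat_vec S X ^^ m) x"]
    unfolding q_def d_def q'_def mat_vec_funpow_split[OF assms(1)] .
  have d: "d \<ge> 0" unfolding d_def by (rule dot_self_nonneg)
  have "a ^ (2 * m) = (a ^ m)\<^sup>2" by (simp add: power_mult[symmetric] mult.commute)
  \<comment> \<open>Squaring preserves the inequality since \<open>a ^ m\<close> is nonnegative for
    even \<open>m\<close>, although \<open>a\<close> may be negative.\<close>
  also have "\<dots> \<le> (d ^ (m - 1) * q)\<^sup>2"
    using assms(3,4) unfolding a_def d_def q_def by (intro power_mono zero_le_even_power) auto
  also have "\<dots> = d ^ ((m - 1) * 2) * q\<^sup>2"
    by (simp only: power_mult_distrib power_mult)
  also have "\<dots> \<le> d ^ ((m - 1) * 2) * (d * q')" using q d by (intro mult_left_mono) auto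
  also have "\<dots> = d ^ Suc ((m - 1) * 2) * q'" by simp
  also have "Suc ((m - 1) * 2) = 2 * m - 1" using assms(2) by linarith
  finally show ?thesis unfolding a_def d_def q'_def .
qed

lemma quadratic_form_power_le:
  assumes "\<And>i j. X i j = X j i"
  shows "(dot S x (mat_vec S X x)) ^ (2 ^ Suc i) \<le> (dot S x x) ^ (2 ^ Suc i - 1) * dot S x ((mat_vec S X ^^ (2 ^ Suc i)) x)"
proof (induction i)
  case 0
  show ?case using dot_CS[of S x "mat_vec S X x"] mat_vec_funpow_split[OF assms, of S x 1]
    by (simp add: eval_nat_numeral)
next
  case (Suc i)
  have "even ((2::nat) ^ Suc i)" "(2::nat) ^ Suc i > 0" by auto
  from quadratic_form_power_double[OF assms this(2,1) Suc] show ?case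
    by (simp only: power_Suc)
qed

lemma quadratic_form_le_of_trace:
  assumes "finite S" "\<And>i j. X i j = X j i" "2 * k = 2 ^ j" "k > 0" "t \<ge> 0"
    and "walk_trace S X (2 * k) < t ^ (2 * k)"
  shows "dot S x (mat_vec S X x) \<le> t * dot S x x"
proof (rule ccontr)
  assume "\<not> ?thesis"
  then have gt: "t * dot S x x < dot S x (mat_vec S X x)" by simp
  obtain i where i: "2 * k = 2 ^ Suc i"
    using assms(3) by (cases j) auto
  have "(t * dot S x x) ^ (2 * k) < (dot S x (mat_vec S X x)) ^ (2 * k)"
    using gt assms(4,5) dot_self_nonneg[of S x] by (intro power_strict_mono) auto
  also have "\<dots> \<le> (dot S x x) ^ (2 * k - 1) * dot S x ((mat_vec S X ^^ (2 * k)) x)"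
    unfolding i by (rule quadratic_form_power_le[OF assms(2)])
  also have "\<dots> \<le> (dot S x x) ^ (2 * k - 1) * (dot S x x * walk_trace S X (2 * k))"
    using norm_funpow_le_trace[OF assms(1,2)] dot_self_nonneg[of S x] by (intro mult_left_mono) auto
  also have "\<dots> = (dot S x x) ^ Suc (2 * k - 1) * walk_trace S X (2 * k)" by simp
  also have "Suc (2 * k - 1) = 2 * k" using assms(4) by simp
  also have "(dot S x x) ^ (2 * k) * walk_trace S X (2 * k) \<le> (dot S x x) ^ (2 * k) * t ^ (2 * k)"
    using assms(6) dot_self_nonneg[of S x] by (intro mult_left_mono) auto
  finally show False by (simp add: power_mult_distrib mult.commute)
qed


section \<open>Nets\<close>

lemma dot_scale: "dot S (\<lambda>i. a * x i) (\<lambda>i. b * y i) = a * b * dot S x y"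
  by (simp add: dot_def sum_distrib_left mult_ac)

lemma mat_vec_scale: "mat_vec S X (\<lambda>i. a * x i) = (\<lambda>i. a * mat_vec S X x i)"
  by (rule ext) (simp add: mat_vec_def sum_distrib_left mult_ac)

lemma mat_vec_diff: "mat_vec S X (\<lambda>i. x i - y i) = (\<lambda>i. mat_vec S X x i - mat_vec S X y i)"
  by (rule ext) (simp add: mat_vec_def sum_subtractf algebra_simps)

lemma dot_diff_right: "dot S x (\<lambda>i. y i - z i) = dot S x y - dot S x z"
  by (simp add: dot_def sum_subtractf algebra_simps)

lemma dot_diff_left: "dot S (\<lambda>i. y i - z i) x = dot S y x - dot S z x"
  by (simp add: dot_def sum_subtractf algebra_simps)

text \<open>The operator norm of \<open>X\<close> on \<open>S\<close>, in bilinear form so that a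
  net can be used in both arguments.\<close>

definition bilin_bound :: "nat set \<Rightarrow> (nat \<Rightarrow> nat \<Rightarrow> real) \<Rightarrow> real" where
  "bilin_bound S X = (SUP (x, y)\<in>{x. dot S x x \<le> 1} \<times> {y. dot S y y \<le> 1}. \<bar>dot S y (mat_vec S X x)\<bar>)"

lemma abs_le_of_dot_le:
  assumes "finite S" "i \<in> S" "dot S x x \<le> 1"
  shows "\<bar>x i\<bar> \<le> 1"
proof -
  have "(x i)\<^sup>2 \<le> (\<Sum>i\<in>S. (x i)\<^sup>2)" using assms by (intro member_le_sum) auto
  then have "(x i)\<^sup>2 \<le> 1" using assms(3) by (simp add: dot_def power2_eq_square)
  then show ?thesis by (simp add: abs_square_le_1)
qed

lemma bilin_bound_upper:
  assumes "finite S" "dot S x x \<le> 1" "dot S y y \<le> 1"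
  shows "\<bar>dot S y (mat_vec S X x)\<bar> \<le> bilin_bound S X"
proof -
  have "bdd_above ((\<lambda>(x, y). \<bar>dot S y (mat_vec S X x)\<bar>) ` ({x. dot S x x \<le> 1} \<times> {y. dot S y y \<le> 1}))"
  proof (rule bdd_aboveI2[where M = "\<Sum>i\<in>S. \<Sum>j\<in>S. \<bar>X i j\<bar>"])
    fix p :: "(nat \<Rightarrow> real) \<times> (nat \<Rightarrow> real)"
    assume "p \<in> {x. dot S x x \<le> 1} \<times> {y. dot S y y \<le> 1}"
    then obtain x y where p: "p = (x, y)" "dot S x x \<le> 1" "dot S y y \<le> 1" by auto
    have "\<bar>dot S y (mat_vec S X x)\<bar> \<le> (\<Sum>i\<in>S. \<bar>y i * mat_vec S X x i\<bar>)"
      unfolding dot_def by (rule sum_abs)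
    also have "\<dots> \<le> (\<Sum>i\<in>S. \<Sum>j\<in>S. \<bar>X i j\<bar>)"
    proof (intro sum_mono)
      fix i assume i: "i \<in> S"
      have "\<bar>y i * mat_vec S X x i\<bar> \<le> 1 * \<bar>mat_vec S X x i\<bar>"
        unfolding abs_mult using abs_le_of_dot_le[OF assms(1) i p(3)] by (intro mult_right_mono) auto
      also have "\<dots> \<le> (\<Sum>j\<in>S. \<bar>X i j * x j\<bar>)" unfolding mat_vec_def by simp
      also have "\<dots> \<le> (\<Sum>j\<in>S. \<bar>X i j\<bar>)"
        using abs_le_of_dot_le[OF assms(1) _ p(2)] by (intro sum_mono) (auto simp: abs_mult intro: mult_left_le)
      finally show "\<bar>y i * mat_vec S X x i\<bar> \<le> (\<Sum>j\<in>S. \<bar>X i j\<bar>)" .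
    qed
    finally show "(case p of (x, y) \<Rightarrow> \<bar>dot S y (mat_vec S X x)\<bar>) \<le> (\<Sum>i\<in>S. \<Sum>j\<in>S. \<bar>X i j\<bar>)"
      by (simp add: p)
  qed
  then show ?thesis unfolding bilin_bound_def using assms(2,3)
    by (intro cSUP_upper2[where x = "(x, y)"]) auto
qed

lemma bilin_bound_scaled:
  assumes "finite S" "dot S x x \<le> a\<^sup>2" "dot S y y \<le> b\<^sup>2" "a > 0" "b > 0"
  shows "\<bar>dot S y (mat_vec S X x)\<bar> \<le> bilin_bound S X * (a * b)"
proof -
  have "dot S (\<lambda>i. 1 / a * x i) (\<lambda>i. 1 / a * x i) \<le> 1" "dot S (\<lambda>i. 1 / b * y i) (\<lambda>i. 1 / b * y i) \<le> 1"
    unfolding dot_scale using assms by (auto simp: power2_eq_square divide_simps)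
  from bilin_bound_upper[OF assms(1) this, of X]
  have "\<bar>1 / b * (1 / a) * dot S y (mat_vec S X x)\<bar> \<le> bilin_bound S X"
    unfolding mat_vec_scale dot_scale .
  then show ?thesis using assms(4,5) by (simp add: abs_mult field_simps)
qed

lemma bilin_bound_nonneg: "finite S \<Longrightarrow> bilin_bound S X \<ge> 0"
  using bilin_bound_upper[of S "\<lambda>_. 0" "\<lambda>_. 0" X] by (simp add: dot_def)

lemma mat_vec_norm_le:
  assumes "finite S"
  shows "dot S (mat_vec S X x) (mat_vec S X x) \<le> (bilin_bound S X)\<^sup>2 * dot S x x"
proof -
  define y where "y = mat_vec S X x"
  \<comment> \<open>The slack \<open>e\<close> makes both radii positive, as
    \<open>bilin_bound_scaled\<close> requires even for zero vectors; it is then sent to 0.\<close>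
  have *: "dot S y y \<le> bilin_bound S X * (sqrt (dot S x x + e) * sqrt (dot S y y + e))" if "e > 0" for e
  proof -
    have "\<bar>dot S y (mat_vec S X x)\<bar> \<le> bilin_bound S X * (sqrt (dot S x x + e) * sqrt (dot S y y + e))"
      using dot_self_nonneg[of S x] dot_self_nonneg[of S y] that
      by (intro bilin_bound_scaled assms) auto
    then show ?thesis by (simp add: y_def)
  qed
  have "((\<lambda>e. bilin_bound S X * (sqrt (dot S x x + e) * sqrt (dot S y y + e))) \<longlongrightarrow>
      bilin_bound S X * (sqrt (dot S x x + 0) * sqrt (dot S y y + 0))) (at_right 0)"
    by (intro tendsto_intros)
  then have le: "dot S y y \<le> bilin_bound S X * (sqrt (dot S x x) * sqrt (dot S y y))"
    by (intro tendsto_lowerbound[where F = "at_right 0"])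
       (auto simp: eventually_at_right_less intro!: eventually_at_rightI[of 0 1] *)
  show ?thesis
  proof (cases "dot S y y = 0")
    case True
    then show ?thesis using dot_self_nonneg[of S x] by (simp add: y_def[symmetric])
  next
    case False
    then have pos: "dot S y y > 0" using dot_self_nonneg[of S y] by simp
    have "sqrt (dot S y y) * sqrt (dot S y y) \<le> (bilin_bound S X * sqrt (dot S x x)) * sqrt (dot S y y)"
      using le pos by (simp add: mult_ac)
    then have "sqrt (dot S y y) \<le> bilin_bound S X * sqrt (dot S x x)"
      using pos by (simp only: mult_le_cancel_right_pos real_sqrt_gt_zero)
    then have "(sqrt (dot S y y))\<^sup>2 \<le> (bilin_bound S X * sqrt (dot S x x))\<^sup>2"
      using pos by (intro power_mono) auto
    then show ?thesis using pos dot_self_nonneg[of S x] by (simp add: power_mult_distrib y_def[symmetric])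
  qed
qed

lemma walk_trace_le_bilin_bound:
  assumes "finite S" "\<And>i j. X i j = X j i"
  shows "walk_trace S X (2 * k) \<le> card S * bilin_bound S X ^ (2 * k)"
proof -
  have "dot S ((mat_vec S X ^^ m) x) ((mat_vec S X ^^ m) x) \<le> bilin_bound S X ^ (2 * m) * dot S x x" for m x
  proof (induction m)
    case (Suc m)
    have "dot S ((mat_vec S X ^^ Suc m) x) ((mat_vec S X ^^ Suc m) x) \<le>
        (bilin_bound S X)\<^sup>2 * dot S ((mat_vec S X ^^ m) x) ((mat_vec S X ^^ m) x)"
      using mat_vec_norm_le[OF assms(1)] by simp
    also have "\<dots> \<le> (bilin_bound S X)\<^sup>2 * (bilin_bound S X ^ (2 * m) * dot S x x)"
      by (intro mult_left_mono Suc) simp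
    finally show ?case by (simp add: power_add power2_eq_square mult_ac)
  qed simp
  then have "walk_trace S X (2 * k) \<le> (\<Sum>i\<in>S. bilin_bound S X ^ (2 * k) * dot S (unit_at i) (unit_at i))"
    unfolding walk_trace_even[OF assms] by (intro sum_mono)
  also have "\<dots> = (\<Sum>i\<in>S. bilin_bound S X ^ (2 * k))"
    by (intro sum.cong refl) (simp add: dot_unit_at[OF assms(1)], simp add: unit_at_def)
  finally show ?thesis by simp
qed

definition quarter_net :: "nat set \<Rightarrow> (nat \<Rightarrow> real) set \<Rightarrow> bool" where
  "quarter_net S N \<longleftrightarrow> finite N \<and> (\<forall>x\<in>N. dot S x x \<le> 1) \<and>
     (\<forall>x. dot S x x \<le> 1 \<longrightarrow> (\<exists>x'\<in>N. dot S (\<lambda>i. x i - x' i) (\<lambda>i. x i - x' i) \<le> (1 / 4)\<^sup>2))"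

text \<open>Moving either argument to the net costs at most a quarter of the norm. The norm is
  therefore at most \<open>m\<close> plus half of itself, and it is finite.\<close>

lemma bilin_bound_net:
  assumes "finite S" "quarter_net S N" "\<And>x y. x \<in> N \<Longrightarrow> y \<in> N \<Longrightarrow> \<bar>dot S y (mat_vec S X x)\<bar> \<le> m"
  shows "bilin_bound S X \<le> 2 * m"
proof -
  have "\<bar>dot S y (mat_vec S X x)\<bar> \<le> m + bilin_bound S X / 2" if xy: "dot S x x \<le> 1" "dot S y y \<le> 1" for x y
  proof -
    obtain x' where x': "x' \<in> N" "dot S (\<lambda>i. x i - x' i) (\<lambda>i. x i - x' i) \<le> (1 / 4)\<^sup>2"
      using assms(2) xy(1) unfolding quarter_net_def by blast
    obtain y' where y': "y' \<in> N" "dot S (\<lambda>i. y i - y' i) (\<lambda>i. y i - y' i) \<le> (1 / 4)\<^sup>2"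
      using assms(2) xy(2) unfolding quarter_net_def by blast
    have x'1: "dot S x' x' \<le> 1\<^sup>2" using assms(2) x'(1) unfolding quarter_net_def by simp
    have 1: "\<bar>dot S y (mat_vec S X (\<lambda>i. x i - x' i))\<bar> \<le> bilin_bound S X * (1 / 4 * 1)"
      by (intro bilin_bound_scaled assms(1) x'(2)) (use xy in auto)
    have 2: "\<bar>dot S (\<lambda>i. y i - y' i) (mat_vec S X x')\<bar> \<le> bilin_bound S X * (1 * (1 / 4))"
      by (intro bilin_bound_scaled assms(1) y'(2) x'1) auto
    have "dot S y (mat_vec S X x) = dot S y (mat_vec S X (\<lambda>i. x i - x' i)) +
        dot S (\<lambda>i. y i - y' i) (mat_vec S X x') + dot S y' (mat_vec S X x')"
      by (simp add: mat_vec_diff dot_diff_right dot_diff_left)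
    then show ?thesis using 1 2 assms(3)[OF x'(1) y'(1)] by linarith
  qed
  moreover have "dot S (\<lambda>_. 0) (\<lambda>_. 0) \<le> 1" by (simp add: dot_def)
  ultimately have "bilin_bound S X \<le> m + bilin_bound S X / 2"
    unfolding bilin_bound_def[of S X, symmetric]
    by (subst bilin_bound_def) (intro cSUP_least, auto)
  then show ?thesis by simp
qed

text \<open>The maximum over the net is replaced by a sum of even powers, whose expectation can be
  taken term by term for fixed vectors.\<close>

lemma walk_trace_le_net:
  assumes "finite S" "\<And>i j. X i j = X j i" "quarter_net S N"
  shows "walk_trace S X (2 * k) \<le>
    card S * (4 ^ k * (\<Sum>x\<in>N. \<Sum>y\<in>N. (dot S y (mat_vec S X x)) ^ (2 * k)))"
proof -
  let ?h = "\<lambda>x y. (dot S y (mat_vec S X x)) ^ (2 * k)"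
  have fin: "finite N" using assms(3) by (simp add: quarter_net_def)
  obtain x0 where x0: "x0 \<in> N"
    using assms(3) unfolding quarter_net_def by (auto dest!: spec[of _ "\<lambda>_. 0"] simp: dot_def)
  define A where "A = (\<lambda>(x, y). \<bar>dot S y (mat_vec S X x)\<bar>) ` (N \<times> N)"
  have A: "finite A" "A \<noteq> {}" using fin x0 by (auto simp: A_def)
  obtain x y where xy: "x \<in> N" "y \<in> N" "Max A = \<bar>dot S y (mat_vec S X x)\<bar>"
    using Max_in[OF A] unfolding A_def by auto
  have "bilin_bound S X \<le> 2 * Max A"
    using A by (intro bilin_bound_net[OF assms(1,3)] Max_ge) (auto simp: A_def)
  then have "bilin_bound S X ^ (2 * k) \<le> (2 * Max A) ^ (2 * k)"
    by (intro power_mono bilin_bound_nonneg assms(1))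
  also have "\<dots> = 4 ^ k * ?h x y"
    by (simp add: xy(3) power_mult_distrib power_mult power_even_abs)
  also have "?h x y \<le> (\<Sum>y\<in>N. ?h x y)"
    using fin xy(2) by (intro member_le_sum[of y N "?h x"]) auto
  also have "\<dots> \<le> (\<Sum>x\<in>N. \<Sum>y\<in>N. ?h x y)"
    using fin xy(1) by (intro member_le_sum[of x N "\<lambda>x. \<Sum>y\<in>N. ?h x y"] sum_nonneg) auto
  finally have "bilin_bound S X ^ (2 * k) \<le> 4 ^ k * (\<Sum>x\<in>N. \<Sum>y\<in>N. ?h x y)" by simp
  then have "card S * bilin_bound S X ^ (2 * k) \<le> card S * (4 ^ k * (\<Sum>x\<in>N. \<Sum>y\<in>N. ?h x y))"
    by (intro mult_left_mono) auto
  then show ?thesis using walk_trace_le_bilin_bound[of S X, OF assms(1,2), of k] by linarith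
qed

text \<open>Rounding towards zero never increases an absolute value, so a rounded point of the ball
  stays in the ball.\<close>

definition truncate :: "real \<Rightarrow> int" where
  "truncate a = (if a \<ge> 0 then \<lfloor>a\<rfloor> else \<lceil>a\<rceil>)"

lemma truncate: "\<bar>of_int (truncate a)\<bar> \<le> \<bar>a\<bar>" "\<bar>a - of_int (truncate a)\<bar> \<le> 1"
proof -
  show "\<bar>of_int (truncate a)\<bar> \<le> \<bar>a\<bar>"
    using floor_correct[of a] ceiling_correct[of a] zero_le_floor[of a] ceiling_le_zero[of a]
    unfolding truncate_def by (cases "a \<ge> 0") auto
  show "\<bar>a - of_int (truncate a)\<bar> \<le> 1"
    using floor_correct[of a] ceiling_correct[of a] unfolding truncate_def by (simp, linarith)
qed

lemma sum_two_powers_le: "(\<Sum>z = - int L..int L. (1 / 2 :: real) ^ nat \<bar>z\<bar>) \<le> 3"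
proof -
  have "(\<Sum>z = - int L..int L. (1 / 2 :: real) ^ nat \<bar>z\<bar>) = 3 - 2 * (1 / 2) ^ L"
  proof (induction L)
    case (Suc L)
    have "{- int (Suc L)..int (Suc L)} = insert (int (Suc L)) (insert (- int (Suc L)) {- int L..int L})"
      by auto
    moreover have "nat (1 + int L) = Suc L" "nat (int L + 1) = Suc L" by simp_all
    ultimately show ?case using Suc by simp
  qed simp
  then show ?thesis by simp
qed

text \<open>A generating function argument at 1/2. Since \<bar>z\<bar> is at most its square for
  integers, every lattice point of the ball has weight 2^L (1/2)^(sum of absolute values) at least
  one; the total weight factors over the coordinates, and each factor is at most 3.\<close>

lemma lattice_points_card:
  fixes R L :: nat
  defines "Z \<equiv> {z \<in> {..<R} \<rightarrow>\<^sub>E (UNIV :: int set). (\<Sum>i<R. (z i)\<^sup>2) \<le> int L}"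
  shows "finite Z" "real (card Z) \<le> 2 ^ L * 3 ^ R"
proof -
  let ?P = "{..<R} \<rightarrow>\<^sub>E {- int L..int L}"
  have absle: "\<bar>a\<bar> \<le> a\<^sup>2" for a :: int
  proof (cases "a = 0")
    case False
    then have "1 * \<bar>a\<bar> \<le> \<bar>a\<bar> * \<bar>a\<bar>" by (intro mult_right_mono) auto
    then show ?thesis by (simp add: power2_eq_square)
  qed simp
  have sumle: "(\<Sum>i<R. \<bar>z i\<bar>) \<le> int L" if "z \<in> Z" for z
    using that sum_mono[of "{..<R}" "\<lambda>i. \<bar>z i\<bar>" "\<lambda>i. (z i)\<^sup>2"] absle by (force simp: Z_def)
  have sub: "Z \<subseteq> ?P"
  proof
    fix z assume z: "z \<in> Z"
    have "\<bar>z i\<bar> \<le> int L" if "i < R" for i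
      using sumle[OF z] member_le_sum[of i "{..<R}" "\<lambda>i. \<bar>z i\<bar>"] that by auto
    then show "z \<in> ?P" using z by (force simp: Z_def PiE_def Pi_def)
  qed
  have finP: "finite ?P" by (intro finite_PiE) auto
  show fin: "finite Z" using sub finP by (rule finite_subset)
  have "real (card Z) = (\<Sum>z\<in>Z. 1)" by simp
  also have "\<dots> \<le> (\<Sum>z\<in>Z. 2 ^ L * (\<Prod>i<R. (1 / 2) ^ nat \<bar>z i\<bar>))"
  proof (intro sum_mono)
    fix z assume z: "z \<in> Z"
    have "(\<Sum>i<R. nat \<bar>z i\<bar>) \<le> L"
    proof -
      have "int (\<Sum>i<R. nat \<bar>z i\<bar>) = (\<Sum>i<R. \<bar>z i\<bar>)" by simp
      then show ?thesis using sumle[OF z] by linarith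
    qed
    then have "(1 / 2 :: real) ^ L \<le> (1 / 2) ^ (\<Sum>i<R. nat \<bar>z i\<bar>)"
      by (intro power_decreasing) auto
    also have "\<dots> = (\<Prod>i<R. (1 / 2) ^ nat \<bar>z i\<bar>)" by (rule power_sum)
    finally have "2 ^ L * (1 / 2 :: real) ^ L \<le> 2 ^ L * (\<Prod>i<R. (1 / 2) ^ nat \<bar>z i\<bar>)"
      by (rule mult_left_mono) simp
    then show "1 \<le> 2 ^ L * (\<Prod>i<R. (1 / 2 :: real) ^ nat \<bar>z i\<bar>)"
      by (simp only: power_mult_distrib[symmetric]) simp
  qed
  also have "\<dots> \<le> (\<Sum>z\<in>?P. 2 ^ L * (\<Prod>i<R. (1 / 2) ^ nat \<bar>z i\<bar>))"
    by (intro sum_mono2 finP sub mult_nonneg_nonneg prod_nonneg ballI zero_le_power) simp_all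
  also have "\<dots> = 2 ^ L * (\<Prod>i<R. \<Sum>z = - int L..int L. (1 / 2) ^ nat \<bar>z\<bar>)"
    unfolding sum_distrib_left[symmetric] by (subst prod_sum_PiE) auto
  also have "\<dots> \<le> 2 ^ L * (\<Prod>i<R. 3)"
    by (intro mult_left_mono prod_mono conjI sum_two_powers_le sum_nonneg) auto
  finally show "real (card Z) \<le> 2 ^ L * 3 ^ R" by simp
qed

text \<open>The net is the lattice of mesh \<open>1 / s\<close> in the unit ball. With
  \<open>s = 4 * sqrt R\<close> the squared rounding errors add up to at most
  \<open>R / s\<^sup>2\<close> = 1/16, and the ball scaled by \<open>s\<close> has squared radius
  \<open>16 * R\<close>.\<close>

lemma lattice_net:
  assumes "R > 0"
  obtains N where "quarter_net {..<R} N" "real (card N) \<le> 2 ^ (18 * R)"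
proof -
  define Z where "Z = {z \<in> {..<R} \<rightarrow>\<^sub>E (UNIV :: int set). (\<Sum>i<R. (z i)\<^sup>2) \<le> int (16 * R)}"
  define s where "s = 4 * sqrt (real R)"
  have s: "s > 0" "s\<^sup>2 = 16 * R" using assms by (auto simp: s_def power_mult_distrib)
  define N where "N = (\<lambda>z i. of_int (z i) / s) ` Z"
  have Z: "finite Z" "real (card Z) \<le> 2 ^ (16 * R) * 3 ^ R"
    using lattice_points_card[of R "16 * R"] by (auto simp: Z_def)
  have "real (card N) \<le> real (card Z)"
    unfolding N_def using Z(1) by (simp add: card_image_le)
  also have "\<dots> \<le> 2 ^ (16 * R) * 4 ^ R"
    using Z(2) power_mono[of "3::real" 4 R] by (smt (verit) mult_left_mono zero_le_power)
  also have "\<dots> = 2 ^ (18 * R)"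
  proof -
    have "(4::real) ^ R = 2 ^ (2 * R)" by (simp add: power_mult)
    then show ?thesis by (simp add: power_add[symmetric])
  qed
  finally have card: "real (card N) \<le> 2 ^ (18 * R)" .
  have "dot {..<R} x x \<le> 1" if xN: "x \<in> N" for x
  proof -
    obtain z where z: "z \<in> Z" "x = (\<lambda>i. of_int (z i) / s)" using xN unfolding N_def by blast
    have "of_int (\<Sum>i<R. (z i)\<^sup>2) \<le> (of_int (int (16 * R)) :: real)"
      using z(1) unfolding Z_def of_int_le_iff by simp
    then have "dot {..<R} x x * s\<^sup>2 \<le> s\<^sup>2"
      using s by (simp add: z(2) dot_def power2_eq_square sum_divide_distrib[symmetric])
    then show ?thesis using s(1) by simp
  qed
  moreover have "\<exists>x'\<in>N. dot {..<R} (\<lambda>i. x i - x' i) (\<lambda>i. x i - x' i) \<le> (1 / 4)\<^sup>2" if x: "dot {..<R} x x \<le> 1" for x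
  proof -
    define z where "z = (\<lambda>i\<in>{..<R}. truncate (s * x i))"
    have "(\<Sum>i<R. (real_of_int (z i))\<^sup>2) \<le> (\<Sum>i<R. (s * x i)\<^sup>2)"
    proof (intro sum_mono)
      fix i assume "i \<in> {..<R}"
      then show "(real_of_int (z i))\<^sup>2 \<le> (s * x i)\<^sup>2"
        using truncate(1)[of "s * x i"] by (simp add: z_def abs_le_square_iff)
    qed
    also have "\<dots> = s\<^sup>2 * dot {..<R} x x" by (simp add: dot_def sum_distrib_left power2_eq_square mult_ac)
    also have "\<dots> \<le> 16 * R" using x s by (simp add: mult_left_le)
    finally have "of_int (\<Sum>i<R. (z i)\<^sup>2) \<le> (of_int (int (16 * R)) :: real)" by simp
    then have "(\<Sum>i<R. (z i)\<^sup>2) \<le> int (16 * R)" unfolding of_int_le_iff .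
    then have "z \<in> Z" by (auto simp: Z_def z_def)
    moreover have "dot {..<R} (\<lambda>i. x i - of_int (z i) / s) (\<lambda>i. x i - of_int (z i) / s) \<le> (1 / 4)\<^sup>2"
    proof -
      have "dot {..<R} (\<lambda>i. x i - of_int (z i) / s) (\<lambda>i. x i - of_int (z i) / s) \<le> (\<Sum>i<R. 1 / s\<^sup>2)"
        unfolding dot_def
      proof (intro sum_mono)
        fix i assume i: "i \<in> {..<R}"
        have "\<bar>s * x i - of_int (z i)\<bar> \<le> 1" using truncate(2)[of "s * x i"] i by (simp add: z_def)
        then have "(s * x i - of_int (z i))\<^sup>2 \<le> 1" by (simp add: abs_square_le_1)
        moreover have "(x i - of_int (z i) / s) = (s * x i - of_int (z i)) / s" using s(1) by (simp add: field_simps)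
        ultimately show "(x i - of_int (z i) / s) * (x i - of_int (z i) / s) \<le> 1 / s\<^sup>2"
          by (simp add: power2_eq_square divide_right_mono)
      qed
      also have "\<dots> = (1 / 4)\<^sup>2" using assms unfolding s(2) by (simp add: power2_eq_square)
      finally show ?thesis .
    qed
    ultimately show ?thesis
      unfolding N_def by (intro bexI[of _ "\<lambda>i. of_int (z i) / s"]) auto
  qed
  ultimately have "quarter_net {..<R} N" using Z(1) by (auto simp: quarter_net_def N_def)
  then show ?thesis using that card by blast
qed


section \<open>The spectral tail bound\<close>

lemma power_over_fact_le_exp:
  fixes a :: real
  assumes "a \<ge> 0"
  shows "a ^ n / fact n \<le> exp a"
proof -
  have "(\<Sum>k\<in>{n}. a ^ k /\<^sub>R fact k) \<le> (\<Sum>k. a ^ k /\<^sub>R fact k)"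
    using assms by (intro sum_le_suminf summable_exp_generic) auto
  then show ?thesis by (simp add: exp_def field_simps)
qed

lemma even_power_over_fact_le_exp:
  fixes a :: real
  shows "a ^ (2 * k) / fact (2 * k) \<le> exp a + exp (- a)"
proof -
  have "a ^ (2 * k) / fact (2 * k) \<le> exp \<bar>a\<bar>"
    using power_over_fact_le_exp[of "\<bar>a\<bar>" "2 * k"] by (simp add: power_even_abs)
  also have "\<dots> \<le> exp a + exp (- a)" by (cases "a \<ge> 0") auto
  finally show ?thesis .
qed

text \<open>Hoeffding's lemma for the values 2 and -1 with probabilities 1/3 and 2/3, which span an
  interval of length 3. It is applied with a nonnegative range, so for negative \<open>u\<close> the
  two values exchange roles.\<close>

lemma skewed_mgf:
  fixes u :: real
  shows "(exp (2 * u) + 2 * exp (- u)) / 3 \<le> exp (9 * u\<^sup>2 / 8)"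
proof (cases "u \<ge> 0")
  case True
  have "- (3 * u) * (1 / 3) + ln (1 + 1 / 3 * (exp (3 * u) - 1)) \<le> (3 * u)\<^sup>2 / 8"
    using True by (intro Hoeffdings_lemma_aux) auto
  then have "ln (1 + 1 / 3 * (exp (3 * u) - 1)) \<le> u + 9 * u\<^sup>2 / 8" by (simp add: power2_eq_square)
  moreover have "1 + 1 / 3 * (exp (3 * u) - 1) > 0" by (simp add: right_diff_distrib add_pos_pos)
  ultimately have "1 + 1 / 3 * (exp (3 * u) - 1) \<le> exp (u + 9 * u\<^sup>2 / 8)"
    by (metis exp_le_cancel_iff exp_ln)
  then have "exp (- u) * (1 + 1 / 3 * (exp (3 * u) - 1)) \<le> exp (- u) * exp (u + 9 * u\<^sup>2 / 8)"
    by (intro mult_left_mono) auto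
  also have "\<dots> = exp (9 * u\<^sup>2 / 8)" by (simp add: exp_add[symmetric])
  also have "exp (- u) * (1 + 1 / 3 * (exp (3 * u) - 1)) = (exp (2 * u) + 2 * exp (- u)) / 3"
  proof -
    have "exp (- u) * exp (3 * u) = exp (2 * u)" by (simp add: exp_add[symmetric])
    then show ?thesis by (simp add: algebra_simps)
  qed
  finally show ?thesis .
next
  case False
  define h where "h = - 3 * u"
  have "- h * (2 / 3) + ln (1 + 2 / 3 * (exp h - 1)) \<le> h\<^sup>2 / 8"
    using False by (intro Hoeffdings_lemma_aux) (auto simp: h_def)
  then have "ln (1 + 2 / 3 * (exp h - 1)) \<le> - 2 * u + 9 * u\<^sup>2 / 8" by (simp add: h_def power2_eq_square)
  moreover have "1 + 2 / 3 * (exp h - 1) > 0" by (simp add: right_diff_distrib add_pos_pos)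
  ultimately have "1 + 2 / 3 * (exp h - 1) \<le> exp (- 2 * u + 9 * u\<^sup>2 / 8)"
    by (metis exp_le_cancel_iff exp_ln)
  then have "exp (2 * u) * (1 + 2 / 3 * (exp h - 1)) \<le> exp (2 * u) * exp (- 2 * u + 9 * u\<^sup>2 / 8)"
    by (intro mult_left_mono) auto
  also have "\<dots> = exp (9 * u\<^sup>2 / 8)" by (simp add: exp_add[symmetric])
  also have "exp (2 * u) * (1 + 2 / 3 * (exp h - 1)) = (exp (2 * u) + 2 * exp (- u)) / 3"
  proof -
    have "exp (2 * u) * exp h = exp (- u)" by (simp add: exp_add[symmetric] h_def)
    moreover have "exp (2 * u) * (1 + 2 / 3 * (exp h - 1)) = exp (2 * u) / 3 + 2 / 3 * (exp (2 * u) * exp h)"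
      by (simp add: field_simps)
    ultimately show ?thesis by (simp add: add_divide_distrib)
  qed
  finally show ?thesis .
qed

section \<open>Forms over node pairs and the moments of the comparison matrix\<close>

lemma finite_node_pairs [simp]: "finite (node_pairs n)"
  by (rule finite_subset[of _ "{..<n} \<times> {..<n}"]) (auto simp: node_pairs_def)

lemma sum_off_diagonal:
  fixes g :: "nat \<Rightarrow> nat \<Rightarrow> real"
  assumes "\<And>i. g i i = 0"
  shows "(\<Sum>i<n. \<Sum>j<n. g i j) = (\<Sum>(i, j)\<in>node_pairs n. g i j + g j i)"
proof -
  let ?D = "{(i, j). i < n \<and> j < n}" and ?L = "(\<lambda>(i, j). (j, i)) ` node_pairs n"
  have "(\<Sum>i<n. \<Sum>j<n. g i j) = (\<Sum>(i, j)\<in>{..<n} \<times> {..<n}. g i j)"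
    by (rule sum.cartesian_product)
  also have "\<dots> = (\<Sum>(i, j)\<in>node_pairs n \<union> ?L. g i j)"
  proof (intro sum.mono_neutral_right)
    show "\<forall>p\<in>{..<n} \<times> {..<n} - (node_pairs n \<union> ?L). (case p of (i, j) \<Rightarrow> g i j) = 0"
    proof
      fix p assume p: "p \<in> {..<n} \<times> {..<n} - (node_pairs n \<union> ?L)"
      then have "fst p = snd p"
        by (cases "fst p" "snd p" rule: linorder_cases) (auto simp: node_pairs_def image_iff split: prod.splits)
      then show "(case p of (i, j) \<Rightarrow> g i j) = 0" using assms by (cases p) auto
    qed
  qed (use finite_node_pairs in \<open>auto simp: node_pairs_def\<close>)
  also have "\<dots> = (\<Sum>(i, j)\<in>node_pairs n. g i j) + (\<Sum>(i, j)\<in>?L. g i j)"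
    by (intro sum.union_disjoint finite_imageI finite_node_pairs) (auto simp: node_pairs_def)
  also have "(\<Sum>(i, j)\<in>?L. g i j) = (\<Sum>(i, j)\<in>node_pairs n. g j i)"
    by (subst sum.reindex) (auto simp: inj_on_def case_prod_unfold)
  finally show ?thesis by (simp add: sum.distrib case_prod_unfold)
qed

lemma bilinear_form_node_pairs:
  "dot {..<n} y (mat_vec {..<n} (sym_entry x) z) =
   (\<Sum>e\<in>node_pairs n. x e * (y (fst e) * z (snd e) + y (snd e) * z (fst e)))"
proof -
  have "dot {..<n} y (mat_vec {..<n} (sym_entry x) z) = (\<Sum>i<n. \<Sum>j<n. sym_entry x i j * (y i * z j))"
    by (simp add: dot_def mat_vec_def sum_distrib_left mult_ac)
  also have "\<dots> = (\<Sum>(i, j)\<in>node_pairs n. sym_entry x i j * (y i * z j) + sym_entry x j i * (y j * z i))"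
    by (rule sum_off_diagonal) (simp add: sym_entry_def)
  also have "\<dots> = (\<Sum>e\<in>node_pairs n. x e * (y (fst e) * z (snd e) + y (snd e) * z (fst e)))"
    by (intro sum.cong refl)
       (auto simp: node_pairs_def sym_entry_def sym_edge_def algebra_simps split: prod.splits)
  finally show ?thesis .
qed

text \<open>A centred variable whose moments of order at least two, odd ones included, are all at least one,
  so that every doubled walk adds at least one to the trace moment. A symmetric sign would only
  serve for even multiplicities.\<close>

definition skewed :: "bool \<Rightarrow> real" where
  "skewed b = (if b then 2 else - 1)"

abbreviation skewed_law :: "nat \<Rightarrow> (nat \<times> nat \<Rightarrow> bool) pmf" where
  "skewed_law n \<equiv> Pi_pmf (node_pairs n) False (\<lambda>_. bernoulli_pmf (1 / 3))"

lemma skewed_moment_ge_1: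
  assumes "j \<ge> 2"
  shows "measure_pmf.expectation (bernoulli_pmf (1 / 3)) (\<lambda>b. skewed b ^ j) \<ge> 1"
proof (cases "even j")
  case True
  have "(2::real) ^ 2 \<le> 2 ^ j" using assms by (intro power_increasing) auto
  then show ?thesis using True by (simp add: expectation_bernoulli skewed_def)
next
  case False
  then have "j \<ge> 3" using assms by (cases "j = 2") auto
  then have "(2::real) ^ 3 \<le> 2 ^ j" by (intro power_increasing) auto
  then show ?thesis using False by (simp add: expectation_bernoulli skewed_def)
qed

text \<open>For fixed vectors the form is a sum of independent terms, one per edge, whose
  coefficients have square sum at most 2. The subgaussian constant is thus independent of
  \<open>n\<close>.\<close>

lemma skewed_bilinear_mgf:
  assumes "dot {..<n} y y \<le> 1" "dot {..<n} z z \<le> 1"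
  shows "measure_pmf.expectation (skewed_law n)
    (\<lambda>\<omega>. exp (s * dot {..<n} y (mat_vec {..<n} (sym_entry (\<lambda>e. skewed (\<omega> e))) z))) \<le> exp (9 * s\<^sup>2 / 4)"
proof -
  define a where "a = (\<lambda>e. y (fst e) * z (snd e) + y (snd e) * z (fst e))"
  have "measure_pmf.expectation (skewed_law n)
      (\<lambda>\<omega>. exp (s * dot {..<n} y (mat_vec {..<n} (sym_entry (\<lambda>e. skewed (\<omega> e))) z))) =
      measure_pmf.expectation (skewed_law n) (\<lambda>\<omega>. \<Prod>e\<in>node_pairs n. exp (s * a e * skewed (\<omega> e)))"
    unfolding bilinear_form_node_pairs
    by (simp add: exp_sum[symmetric] sum_distrib_left a_def mult_ac)
  also have "\<dots> = (\<Prod>e\<in>node_pairs n. measure_pmf.expectation (bernoulli_pmf (1 / 3)) (\<lambda>b. exp (s * a e * skewed b)))"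
    by (intro expectation_prod_Pi_pmf_signed integrable_measure_pmf_finite) auto
  also have "\<dots> \<le> (\<Prod>e\<in>node_pairs n. exp (9 * (s * a e)\<^sup>2 / 8))"
  proof (intro prod_mono conjI)
    fix e
    show "0 \<le> measure_pmf.expectation (bernoulli_pmf (1 / 3)) (\<lambda>b. exp (s * a e * skewed b))" by simp
    show "measure_pmf.expectation (bernoulli_pmf (1 / 3)) (\<lambda>b. exp (s * a e * skewed b)) \<le> exp (9 * (s * a e)\<^sup>2 / 8)"
      using skewed_mgf[of "s * a e"] by (simp add: expectation_bernoulli skewed_def field_simps)
  qed
  also have "\<dots> = exp (9 * s\<^sup>2 / 8 * (\<Sum>e\<in>node_pairs n. (a e)\<^sup>2))"
    by (simp add: exp_sum[symmetric] sum_distrib_left power_mult_distrib field_simps)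
  also have "\<dots> \<le> exp (9 * s\<^sup>2 / 8 * 2)"
  proof -
    have "(\<Sum>e\<in>node_pairs n. (a e)\<^sup>2) \<le> (\<Sum>(i, j)\<in>node_pairs n. 2 * (y i * z j)\<^sup>2 + 2 * (y j * z i)\<^sup>2)"
    proof (intro sum_mono)
      fix e
      have "(p + q)\<^sup>2 \<le> 2 * p\<^sup>2 + 2 * q\<^sup>2" for p q :: real
        using zero_le_power2[of "p - q"] by (simp add: power2_eq_square algebra_simps)
      then show "(a e)\<^sup>2 \<le> (case e of (i, j) \<Rightarrow> 2 * (y i * z j)\<^sup>2 + 2 * (y j * z i)\<^sup>2)"
        by (simp add: a_def case_prod_unfold)
    qed
    also have "\<dots> = (\<Sum>(i, j)\<in>node_pairs n. (if i = j then 0 else 2 * (y i * z j)\<^sup>2) + (if j = i then 0 else 2 * (y j * z i)\<^sup>2))"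
      by (intro sum.cong refl) (auto simp: node_pairs_def)
    also have "\<dots> = (\<Sum>i<n. \<Sum>j<n. if i = j then 0 else 2 * (y i * z j)\<^sup>2)"
      by (rule sum_off_diagonal[symmetric]) simp
    also have "\<dots> \<le> (\<Sum>i<n. \<Sum>j<n. 2 * (y i * z j)\<^sup>2)"
      by (intro sum_mono) auto
    also have "\<dots> = 2 * (dot {..<n} y y * dot {..<n} z z)"
      unfolding dot_def sum_product unfolding sum_distrib_left
      by (intro sum.cong refl) (simp add: power2_eq_square)
    also have "\<dots> \<le> 2 * (1 * 1)"
      using assms dot_self_nonneg by (intro mult_left_mono mult_mono) auto
    finally have "(\<Sum>e\<in>node_pairs n. (a e)\<^sup>2) \<le> 2" by simp
    then have "9 * s\<^sup>2 / 8 * (\<Sum>e\<in>node_pairs n. (a e)\<^sup>2) \<le> 9 * s\<^sup>2 / 8 * 2"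
      by (rule mult_left_mono) simp
    then show ?thesis by (simp only: exp_le_cancel_iff)
  qed
  finally show ?thesis by simp
qed

lemma integrable_Pi_bool [simp]:
  fixes p :: "'a \<Rightarrow> bool pmf" and h :: "_ \<Rightarrow> real"
  shows "finite I \<Longrightarrow> integrable (measure_pmf (Pi_pmf I d p)) h"
  by (intro integrable_measure_pmf_finite) simp

lemma skewed_bilinear_moment:
  assumes "dot {..<n} y y \<le> 1" "dot {..<n} z z \<le> 1" "k > 0"
  shows "measure_pmf.expectation (skewed_law n)
    (\<lambda>\<omega>. dot {..<n} y (mat_vec {..<n} (sym_entry (\<lambda>e. skewed (\<omega> e))) z) ^ (2 * k)) \<le> 2 * (128 * real k) ^ k"
proof -
  \<comment> \<open>The moment is at most (2k)! / s^(2k) times exponential moments. At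
    \<open>s = sqrt k\<close> the first factor is at most (4 k)^k and the second at most 2 * 32^k,
    whence 128.\<close>
  define s where "s = sqrt (real k)"
  define b where "b = (\<lambda>\<omega>. dot {..<n} y (mat_vec {..<n} (sym_entry (\<lambda>e. skewed (\<omega> e))) z))"
  have s: "s\<^sup>2 = k" "s > 0" using assms(3) by (auto simp: s_def)
  have s2k: "s ^ (2 * k) = real k ^ k" by (simp add: power_mult s(1))
  have "real k ^ k * measure_pmf.expectation (skewed_law n) (\<lambda>\<omega>. b \<omega> ^ (2 * k)) =
      measure_pmf.expectation (skewed_law n) (\<lambda>\<omega>. (s * b \<omega>) ^ (2 * k))"
    unfolding power_mult_distrib s2k by (rule Bochner_Integration.integral_mult_right_zero[symmetric])
  also have "\<dots> \<le> measure_pmf.expectation (skewed_law n)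
      (\<lambda>\<omega>. fact (2 * k) * (exp (s * b \<omega>) + exp (- s * b \<omega>)))"
    using even_power_over_fact_le_exp[where k = k]
    by (intro integral_mono) (auto simp: divide_le_eq mult.commute)
  also have "\<dots> = fact (2 * k) * (measure_pmf.expectation (skewed_law n) (\<lambda>\<omega>. exp (s * b \<omega>)) +
      measure_pmf.expectation (skewed_law n) (\<lambda>\<omega>. exp (- s * b \<omega>)))"
    by (simp add: Bochner_Integration.integral_add)
  also have "\<dots> \<le> fact (2 * k) * (exp (9 * s\<^sup>2 / 4) + exp (9 * (- s)\<^sup>2 / 4))"
    unfolding b_def using assms(1,2) by (intro mult_left_mono add_mono skewed_bilinear_mgf) auto
  also have "\<dots> = 2 * fact (2 * k) * exp (9 * real k / 4)" by (simp add: s(1))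
  also have "\<dots> \<le> 2 * (4 ^ k * real k ^ k * real k ^ k) * 32 ^ k"
  proof (rule mult_mono)
    have "fact (2 * k) \<le> real ((2 * k) ^ (2 * k))" by (rule fact_le_power)
    also have "\<dots> = 4 ^ k * real k ^ k * real k ^ k"
    proof -
      have "real (2 * k) ^ 2 = 4 * real k * real k" by (simp add: power2_eq_square)
      then show ?thesis by (subst of_nat_power) (simp only: power_mult power_mult_distrib)
    qed
    finally show "2 * fact (2 * k) \<le> 2 * (4 ^ k * real k ^ k * real k ^ k)" by simp
    have "exp (9 * real k / 4) \<le> exp (real (3 * k) * 1)" by simp
    also have "\<dots> = exp 1 ^ (3 * k)" by (rule exp_of_nat_mult)
    also have "\<dots> \<le> 3 ^ (3 * k)" by (intro power_mono exp_le) simp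
    also have "\<dots> = 27 ^ k" by (simp add: power_mult)
    also have "\<dots> \<le> (32::real) ^ k" by (intro power_mono) auto
    finally show "exp (9 * real k / 4) \<le> 32 ^ k" .
  qed auto
  also have "\<dots> = real k ^ k * (2 * (128 * real k) ^ k)"
  proof -
    have "4 ^ k * 32 ^ k = (128::real) ^ k" by (simp only: power_mult_distrib[symmetric]) simp
    then show ?thesis by (simp only: power_mult_distrib mult_ac)
  qed
  finally show ?thesis using assms(3) unfolding b_def by simp
qed

text \<open>Here a net loses only a constant: the dimension is \<open>2 * k\<close>, so the number
  of pairs of net points is exponential in \<open>k\<close>, of the same kind as the power
  \<open>2 * k\<close> being estimated.\<close>

lemma skewed_trace_moment:
  assumes "k > 0"
  shows "measure_pmf.expectation (skewed_law (2 * k))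
    (\<lambda>\<omega>. walk_trace {..<2 * k} (sym_entry (\<lambda>e. skewed (\<omega> e))) (2 * k)) \<le> 2 * k * (2 ^ 82 * real k) ^ k"
proof -
  let ?S = "{..<2 * k}" and ?M = "skewed_law (2 * k)"
  define b where "b = (\<lambda>x y \<omega>. dot ?S y (mat_vec ?S (sym_entry (\<lambda>e. skewed (\<omega> e))) x))"
  obtain N where N: "quarter_net ?S N" "real (card N) \<le> 2 ^ (18 * (2 * k))"
    using lattice_net[of "2 * k"] assms by auto
  have fin: "finite N" and N1: "\<And>x. x \<in> N \<Longrightarrow> dot ?S x x \<le> 1" using N(1) by (auto simp: quarter_net_def)
  have "measure_pmf.expectation ?M (\<lambda>\<omega>. walk_trace ?S (sym_entry (\<lambda>e. skewed (\<omega> e))) (2 * k)) \<le>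
      measure_pmf.expectation ?M (\<lambda>\<omega>. (2 * k) * (4 ^ k * (\<Sum>x\<in>N. \<Sum>y\<in>N. b x y \<omega> ^ (2 * k))))"
    using walk_trace_le_net[OF _ sym_entry_commute N(1)] unfolding b_def
    by (intro integral_mono) auto
  also have "\<dots> = 2 * k * (4 ^ k * (\<Sum>x\<in>N. \<Sum>y\<in>N. measure_pmf.expectation ?M (\<lambda>\<omega>. b x y \<omega> ^ (2 * k))))"
    by (simp add: Bochner_Integration.integral_sum)
  also have "\<dots> \<le> 2 * k * (4 ^ k * (\<Sum>x\<in>N. \<Sum>y\<in>N. 2 * (128 * real k) ^ k))"
    unfolding b_def using N1 assms by (intro mult_left_mono sum_mono skewed_bilinear_moment) auto
  also have "\<dots> = 2 * k * (4 ^ k * ((real (card N))\<^sup>2 * (2 * (128 * real k) ^ k)))"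
    by (simp add: power2_eq_square)
  also have "\<dots> \<le> 2 * k * (4 ^ k * ((2 ^ (36 * k))\<^sup>2 * (2 ^ k * (128 * real k) ^ k)))"
    using N(2) assms self_le_power[of "2::real" k]
    by (intro mult_left_mono mult_mono power_mono) auto
  \<comment> \<open>The factors per unit of \<open>k\<close> are 4 for passing to the net, 2^72 for
    the pairs of net points, and 2 and 2^7 from the moment of each form.\<close>
  also have "4 ^ k * ((2 ^ (36 * k))\<^sup>2 * (2 ^ k * (128 * real k) ^ k)) = (2 ^ 82 * real k) ^ k"
  proof -
    have "(2 ^ (36 * k))\<^sup>2 = (((2::real) ^ 36) ^ 2) ^ k"
      by (simp only: power_mult[symmetric] mult_ac)
    then show ?thesis by (simp only: power_mult_distrib[symmetric]) simp
  qed
  finally show ?thesis by simp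
qed

lemma doubled_walks_count:
  assumes "k > 0"
  shows "real (card {w\<in>closed_walks {..<2 * k} (2 * k). doubled (2 * k) w}) \<le> 2 * k * (2 ^ 82 * real k) ^ k"
proof -
  interpret Y: random_entries "node_pairs (2 * k)" "\<lambda>_. 1 / 3" "\<lambda>_. skewed" "{..<2 * k}"
    by unfold_locales
       (use finite_node_pairs in \<open>auto simp: node_pairs_def expectation_bernoulli skewed_def\<close>)
  have "real (card {w\<in>closed_walks {..<2 * k} (2 * k). doubled (2 * k) w}) \<le>
      measure_pmf.expectation (skewed_law (2 * k))
        (\<lambda>\<omega>. walk_trace {..<2 * k} (sym_entry (\<lambda>e. skewed (\<omega> e))) (2 * k))"
    using Y.trace_expectation_lower[OF skewed_moment_ge_1, of "2 * k"]
    unfolding Y.M_def Y.X_def walk_trace_def .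
  also have "\<dots> \<le> 2 * k * (2 ^ 82 * real k) ^ k" using skewed_trace_moment[OF assms] by simp
  finally show ?thesis by simp
qed

context random_entries
begin

lemma spectral_tail:
  fixes \<rho> :: real
  assumes "0 \<le> \<rho>" "\<rho> \<le> 1"
    and "\<And>e j. e \<in> I \<Longrightarrow> j \<ge> 2 \<Longrightarrow> \<bar>measure_pmf.expectation (bernoulli_pmf (P e)) (\<lambda>b. f e b ^ j)\<bar> \<le> \<rho>"
    and "k = 2 ^ i" "\<rho> * card S \<le> k"
  shows "measure_pmf.prob M {\<omega>. \<exists>x. dot S x (mat_vec S (X \<omega>) x) > 2 ^ 43 * sqrt k * dot S x x} \<le>
    card S * (1 / 16) ^ k"
proof -
  \<comment> \<open>Chosen so that \<open>t ^ (2 * k)\<close> is 16^k times the bound (2^82 k)^k in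
    the trace moment; Markov's inequality then leaves (1/16)^k.\<close>
  define t where "t = 2 ^ 43 * sqrt (real k)"
  have k: "k > 0" using assms(4) by simp
  have Xsym: "X \<omega> i j = X \<omega> j i" for \<omega> i j by (simp add: X_def sym_entry_commute)
  have t: "t > 0" "t ^ (2 * k) = (2 ^ 86 * real k) ^ k"
    using k by (auto simp: t_def power_mult power_mult_distrib)
  have nonneg: "walk_trace S (X \<omega>) (2 * k) \<ge> 0" for \<omega>
    unfolding walk_trace_even[OF finite_S Xsym] by (intro sum_nonneg dot_self_nonneg)
  have "measure_pmf.prob M {\<omega>. \<exists>x. dot S x (mat_vec S (X \<omega>) x) > t * dot S x x} \<le>
      measure_pmf.prob M {\<omega> \<in> space (measure_pmf M). t ^ (2 * k) \<le> walk_trace S (X \<omega>) (2 * k)}"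
  proof (intro measure_pmf.finite_measure_mono subsetI)
    fix \<omega> assume "\<omega> \<in> {\<omega>. \<exists>x. dot S x (mat_vec S (X \<omega>) x) > t * dot S x x}"
    then obtain x where "dot S x (mat_vec S (X \<omega>) x) > t * dot S x x" by auto
    then have "\<not> walk_trace S (X \<omega>) (2 * k) < t ^ (2 * k)"
      using quadratic_form_le_of_trace[of S "X \<omega>" k "Suc i" t x, OF finite_S Xsym] assms(4) t(1)
      by auto
    then show "\<omega> \<in> {\<omega> \<in> space (measure_pmf M). t ^ (2 * k) \<le> walk_trace S (X \<omega>) (2 * k)}" by simp
  qed simp
  also have "\<dots> \<le> measure_pmf.expectation M (\<lambda>\<omega>. walk_trace S (X \<omega>) (2 * k)) / t ^ (2 * k)"
    using t(1) nonneg by (intro integral_Markov_inequality_measure[where A = "{}"]) auto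
  also have "\<dots> \<le> (card S * (2 ^ 82 * real k) ^ k) / t ^ (2 * k)"
  proof (intro divide_right_mono)
    have "measure_pmf.expectation M (\<lambda>\<omega>. walk_trace S (X \<omega>) (2 * k)) \<le>
        (\<Sum>u\<in>{u\<in>closed_walks S (2 * k). doubled (2 * k) u}. \<rho> ^ (card (u ` {..2 * k}) - 1))"
      unfolding walk_trace_def by (rule trace_expectation_upper[OF assms(1-3)])
    also have "\<dots> \<le> card S / (2 * k) * card {w\<in>closed_walks {..<2 * k} (2 * k). doubled (2 * k) w}"
      using doubled_walks_comparison[OF finite_S k assms(1,5)] by simp
    also have "\<dots> \<le> card S / (2 * k) * (2 * k * (2 ^ 82 * real k) ^ k)"
      by (rule mult_left_mono) (use doubled_walks_count[OF k] in simp_all)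
    also have "\<dots> = card S * (2 ^ 82 * real k) ^ k" using k by simp
    finally show "measure_pmf.expectation M (\<lambda>\<omega>. walk_trace S (X \<omega>) (2 * k)) \<le> card S * (2 ^ 82 * real k) ^ k" .
  qed (use t in auto)
  also have "\<dots> = card S * (1 / 16) ^ k"
  proof -
    have "(2 ^ 82 * real k) ^ k / (2 ^ 86 * real k) ^ k = (2 ^ 82 * real k / (2 ^ 86 * real k)) ^ k"
      by (simp only: power_divide)
    also have "2 ^ 82 * real k / (2 ^ 86 * real k) = 1 / 16" using k by simp
    finally show ?thesis unfolding t(2) by (simp only: times_divide_eq_right[symmetric])
  qed
  finally show ?thesis unfolding t_def .
qed

end


section \<open>Concentration in the block model\<close>

locale dcsbm_recovery =
  fixes n r :: nat and c :: "nat \<Rightarrow> nat" and \<theta> :: "nat \<Rightarrow> real" and B :: "nat \<Rightarrow> nat \<Rightarrow> real"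
    and p q \<delta> lam :: real
  assumes params: "dcsbm_params n r c \<theta> B"
    and singletons: "singleton_blocks_bounded n c \<theta> B"
    and B_diag: "\<And>a. a < r \<Longrightarrow> B a a = p"
    and B_off: "\<And>a b. a < b \<Longrightarrow> b < r \<Longrightarrow> B a b = q"
    and q_nonneg: "q \<ge> 0"
    and theta_min_pos: "theta_min n \<theta> > 0"
    and delta_pos: "\<delta> > 0" and delta_less: "\<delta> < p"
    and lam_lower: "\<And>a b. a < b \<Longrightarrow> b < r \<Longrightarrow> (q + \<delta>) / (H n r c \<theta> B a * H n r c \<theta> B b) < lam"
    and lam_upper: "\<And>a. a < r \<Longrightarrow> lam < (p - \<delta>) / (H n r c \<theta> B a)\<^sup>2"
    and separation: "\<delta> > 2 ^ 50 * (sqrt (q * real n) / G_min n r c \<theta>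
      + sqrt (p * ln (real n) / (G_min n r c \<theta> * theta_min n \<theta>)))"
    and n_ge_3: "n \<ge> 3"
begin

abbreviation "tm \<equiv> theta_min n \<theta>"
abbreviation "Gm \<equiv> G_min n r c \<theta>"
abbreviation "g i \<equiv> G n c \<theta> (c i)"
abbreviation "h i \<equiv> H n r c \<theta> B (c i)"

definition "prb e = (case e of (i, j) \<Rightarrow> \<theta> i * \<theta> j * B (c i) (c j))"

lemma p_pos: "p > 0" using delta_pos delta_less by simp

lemma n_pos: "n > 0" using n_ge_3 by simp

lemma labels: "c ` {..<n} = {..<r}" using params by (simp add: dcsbm_params_def)

lemma c_less: "i < n \<Longrightarrow> c i < r" using labels by blast

lemma theta_ge: "i < n \<Longrightarrow> \<theta> i \<ge> tm"
  unfolding theta_min_def by (intro Min_le) auto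

lemma theta_pos: "i < n \<Longrightarrow> \<theta> i > 0"
  using theta_ge theta_min_pos by force

lemma g_pos: "i < n \<Longrightarrow> g i > 0"
  using G_cluster_pos[of n \<theta> i c] theta_pos by simp

lemma Gm_pos: "Gm > 0"
proof -
  have "Gm \<in> G n c \<theta> ` {..<r}"
    unfolding G_min_def using c_less[OF n_pos] by (intro Min_in) auto
  then obtain a where "a < r" "Gm = G n c \<theta> a" by auto
  moreover then obtain i where "i < n" "a = c i" using labels by (metis imageE lessThan_iff)
  ultimately show ?thesis using g_pos by simp
qed

lemma Gm_le: "i < n \<Longrightarrow> Gm \<le> g i"
  unfolding G_min_def using c_less by (intro Min_le) auto

lemma B_sym: "a < r \<Longrightarrow> b < r \<Longrightarrow> B a b = B b a"
  using params by (simp add: dcsbm_params_def)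

lemma B_neq: "a < r \<Longrightarrow> b < r \<Longrightarrow> a \<noteq> b \<Longrightarrow> B a b = q"
  using B_off[of a b] B_off[of b a] B_sym[of a b] by (cases a b rule: linorder_cases) auto

lemma B_nonneg: "a < r \<Longrightarrow> b < r \<Longrightarrow> B a b \<ge> 0"
  using params by (simp add: dcsbm_params_def)

lemma sum_clusters: "(\<Sum>a<r. \<Sum>i\<in>cluster n c a. f i) = (\<Sum>i<n. f i)" for f :: "nat \<Rightarrow> real"
proof -
  have "(\<Sum>a<r. \<Sum>i\<in>{i\<in>{..<n}. c i = a}. f i) = (\<Sum>i<n. f i)"
    using c_less by (intro sum.group) auto
  then show ?thesis by (simp add: cluster_def)
qed

text \<open>Thus \<open>\<theta> j * h j\<close> is the expected degree with a self-loop of weight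
  \<open>\<theta> j * \<theta> j * p\<close> included, which the graph does not have.\<close>

lemma theta_h: "\<theta> j * h j = (\<Sum>i<n. \<theta> i * \<theta> j * B (c i) (c j))" if "j < n"
proof -
  have "\<theta> j * h j = (\<Sum>a<r. \<Sum>i\<in>cluster n c a. \<theta> i * \<theta> j * B (c i) (c j))"
    unfolding H_def G_def sum_distrib_left
    by (intro sum.cong refl) (auto simp: cluster_def B_sym[OF c_less[OF that]])
  then show ?thesis unfolding sum_clusters .
qed

lemma h_ge: "p * g j \<le> h j" if "j < n"
proof -
  have "B (c j) (c j) * g j \<le> (\<Sum>b<r. B (c j) b * G n c \<theta> b)"
  proof (rule member_le_sum)
    fix b assume "b \<in> {..<r} - {c j}"
    moreover have "G n c \<theta> b \<ge> 0"
      unfolding G_def cluster_def by (intro sum_nonneg) (auto intro: less_imp_le theta_pos)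
    ultimately show "0 \<le> B (c j) b * G n c \<theta> b" using B_nonneg c_less[OF that] by simp
  qed (use c_less that in auto)
  then show ?thesis using B_diag c_less that by (simp add: H_def)
qed

lemma h_pos: "j < n \<Longrightarrow> h j > 0"
  using h_ge[of j] g_pos[of j] p_pos by (meson less_le_trans mult_pos_pos)

lemma lam_h_upper: "lam * (h i)\<^sup>2 < p - \<delta>" if "i < n"
  using lam_upper[OF c_less[OF that]] h_pos[OF that] by (simp add: field_simps)

lemma lam_h_lower: "q + \<delta> < lam * (h i * h j)" if "i < n" "j < n" "c i \<noteq> c j"
proof -
  have "(q + \<delta>) / (h i * h j) < lam"
    using lam_lower[of "c i" "c j"] lam_lower[of "c j" "c i"] c_less that
    by (cases "c i" "c j" rule: linorder_cases) (auto simp: mult.commute)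
  then show ?thesis using h_pos that by (simp add: pos_divide_less_eq)
qed

text \<open>The lower bound makes \<open>lam\<close> positive, so the upper bounds for the two
  clusters can be multiplied; \<open>lam * (h i * h j)\<close> is their geometric mean. In
  particular q + \<delta> is below p - \<delta>.\<close>

lemma lam_h_cross: "lam > 0 \<and> lam * (h i * h j) < p - \<delta>" if ij: "i < n" "j < n" "c i \<noteq> c j"
proof -
  have pos: "h i * h j > 0" using h_pos ij by simp
  have "0 < lam * (h i * h j)" using lam_h_lower[OF ij] q_nonneg delta_pos by linarith
  then have lam: "lam > 0" using pos by (simp add: zero_less_mult_iff)
  have "(lam * (h i * h j))\<^sup>2 = (lam * (h i)\<^sup>2) * (lam * (h j)\<^sup>2)" by (simp add: power2_eq_square)
  also have "\<dots> < (p - \<delta>) * (p - \<delta>)"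
    using lam_h_upper ij lam h_pos delta_less by (intro mult_strict_mono) auto
  finally have "(lam * (h i * h j))\<^sup>2 < (p - \<delta>)\<^sup>2" by (simp add: power2_eq_square)
  then show ?thesis using lam delta_less power_less_imp_less_base by fastforce
qed

lemma B_le_p: "i < n \<Longrightarrow> j < n \<Longrightarrow> B (c i) (c j) \<le> p"
  using lam_h_cross[of i j] lam_h_lower[of i j] B_diag[of "c i"] B_neq[of "c i" "c j"] c_less delta_pos
  by (cases "c i = c j") force+

lemma prb_01: "e \<in> node_pairs n \<Longrightarrow> 0 \<le> prb e \<and> prb e \<le> 1"
  using params c_less by (auto simp: prb_def node_pairs_def dcsbm_params_def)

lemma prb_edge: "i < n \<Longrightarrow> j < n \<Longrightarrow> prb (sym_edge i j) = \<theta> i * \<theta> j * B (c i) (c j)"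
  using B_sym[of "c i" "c j"] c_less by (auto simp: prb_def sym_edge_def min_def max_def)

text \<open>In a cluster with a second node the edge probability gives this; for a singleton it is
  the assumption \<^const>\<open>singleton_blocks_bounded\<close>.\<close>

lemma theta_p_le: "\<theta> j * p \<le> 1 / tm" if j: "j < n"
proof (cases "cluster n c (c j) = {j}")
  case True
  then have "\<theta> j * \<theta> j * p \<le> 1"
    using singletons j B_diag c_less by (auto simp: singleton_blocks_bounded_def)
  moreover have "tm * (\<theta> j * p) \<le> \<theta> j * (\<theta> j * p)"
    using theta_ge[OF j] theta_pos[OF j] p_pos by (intro mult_right_mono) auto
  ultimately show ?thesis using theta_min_pos by (simp add: field_simps)
next
  case False
  then obtain i where i: "i < n" "c i = c j" "i \<noteq> j" using j by (auto simp: cluster_def)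
  have "\<forall>i<n. \<forall>j<n. i \<noteq> j \<longrightarrow> \<theta> i * \<theta> j * B (c i) (c j) \<le> 1"
    using params unfolding dcsbm_params_def by blast
  then have "\<theta> i * \<theta> j * B (c i) (c j) \<le> 1" using i j by blast
  then have "\<theta> i * \<theta> j * p \<le> 1" using i(2) B_diag c_less[OF j] by simp
  moreover have "tm * (\<theta> j * p) \<le> \<theta> i * (\<theta> j * p)"
    using theta_ge[OF i(1)] theta_pos[OF j] p_pos by (intro mult_right_mono) auto
  ultimately show ?thesis using theta_min_pos by (simp add: field_simps)
qed

abbreviation "L \<equiv> ln (real n)"

lemma L_ge_1: "L \<ge> 1"
proof -
  have "exp 1 \<le> real n" using exp_le n_ge_3 by linarith
  then show ?thesis using n_pos by (simp add: ln_ge_iff)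
qed

text \<open>The two terms of \<open>separation\<close> are used separately: this one only in the
  spectral bound across clusters, and \<open>delta_sq\<close> wherever \<open>L\<close>
  enters.\<close>

lemma delta_Gm: "\<delta> * Gm \<ge> 2 ^ 50 * sqrt (q * n)"
proof -
  have "\<delta> \<ge> 2 ^ 50 * (sqrt (q * n) / Gm)"
    using separation p_pos L_ge_1 Gm_pos theta_min_pos
    by (smt (verit) divide_nonneg_pos mult_nonneg_nonneg mult_pos_pos real_sqrt_ge_zero mult_left_mono zero_le_power)
  then show ?thesis using Gm_pos by (simp add: field_simps)
qed

lemma delta_sq: "\<delta>\<^sup>2 * (Gm * tm) \<ge> 2 ^ 100 * (p * L)"
proof -
  have pos: "p * L / (Gm * tm) \<ge> 0" using p_pos L_ge_1 Gm_pos theta_min_pos by simp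
  have "sqrt (q * n) / Gm \<ge> 0" using q_nonneg Gm_pos by simp
  then have "2 ^ 50 * sqrt (p * L / (Gm * tm)) \<le> 2 ^ 50 * (sqrt (q * n) / Gm + sqrt (p * L / (Gm * tm)))"
    by (intro mult_left_mono) auto
  then have "\<delta> \<ge> 2 ^ 50 * sqrt (p * L / (Gm * tm))" using separation by linarith
  then have "(2 ^ 50 * sqrt (p * L / (Gm * tm)))\<^sup>2 \<le> \<delta>\<^sup>2" using pos by (intro power_mono) auto
  then have "2 ^ 100 * (p * L / (Gm * tm)) \<le> \<delta>\<^sup>2" using pos by (simp add: power_mult_distrib)
  then show ?thesis using Gm_pos theta_min_pos by (simp add: field_simps)
qed

text \<open>\<open>delta_sq\<close> divided by \<open>\<delta>\<close>, which is less than
  \<open>p\<close>. This is the form that controls the size of single entries rather than their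
  variance.\<close>

lemma delta_lin: "\<delta> * (Gm * tm) \<ge> 2 ^ 100 * L"
proof -
  have "\<delta> * (2 ^ 100 * L) \<le> 2 ^ 100 * (p * L)" using delta_less L_ge_1 by simp
  also have "\<dots> \<le> \<delta> * (\<delta> * (Gm * tm))" using delta_sq by (simp add: power2_eq_square mult_ac)
  finally show ?thesis using delta_pos by (simp only: mult_le_cancel_left_pos)
qed

definition "W \<omega> = sym_entry (\<lambda>e. of_bool (\<omega> e) - prb e)"

abbreviation "law \<equiv> Pi_pmf (node_pairs n) False (\<lambda>e. bernoulli_pmf (prb e))"

lemma W_sym: "W \<omega> i j = W \<omega> j i" by (simp add: W_def sym_entry_commute)

text \<open>The edges from \<open>j\<close> to the other nodes of \<open>T\<close> are distinct, so
  the column sum is a sum of independent terms; \<open>j\<close> itself meets the zero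
  diagonal.\<close>

lemma star_tail:
  assumes "T \<subseteq> {..<n}" "j < n" "(\<Sum>i\<in>T - {j}. \<theta> i * \<theta> j * B (c i) (c j)) \<le> V" "0 \<le> \<eta>" "\<eta> \<le> 1"
  shows "measure_pmf.prob law {\<omega>. \<eta> * V \<le> \<bar>\<Sum>i\<in>T. W \<omega> i j\<bar>} \<le> 2 * exp (- \<eta>\<^sup>2 * V / 4)"
proof -
  define F where "F = (\<lambda>i. sym_edge i j) ` (T - {j})"
  have inj: "inj_on (\<lambda>i. sym_edge i j) (T - {j})" by (auto simp: inj_on_def sym_edge_eq_iff)
  have sub: "F \<subseteq> node_pairs n"
    using assms(1,2) by (auto simp: F_def node_pairs_def sym_edge_def)
  have fin: "finite T" using assms(1) finite_subset by auto
  have "(\<Sum>e\<in>F. prb e) = (\<Sum>i\<in>T - {j}. \<theta> i * \<theta> j * B (c i) (c j))"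
    unfolding F_def sum.reindex[OF inj] comp_def
    using assms(1,2) by (intro sum.cong refl prb_edge) auto
  then have V: "(\<Sum>e\<in>F. prb e) \<le> V" using assms(3) by simp
  have "(\<Sum>i\<in>T. W \<omega> i j) = (\<Sum>e\<in>F. of_bool (\<omega> e) - prb e)" for \<omega>
    unfolding F_def sum.reindex[OF inj] comp_def
    using fin by (intro sum.mono_neutral_cong_right) (auto simp: W_def sym_entry_def)
  then show ?thesis using bernoulli_sum_tail[OF finite_node_pairs sub prb_01 V assms(4,5)] by simp
qed

lemma exp_neg_L: "exp (- (real m * L)) = 1 / real n ^ m"
  using n_pos by (simp add: exp_minus exp_of_nat_mult divide_simps)

lemma cluster_sum_tail:
  assumes "k < n" "j < n"
  shows "measure_pmf.prob law {\<omega>. \<delta> / 24 * (g k * \<theta> j) \<le> \<bar>\<Sum>i\<in>cluster n c (c k). W \<omega> i j\<bar>} \<le> 2 / real n ^ 4"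
proof -
  define V where "V = p * (g k * \<theta> j)"
  define \<eta> where "\<eta> = \<delta> / (24 * p)"
  have eta: "0 \<le> \<eta>" "\<eta> \<le> 1" using delta_pos delta_less by (auto simp: \<eta>_def)
  have "(\<Sum>i\<in>cluster n c (c k) - {j}. \<theta> i * \<theta> j * B (c i) (c j)) \<le> (\<Sum>i\<in>cluster n c (c k). \<theta> i * \<theta> j * p)"
  proof -
    have le: "0 \<le> \<theta> i * \<theta> j * B (c i) (c j)" "\<theta> i * \<theta> j * B (c i) (c j) \<le> \<theta> i * \<theta> j * p"
      if "i \<in> cluster n c (c k)" for i
    proof -
      have "i < n" using that by (simp add: cluster_def)
      then show "0 \<le> \<theta> i * \<theta> j * B (c i) (c j)" "\<theta> i * \<theta> j * B (c i) (c j) \<le> \<theta> i * \<theta> j * p"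
        using B_le_p[of i j] assms(2) theta_pos[of i] theta_pos[of j] B_nonneg c_less
        by (auto intro!: mult_left_mono)
    qed
    have "(\<Sum>i\<in>cluster n c (c k) - {j}. \<theta> i * \<theta> j * B (c i) (c j)) \<le>
        (\<Sum>i\<in>cluster n c (c k). \<theta> i * \<theta> j * B (c i) (c j))"
      using le(1) by (intro sum_mono2) (auto simp: cluster_def)
    also have "\<dots> \<le> (\<Sum>i\<in>cluster n c (c k). \<theta> i * \<theta> j * p)" using le(2) by (rule sum_mono)
    finally show ?thesis .
  qed
  also have "\<dots> = V" unfolding V_def G_def by (simp add: sum_distrib_left sum_distrib_right mult_ac)
  finally have V: "(\<Sum>i\<in>cluster n c (c k) - {j}. \<theta> i * \<theta> j * B (c i) (c j)) \<le> V" .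
  have eqV: "\<eta> * V = \<delta> / 24 * (g k * \<theta> j)" using p_pos by (simp add: \<eta>_def V_def)
  have "measure_pmf.prob law {\<omega>. \<eta> * V \<le> \<bar>\<Sum>i\<in>cluster n c (c k). W \<omega> i j\<bar>} \<le> 2 * exp (- \<eta>\<^sup>2 * V / 4)"
    by (rule star_tail[OF _ assms(2) V eta]) (auto simp: cluster_def)
  moreover have "exp (- \<eta>\<^sup>2 * V / 4) \<le> exp (- (real 4 * L))"
  proof -
    \<comment> \<open>The exponent \<open>\<eta>\<^sup>2 * V / 4\<close> equals \<delta>^2 g
      \<theta> / (2304 p), and it has to reach \<open>4 * L\<close>, since pairs of nodes enter the
      union bound.\<close>
    have "4 * 2304 * (p * L) \<le> 2 ^ 100 * (p * L)" using p_pos L_ge_1 by (intro mult_right_mono) auto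
    also have "\<dots> \<le> \<delta>\<^sup>2 * (Gm * tm)" by (rule delta_sq)
    also have "\<dots> \<le> \<delta>\<^sup>2 * (g k * \<theta> j)"
      using Gm_le[OF assms(1)] theta_ge[OF assms(2)] Gm_pos theta_min_pos by (intro mult_left_mono mult_mono) auto
    finally have "4 * L \<le> \<eta>\<^sup>2 * V / 4"
      using p_pos by (simp add: \<eta>_def V_def power2_eq_square field_simps)
    then show ?thesis by simp
  qed
  ultimately have "measure_pmf.prob law {\<omega>. \<delta> / 24 * (g k * \<theta> j) \<le> \<bar>\<Sum>i\<in>cluster n c (c k). W \<omega> i j\<bar>} \<le> 2 * (1 / real n ^ 4)"
    unfolding eqV exp_neg_L by linarith
  then show ?thesis by (simp only: times_divide_eq_right mult_1_right)
qed

lemma degree_tail: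
  assumes "j < n"
  shows "measure_pmf.prob law {\<omega>. \<delta> / (12 * p) * (\<theta> j * h j) \<le> \<bar>\<Sum>i<n. W \<omega> i j\<bar>} \<le> 2 / real n ^ 3"
proof -
  define V where "V = \<theta> j * h j"
  define \<eta> where "\<eta> = \<delta> / (12 * p)"
  have eta: "0 \<le> \<eta>" "\<eta> \<le> 1" using delta_pos delta_less by (auto simp: \<eta>_def)
  have V: "(\<Sum>i\<in>{..<n} - {j}. \<theta> i * \<theta> j * B (c i) (c j)) \<le> V"
    unfolding V_def theta_h[OF assms] using theta_pos B_nonneg c_less assms
    by (intro sum_mono2) (auto simp: less_imp_le)
  have "measure_pmf.prob law {\<omega>. \<eta> * V \<le> \<bar>\<Sum>i<n. W \<omega> i j\<bar>} \<le> 2 * exp (- \<eta>\<^sup>2 * V / 4)"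
    by (rule star_tail[OF _ assms V eta]) auto
  moreover have "exp (- \<eta>\<^sup>2 * V / 4) \<le> exp (- (real 3 * L))"
  proof -
    \<comment> \<open>As before, now with exponent \<delta>^2 \<theta> h / (576 p^2) and target
      \<open>3 * L\<close>; \<open>h_ge\<close> cancels one factor \<open>p\<close>.\<close>
    have "3 * 576 * (p * L) \<le> 2 ^ 100 * (p * L)" using p_pos L_ge_1 by (intro mult_right_mono) auto
    also have "\<dots> \<le> \<delta>\<^sup>2 * (Gm * tm)" by (rule delta_sq)
    also have "\<dots> \<le> \<delta>\<^sup>2 * (g j * \<theta> j)"
      using Gm_le[OF assms] theta_ge[OF assms] Gm_pos theta_min_pos by (intro mult_left_mono mult_mono) auto
    finally have "p * (3 * 576 * (p * L)) \<le> p * (\<delta>\<^sup>2 * (g j * \<theta> j))" using p_pos by simp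
    also have "\<dots> = \<delta>\<^sup>2 * \<theta> j * (p * g j)" by simp
    also have "\<dots> \<le> \<delta>\<^sup>2 * \<theta> j * h j"
      using h_ge[OF assms] theta_pos[OF assms] by (intro mult_left_mono) auto
    finally have "3 * L \<le> \<eta>\<^sup>2 * V / 4"
      using p_pos by (simp add: \<eta>_def V_def power2_eq_square field_simps)
    then show ?thesis by simp
  qed
  ultimately show ?thesis unfolding exp_neg_L \<eta>_def V_def by simp
qed

end

section \<open>Spectral bounds for the blocks of the noise matrix\<close>

lemma power_of_two_between:
  fixes x :: real
  assumes "x \<ge> 1"
  obtains i :: nat where "x \<le> 2 ^ i" "2 ^ i \<le> 2 * x"
proof -
  obtain m :: nat where "x < 2 ^ m" using real_arch_pow[of 2 x] by auto
  then have ex: "\<exists>i :: nat. x \<le> 2 ^ i" using less_imp_le by blast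
  define i where "i = (LEAST i :: nat. x \<le> 2 ^ i)"
  have "x \<le> 2 ^ i" unfolding i_def using ex by (rule LeastI_ex)
  moreover have "2 ^ i \<le> 2 * x"
  proof (cases i)
    case 0
    then show ?thesis using assms by simp
  next
    case (Suc j)
    then have "\<not> x \<le> 2 ^ j" unfolding i_def by (intro not_less_Least) simp
    then show ?thesis using Suc by simp
  qed
  ultimately show ?thesis using that by blast
qed

text \<open>The scaled entries are at most one in absolute value, so every higher moment is
  dominated by the variance.\<close>

lemma bernoulli_centered_moment:
  fixes s x :: real
  assumes "0 \<le> x" "x \<le> 1" "0 \<le> s" "s \<le> 1" "m \<ge> 2"
  shows "\<bar>measure_pmf.expectation (bernoulli_pmf x) (\<lambda>b. (s * (of_bool b - x)) ^ m)\<bar> \<le> min 1 (s\<^sup>2 * x)"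
proof -
  have sx: "\<bar>s * (1 - x)\<bar> \<le> 1" "\<bar>s * (- x)\<bar> \<le> 1"
    using assms by (auto simp: abs_mult intro!: mult_le_one)
  have dec: "\<bar>y ^ m\<bar> \<le> y\<^sup>2" if "\<bar>y\<bar> \<le> 1" for y :: real
    using power_decreasing[OF assms(5), of "\<bar>y\<bar>"] that by (simp add: power_abs)
  have "\<bar>measure_pmf.expectation (bernoulli_pmf x) (\<lambda>b. (s * (of_bool b - x)) ^ m)\<bar> =
      \<bar>x * (s * (1 - x)) ^ m + (1 - x) * (s * (- x)) ^ m\<bar>"
    using assms by (simp add: expectation_bernoulli mult.commute)
  also have "\<dots> \<le> x * \<bar>(s * (1 - x)) ^ m\<bar> + (1 - x) * \<bar>(s * (- x)) ^ m\<bar>"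
    using assms by (intro order_trans[OF abs_triangle_ineq]) (simp add: abs_mult)
  also have "\<dots> \<le> x * (s * (1 - x))\<^sup>2 + (1 - x) * (s * (- x))\<^sup>2"
    using assms dec[OF sx(1)] dec[OF sx(2)] by (intro add_mono mult_left_mono) auto
  also have "\<dots> = s\<^sup>2 * x * (1 - x)" by (simp add: power2_eq_square algebra_simps)
  also have "\<dots> \<le> s\<^sup>2 * x" using assms by (simp add: mult_left_le)
  finally have 1: "\<bar>measure_pmf.expectation (bernoulli_pmf x) (\<lambda>b. (s * (of_bool b - x)) ^ m)\<bar> \<le> s\<^sup>2 * x" .
  have "s\<^sup>2 * x \<le> 1" using assms by (intro mult_le_one) (auto simp: power_le_one)
  then show ?thesis using 1 by simp
qed

context dcsbm_recovery
begin

text \<open>The substitution of \<open>z i * sqrt (\<theta> i)\<close> for \<open>z i\<close> moves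
  the weights into the matrix. Multiplied by \<open>tm / sqrt (\<theta> i * \<theta> j)\<close>, the
  entries of \<open>W\<close> are bounded by 1 and their variance by
  \<open>tm\<^sup>2 * \<beta>\<close>, without \<open>\<theta>\<close>. The mask
  \<open>\<phi>\<close> selects the pairs across clusters, or all pairs of a single cluster.\<close>

lemma block_spectral:
  assumes S: "S \<subseteq> {..<n}" and \<beta>: "\<beta> \<ge> 0"
    and B_le: "\<And>i j. i \<in> S \<Longrightarrow> j \<in> S \<Longrightarrow> \<phi> i j \<Longrightarrow> B (c i) (c j) \<le> \<beta>"
    and \<phi>_sym: "\<And>i j. \<phi> i j = \<phi> j i"
    and \<gamma>: "\<gamma> > 0" "2 ^ 95 * (2 * L / tm\<^sup>2 + \<beta> * card S) \<le> \<gamma>\<^sup>2"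
  shows "measure_pmf.prob law {\<omega>. \<exists>z. (\<Sum>i\<in>S. \<Sum>j\<in>S. if \<phi> i j then W \<omega> i j * (z i * z j) else 0) >
    \<gamma> / 16 * (\<Sum>i\<in>S. \<theta> i * (z i)\<^sup>2)} \<le> 1 / real n ^ 3"
proof -
  define f where "f = (\<lambda>e b. if fst e \<in> S \<and> snd e \<in> S \<and> \<phi> (fst e) (snd e)
      then tm / sqrt (\<theta> (fst e) * \<theta> (snd e)) * (of_bool b - prb e) else 0)"
  define \<rho> where "\<rho> = min 1 (tm\<^sup>2 * \<beta>)"
  have \<rho>: "0 \<le> \<rho>" "\<rho> \<le> 1" "\<rho> \<le> tm\<^sup>2 * \<beta>" using \<beta> by (auto simp: \<rho>_def)
  have fin: "finite S" using S finite_subset by blast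
  interpret random_entries "node_pairs n" prb f S
  proof
    show "(i, j) \<in> node_pairs n" if "i \<in> S" "j \<in> S" "i < j" for i j
      using that S by (auto simp: node_pairs_def)
    show "measure_pmf.expectation (bernoulli_pmf (prb e)) (f e) = 0" if "e \<in> node_pairs n" for e
      using prb_01[OF that] by (simp add: expectation_bernoulli f_def)
  qed (use fin in auto)
  have M: "M = law" by (simp add: M_def)
  have moment: "\<bar>measure_pmf.expectation (bernoulli_pmf (prb e)) (\<lambda>b. f e b ^ m)\<bar> \<le> \<rho>"
    if e: "e \<in> node_pairs n" and m: "m \<ge> 2" for e m
  proof (cases "fst e \<in> S \<and> snd e \<in> S \<and> \<phi> (fst e) (snd e)")
    case False
    then have "f e = (\<lambda>_. 0)" by (auto simp: f_def)
    then show ?thesis using m \<rho>(1) by (simp add: power_0_left)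
  next
    case True
    obtain i j where ij: "e = (i, j)" "i < n" "j < n" using e by (auto simp: node_pairs_def)
    define s where "s = tm / sqrt (\<theta> i * \<theta> j)"
    have tt: "tm * tm \<le> \<theta> i * \<theta> j"
      using theta_ge ij theta_min_pos by (intro mult_mono) (auto simp: less_imp_le theta_pos)
    then have "sqrt (tm * tm) \<le> sqrt (\<theta> i * \<theta> j)" by (rule real_sqrt_le_mono)
    moreover have "sqrt (\<theta> i * \<theta> j) > 0" using theta_pos ij by simp
    ultimately have s: "0 \<le> s" "s \<le> 1"
      using theta_min_pos by (simp_all add: s_def)
    have "s\<^sup>2 * prb e = tm\<^sup>2 * B (c i) (c j)"
      using theta_pos[OF ij(2)] theta_pos[OF ij(3)] by (simp add: s_def ij(1) prb_def power_divide)
    also have "\<dots> \<le> tm\<^sup>2 * \<beta>" using True B_le ij(1) by (intro mult_left_mono) auto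
    finally have "min 1 (s\<^sup>2 * prb e) \<le> \<rho>" unfolding \<rho>_def by auto
    moreover have "f e = (\<lambda>b. s * (of_bool b - prb e))" using True by (auto simp: f_def s_def ij(1))
    moreover have "\<bar>measure_pmf.expectation (bernoulli_pmf (prb e)) (\<lambda>b. (s * (of_bool b - prb e)) ^ m)\<bar> \<le> min 1 (s\<^sup>2 * prb e)"
      using prb_01[OF e] by (intro bernoulli_centered_moment s m) auto
    ultimately show ?thesis by (simp only: order_trans)
  qed
  \<comment> \<open>The first argument makes the failure probability polynomially small, and the
    second is what the comparison of walks requires of \<open>k\<close>.\<close>
  define x where "x = max (2 * L) (\<rho> * card S)"
  have "x \<ge> 1" using L_ge_1 by (simp add: x_def)
  then obtain l :: nat where l: "x \<le> 2 ^ l" "2 ^ l \<le> 2 * x" by (rule power_of_two_between)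
  define k :: nat where "k = 2 ^ l"
  have k: "2 * L \<le> k" "\<rho> * card S \<le> k" "k \<le> 2 * x" using l by (auto simp: k_def x_def)
  have x_le: "x \<le> 2 * L + tm\<^sup>2 * \<beta> * card S"
    using L_ge_1 \<rho> \<beta> mult_right_mono[OF \<rho>(3), of "real (card S)"] by (auto simp: x_def)
  have thr: "2 ^ 43 * sqrt k \<le> tm * (\<gamma> / 16)"
  proof (rule power2_le_imp_le)
    \<comment> \<open>Here 2^95 = 2^86 * 2 * 16^2: the squared threshold, the rounding of
      \<open>x\<close> to a power of two, and the margin 1/16.\<close>
    have "(2 ^ 43 * sqrt (real k))\<^sup>2 = 2 ^ 86 * real k" by (simp add: power_mult_distrib)
    also have "\<dots> \<le> 2 ^ 86 * (2 * (2 * L + tm\<^sup>2 * \<beta> * card S))" using k(3) x_le by simp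
    also have "\<dots> = tm\<^sup>2 / 256 * (2 ^ 95 * (2 * L / tm\<^sup>2 + \<beta> * card S))"
      using theta_min_pos by (simp add: field_simps)
    also have "\<dots> \<le> tm\<^sup>2 / 256 * \<gamma>\<^sup>2" using \<gamma>(2) by (intro mult_left_mono) auto
    also have "\<dots> = (tm * (\<gamma> / 16))\<^sup>2" by (simp add: power2_eq_square)
    finally show "(2 ^ 43 * sqrt (real k))\<^sup>2 \<le> (tm * (\<gamma> / 16))\<^sup>2" .
  qed (use theta_min_pos \<gamma>(1) in simp)
  have form: "dot S (\<lambda>i. z i * sqrt (\<theta> i)) (mat_vec S (X \<omega>) (\<lambda>i. z i * sqrt (\<theta> i))) =
      tm * (\<Sum>i\<in>S. \<Sum>j\<in>S. if \<phi> i j then W \<omega> i j * (z i * z j) else 0)" for z \<omega>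
    unfolding dot_def mat_vec_def sum_distrib_left
  proof (intro sum.cong refl)
    fix i j assume ij: "i \<in> S" "j \<in> S"
    then have pos: "sqrt (\<theta> i) > 0" "sqrt (\<theta> j) > 0" using S theta_pos by auto
    show "z i * sqrt (\<theta> i) * (X \<omega> i j * (z j * sqrt (\<theta> j))) = tm * (if \<phi> i j then W \<omega> i j * (z i * z j) else 0)"
    proof (cases "i = j")
      case False
      have "\<theta> (min i j) * \<theta> (max i j) = \<theta> i * \<theta> j" by (cases "i \<le> j") (auto simp: min_def max_def)
      moreover have "\<phi> (min i j) (max i j) = \<phi> i j" using \<phi>_sym by (auto simp: min_def max_def)
      moreover have "min i j \<in> S" "max i j \<in> S" using ij by (auto simp: min_def max_def)
      moreover have "X \<omega> i j = f (sym_edge i j) (\<omega> (sym_edge i j))"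
        using False by (simp add: X_def sym_entry_def)
      moreover have "W \<omega> i j = of_bool (\<omega> (sym_edge i j)) - prb (sym_edge i j)"
        using False by (simp add: W_def sym_entry_def)
      ultimately have "X \<omega> i j = (if \<phi> i j then tm / (sqrt (\<theta> i) * sqrt (\<theta> j)) * W \<omega> i j else 0)"
        by (simp add: f_def sym_edge_def real_sqrt_mult)
      then show ?thesis using pos by (simp add: field_simps)
    qed (simp add: X_def W_def sym_entry_def)
  qed
  have "measure_pmf.prob law {\<omega>. \<exists>z. (\<Sum>i\<in>S. \<Sum>j\<in>S. if \<phi> i j then W \<omega> i j * (z i * z j) else 0) >
      \<gamma> / 16 * (\<Sum>i\<in>S. \<theta> i * (z i)\<^sup>2)} \<le>
    measure_pmf.prob law {\<omega>. \<exists>x. dot S x (mat_vec S (X \<omega>) x) > 2 ^ 43 * sqrt k * dot S x x}"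
  proof (intro measure_pmf.finite_measure_mono subsetI)
    fix \<omega> assume "\<omega> \<in> {\<omega>. \<exists>z. (\<Sum>i\<in>S. \<Sum>j\<in>S. if \<phi> i j then W \<omega> i j * (z i * z j) else 0) >
      \<gamma> / 16 * (\<Sum>i\<in>S. \<theta> i * (z i)\<^sup>2)}"
    then obtain z where z: "(\<Sum>i\<in>S. \<Sum>j\<in>S. if \<phi> i j then W \<omega> i j * (z i * z j) else 0) >
      \<gamma> / 16 * (\<Sum>i\<in>S. \<theta> i * (z i)\<^sup>2)" by auto
    let ?x = "\<lambda>i. z i * sqrt (\<theta> i)"
    have xx: "dot S ?x ?x = (\<Sum>i\<in>S. \<theta> i * (z i)\<^sup>2)"
      unfolding dot_def
    proof (intro sum.cong refl)
      fix i assume "i \<in> S"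
      then have "sqrt (\<theta> i) * sqrt (\<theta> i) = \<theta> i" using S theta_pos by (auto simp: less_imp_le)
      then show "z i * sqrt (\<theta> i) * (z i * sqrt (\<theta> i)) = \<theta> i * (z i)\<^sup>2"
        by (simp add: power2_eq_square mult_ac)
    qed
    have "2 ^ 43 * sqrt k * dot S ?x ?x \<le> tm * (\<gamma> / 16) * dot S ?x ?x"
      by (intro mult_right_mono thr dot_self_nonneg)
    also have "\<dots> < dot S ?x (mat_vec S (X \<omega>) ?x)"
      unfolding form xx using z theta_min_pos by (simp add: mult.assoc)
    finally show "\<omega> \<in> {\<omega>. \<exists>x. dot S x (mat_vec S (X \<omega>) x) > 2 ^ 43 * sqrt k * dot S x x}" by blast
  qed simp
  also have "\<dots> \<le> card S * (1 / 16) ^ k"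
    using spectral_tail[OF \<rho>(1,2) moment k_def k(2)] unfolding M by simp
  also have "\<dots> \<le> real n * (1 / real n ^ 4)"
  proof (intro mult_mono)
    show "real (card S) \<le> real n" using card_mono[OF _ S] by simp
    \<comment> \<open>Since 1/16 is at most exp (-2), the bound \<open>2 * L \<le> k\<close> yields
      (1/16)^k \<le> n^(-4).\<close>
    have "exp 2 = exp (1::real) ^ 2" using exp_double[of "1::real"] by simp
    also have "\<dots> \<le> (3::real) ^ 2" by (intro power_mono exp_le) simp
    finally have "1 / 16 \<le> exp (- 2 :: real)" by (simp add: exp_minus field_simps)
    then have "(1 / 16) ^ k \<le> exp (- 2 :: real) ^ k" by (intro power_mono) auto
    also have "\<dots> = exp (- (2 * real k))" by (simp add: exp_of_nat_mult[symmetric] mult.commute)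
    also have "\<dots> \<le> exp (- (real 4 * L))" using k(1) by simp
    finally show "(1 / 16) ^ k \<le> 1 / real n ^ 4" unfolding exp_neg_L .
  qed auto
  also have "\<dots> = 1 / real n ^ 3" using n_pos by (simp add: eval_nat_numeral)
  finally show ?thesis .
qed

text \<open>The spectral conditions quantify over all \<open>z\<close>, so they may be applied to
  Gram factors that depend on the graph. The error budget is three averages of \<delta>/24 plus two
  spectral parts of \<delta>/16, in total \<delta>/4, against a signal of \<delta>/2. Clusters are
  indexed by their nodes; the repetitions cost only a factor \<open>n\<close> in the union
  bound.\<close>

definition good :: "(nat \<times> nat \<Rightarrow> bool) \<Rightarrow> bool" where
  "good \<omega> \<longleftrightarrow>
     (\<forall>k<n. \<forall>j<n. \<bar>\<Sum>i\<in>cluster n c (c k). W \<omega> i j\<bar> < \<delta> / 24 * (g k * \<theta> j)) \<and>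
     (\<forall>j<n. \<bar>\<Sum>i<n. W \<omega> i j\<bar> < \<delta> / (12 * p) * (\<theta> j * h j)) \<and>
     (\<forall>z. (\<Sum>i<n. \<Sum>j<n. if c i \<noteq> c j then W \<omega> i j * (z i * z j) else 0) \<le>
        \<delta> * Gm / 16 * (\<Sum>i<n. \<theta> i * (z i)\<^sup>2)) \<and>
     (\<forall>k<n. \<forall>z. (\<Sum>i\<in>cluster n c (c k). \<Sum>j\<in>cluster n c (c k). W \<omega> i j * (z i * z j)) \<le>
        \<delta> * g k / 16 * (\<Sum>i\<in>cluster n c (c k). \<theta> i * (z i)\<^sup>2))"

text \<open>This pays for the entry bound \<open>1 / tm\<close> in \<open>block_spectral\<close>.
  Squaring \<open>delta_lin\<close> even provides \<open>L\<^sup>2\<close>, which is at least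
  \<open>L\<close>.\<close>

lemma log_threshold: "2 ^ 97 * (2 * L / tm\<^sup>2) \<le> (\<delta> * Gm)\<^sup>2"
proof -
  have "(2 ^ 100 * L)\<^sup>2 \<le> (\<delta> * (Gm * tm))\<^sup>2"
    using delta_lin L_ge_1 by (intro power_mono) auto
  also have "\<dots> = (\<delta> * Gm)\<^sup>2 * tm\<^sup>2" by (simp add: power_mult_distrib mult_ac)
  finally have "2 ^ 200 * L\<^sup>2 \<le> (\<delta> * Gm)\<^sup>2 * tm\<^sup>2" by (simp add: power_mult_distrib)
  moreover have "2 ^ 98 * L \<le> 2 ^ 200 * L\<^sup>2"
    using L_ge_1 by (intro mult_mono) (auto simp: power2_eq_square)
  ultimately have "2 ^ 98 * L \<le> (\<delta> * Gm)\<^sup>2 * tm\<^sup>2" by linarith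
  then show ?thesis using theta_min_pos by (simp add: pos_divide_le_eq)
qed

lemma threshold_combine: "0 \<le> X \<Longrightarrow> 2 ^ 97 * A \<le> X \<Longrightarrow> 2 ^ 100 * b \<le> X \<Longrightarrow> 2 ^ 95 * (A + b) \<le> X" for X A b :: real
  by simp

lemma off_block_tail:
  "measure_pmf.prob law {\<omega>. \<exists>z. (\<Sum>i<n. \<Sum>j<n. if c i \<noteq> c j then W \<omega> i j * (z i * z j) else 0) >
    \<delta> * Gm / 16 * (\<Sum>i<n. \<theta> i * (z i)\<^sup>2)} \<le> 1 / real n ^ 3"
proof (rule block_spectral[where \<phi> = "\<lambda>i j. c i \<noteq> c j" and \<beta> = q])
  show "B (c i) (c j) \<le> q" if "i \<in> {..<n}" "j \<in> {..<n}" "c i \<noteq> c j" for i j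
    using that B_neq c_less by simp
  have "(2 ^ 50 * sqrt (q * n))\<^sup>2 \<le> (\<delta> * Gm)\<^sup>2"
    using delta_Gm q_nonneg by (intro power_mono) auto
  then have "2 ^ 100 * (q * n) \<le> (\<delta> * Gm)\<^sup>2" using q_nonneg by (simp add: power_mult_distrib)
  then show "2 ^ 95 * (2 * L / tm\<^sup>2 + q * card {..<n}) \<le> (\<delta> * Gm)\<^sup>2"
    using threshold_combine[OF _ log_threshold, of "q * card {..<n}"] by simp
qed (use q_nonneg delta_pos Gm_pos in auto)

text \<open>Nodes have weight at least \<open>tm\<close>, so the cluster has at most
  \<open>g k / tm\<close> of them and its row variance is at most \<open>p * g k / tm\<close>. The
  logarithmic term of \<open>separation\<close> already covers this, as
  \<open>L \<ge> 1\<close>.\<close>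

lemma in_block_tail:
  assumes "k < n"
  shows "measure_pmf.prob law {\<omega>. \<exists>z. (\<Sum>i\<in>cluster n c (c k). \<Sum>j\<in>cluster n c (c k). W \<omega> i j * (z i * z j)) >
    \<delta> * g k / 16 * (\<Sum>i\<in>cluster n c (c k). \<theta> i * (z i)\<^sup>2)} \<le> 1 / real n ^ 3"
proof -
  let ?C = "cluster n c (c k)"
  have "measure_pmf.prob law {\<omega>. \<exists>z. (\<Sum>i\<in>?C. \<Sum>j\<in>?C. if True then W \<omega> i j * (z i * z j) else 0) >
    \<delta> * g k / 16 * (\<Sum>i\<in>?C. \<theta> i * (z i)\<^sup>2)} \<le> 1 / real n ^ 3"
  proof (rule block_spectral[where \<beta> = p])
    show "B (c i) (c j) \<le> p" if "i \<in> ?C" "j \<in> ?C" for i j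
      using that B_le_p[of i j] by (simp add: cluster_def)
    have "tm * card ?C \<le> g k"
      unfolding G_def using theta_ge sum_bounded_below[of ?C tm \<theta>] by (simp add: cluster_def mult.commute)
    then have "p * card ?C * (Gm * tm) \<le> p * (g k * Gm)"
      using p_pos Gm_pos by (simp add: mult_ac)
    also have "\<dots> \<le> p * L * (g k * Gm)"
      using p_pos Gm_pos g_pos[OF assms] L_ge_1 by (intro mult_right_mono) auto
    finally have "2 ^ 100 * (p * card ?C * (Gm * tm)) \<le> 2 ^ 100 * (p * L) * (g k * Gm)" by simp
    also have "\<dots> \<le> \<delta>\<^sup>2 * (Gm * tm) * (g k * Gm)"
      using delta_sq g_pos[OF assms] Gm_pos by (intro mult_right_mono) auto
    finally have "2 ^ 100 * (p * card ?C) * (Gm * tm) \<le> \<delta>\<^sup>2 * (g k * Gm) * (Gm * tm)"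
      by (simp add: mult_ac)
    then have "2 ^ 100 * (p * card ?C) \<le> \<delta>\<^sup>2 * (g k * Gm)"
      using Gm_pos theta_min_pos by (simp only: mult_le_cancel_right_pos mult_pos_pos)
    also have "\<dots> \<le> \<delta>\<^sup>2 * (g k * g k)"
      using Gm_le[OF assms] g_pos[OF assms] by (intro mult_left_mono) auto
    also have "\<dots> = (\<delta> * g k)\<^sup>2" by (simp add: power2_eq_square)
    finally have 1: "2 ^ 100 * (p * card ?C) \<le> (\<delta> * g k)\<^sup>2" .
    have "(\<delta> * Gm)\<^sup>2 \<le> (\<delta> * g k)\<^sup>2"
      using Gm_le[OF assms] Gm_pos delta_pos by (intro power_mono mult_left_mono) auto
    then show "2 ^ 95 * (2 * L / tm\<^sup>2 + p * card ?C) \<le> (\<delta> * g k)\<^sup>2"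
      using 1 log_threshold by (intro threshold_combine) auto
  qed (use p_pos delta_pos g_pos[OF assms] in \<open>auto simp: cluster_def\<close>)
  then show ?thesis by simp
qed

lemma good_prob: "measure_pmf.prob law {\<omega>. good \<omega>} \<ge> 1 - 10 / real n"
proof -
  define E1 where "E1 = (\<lambda>k j. {\<omega>. \<delta> / 24 * (g k * \<theta> j) \<le> \<bar>\<Sum>i\<in>cluster n c (c k). W \<omega> i j\<bar>})"
  define E2 where "E2 = (\<lambda>j. {\<omega>. \<delta> / (12 * p) * (\<theta> j * h j) \<le> \<bar>\<Sum>i<n. W \<omega> i j\<bar>})"
  define E3 where "E3 = {\<omega>. \<exists>z. (\<Sum>i<n. \<Sum>j<n. if c i \<noteq> c j then W \<omega> i j * (z i * z j) else 0) >
    \<delta> * Gm / 16 * (\<Sum>i<n. \<theta> i * (z i)\<^sup>2)}"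
  define E4 where "E4 = (\<lambda>k. {\<omega>. \<exists>z. (\<Sum>i\<in>cluster n c (c k). \<Sum>j\<in>cluster n c (c k). W \<omega> i j * (z i * z j)) >
    \<delta> * g k / 16 * (\<Sum>i\<in>cluster n c (c k). \<theta> i * (z i)\<^sup>2)})"
  let ?P = "measure_pmf.prob law"
  have E1: "?P (E1 k j) \<le> 2 / real n ^ 4" if "k < n" "j < n" for k j
    unfolding E1_def by (rule cluster_sum_tail[OF that])
  have E2: "?P (E2 j) \<le> 2 / real n ^ 3" if "j < n" for j
    unfolding E2_def by (rule degree_tail[OF that])
  have E4: "?P (E4 k) \<le> 1 / real n ^ 3" if "k < n" for k
    unfolding E4_def by (rule in_block_tail[OF that])
  have un: "?P (\<Union>k\<in>{..<n}. F k) \<le> (\<Sum>k<n. a)" if "\<And>k. k < n \<Longrightarrow> ?P (F k) \<le> a" for F a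
  proof -
    have "?P (\<Union>k\<in>{..<n}. F k) \<le> (\<Sum>k<n. ?P (F k))" by (rule measure_UNION_le) auto
    also have "\<dots> \<le> (\<Sum>k<n. a)" using that by (intro sum_mono) auto
    finally show ?thesis .
  qed
  have "?P (UNIV - {\<omega>. good \<omega>}) \<le> ?P ((\<Union>k\<in>{..<n}. \<Union>j\<in>{..<n}. E1 k j) \<union> (\<Union>j\<in>{..<n}. E2 j) \<union> E3 \<union> (\<Union>k\<in>{..<n}. E4 k))"
    by (intro measure_pmf.finite_measure_mono) (auto simp: good_def E1_def E2_def E3_def E4_def not_less not_le)
  also have "\<dots> \<le> ?P (\<Union>k\<in>{..<n}. \<Union>j\<in>{..<n}. E1 k j) + ?P (\<Union>j\<in>{..<n}. E2 j) + ?P E3 + ?P (\<Union>k\<in>{..<n}. E4 k)"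
    by (intro order_trans[OF measure_Un_le] add_mono order_refl) auto
  also have "\<dots> \<le> (\<Sum>k<n. \<Sum>j<n. 2 / real n ^ 4) + (\<Sum>j<n. 2 / real n ^ 3) + 1 / real n ^ 3 + (\<Sum>k<n. 1 / real n ^ 3)"
  proof (intro add_mono)
    show "?P (\<Union>k\<in>{..<n}. \<Union>j\<in>{..<n}. E1 k j) \<le> (\<Sum>k<n. \<Sum>j<n. 2 / real n ^ 4)"
      by (intro un E1)
    show "?P (\<Union>j\<in>{..<n}. E2 j) \<le> (\<Sum>j<n. 2 / real n ^ 3)"
      by (intro un E2)
    show "?P E3 \<le> 1 / real n ^ 3" unfolding E3_def by (rule off_block_tail)
    show "?P (\<Union>k\<in>{..<n}. E4 k) \<le> (\<Sum>k<n. 1 / real n ^ 3)"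
      by (intro un E4)
  qed
  also have "\<dots> = 5 / real n ^ 2 + 1 / real n ^ 3" using n_pos by (simp add: field_simps eval_nat_numeral)
  also have "\<dots> \<le> 5 / real n + 1 / real n"
    using n_ge_3 by (intro add_mono divide_left_mono) (auto intro!: self_le_power)
  also have "\<dots> \<le> 10 / real n" using n_pos by (simp add: field_simps)
  finally have "?P (UNIV - {\<omega>. good \<omega>}) \<le> 10 / real n" .
  then show ?thesis using measure_pmf.prob_compl[of "{\<omega>. good \<omega>}" law] by simp
qed

end


section \<open>Recovery on the good event\<close>

lemma trace_inner_eq:
  assumes "X \<in> carrier_mat n n" "M \<in> carrier_mat n n"
  shows "trace_inner X M = (\<Sum>i<n. \<Sum>j<n. X $$ (i, j) * M $$ (i, j))"
proof -
  have "trace_inner X M = (\<Sum>j<n. \<Sum>i<n. X $$ (i, j) * M $$ (i, j))"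
    using assms by (auto simp: trace_inner_def mat_trace_def scalar_prod_def atLeast0LessThan intro!: sum.cong)
  also have "\<dots> = (\<Sum>i<n. \<Sum>j<n. X $$ (i, j) * M $$ (i, j))" by (rule sum.swap)
  finally show ?thesis .
qed

lemma quadratic_form_eq:
  fixes M :: "real mat"
  assumes "M \<in> carrier_mat n n"
  shows "vec n x \<bullet> (M *\<^sub>v vec n x) = (\<Sum>i<n. \<Sum>j<n. M $$ (i, j) * x i * x j)"
  using assms by (auto simp: scalar_prod_def atLeast0LessThan sum_distrib_left mult_ac intro!: sum.cong)

lemma feasibleD:
  assumes "Y \<in> feasible n"
  shows "Y \<in> carrier_mat n n"
    and "\<And>i j. i < n \<Longrightarrow> j < n \<Longrightarrow> Y $$ (i, j) = Y $$ (j, i)"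
    and "\<And>x. (\<Sum>i<n. \<Sum>j<n. Y $$ (i, j) * x i * x j) \<ge> 0"
    and "\<And>i j. i < n \<Longrightarrow> j < n \<Longrightarrow> 0 \<le> Y $$ (i, j) \<and> Y $$ (i, j) \<le> 1"
    and "\<And>i. i < n \<Longrightarrow> Y $$ (i, i) = 1"
proof -
  have psd: "psd n Y" using assms by (simp add: feasible_def)
  show carr: "Y \<in> carrier_mat n n" using psd by (simp add: psd_def)
  have tr: "Y\<^sup>T = Y" using psd by (simp add: psd_def)
  show "Y $$ (i, j) = Y $$ (j, i)" if "i < n" "j < n" for i j
    using carr that index_transpose_mat(1)[of j Y i] unfolding tr by auto
  show "(\<Sum>i<n. \<Sum>j<n. Y $$ (i, j) * x i * x j) \<ge> 0" for x
  proof -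
    have "vec n x \<bullet> (Y *\<^sub>v vec n x) \<ge> 0" using psd unfolding psd_def by simp
    then show ?thesis unfolding quadratic_form_eq[OF carr] .
  qed
qed (use assms in \<open>auto simp: feasible_def\<close>)

text \<open>Its quadratic form is the sum of the squared cluster sums.\<close>

lemma partition_matrix_feasible: "partition_matrix n c \<in> feasible n"
proof -
  have carr: "partition_matrix n c \<in> carrier_mat n n" by (simp add: partition_matrix_def)
  have "v \<bullet> (partition_matrix n c *\<^sub>v v) \<ge> 0" if v: "v \<in> carrier_vec n" for v
  proof -
    define x where "x = (\<lambda>i. v $ i)"
    define A where "A = c ` {..<n}"
    have "v = vec n x" using v by (auto simp: x_def)
    then have "v \<bullet> (partition_matrix n c *\<^sub>v v) = (\<Sum>i<n. \<Sum>j<n. partition_matrix n c $$ (i, j) * x i * x j)"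
      using quadratic_form_eq[OF carr, of x] by simp
    also have "\<dots> = (\<Sum>i<n. \<Sum>j<n. \<Sum>a\<in>A. (if c i = a then x i else 0) * (if c j = a then x j else 0))"
    proof (intro sum.cong refl)
      fix i j assume ij: "i \<in> {..<n}" "j \<in> {..<n}"
      have "(\<Sum>a\<in>A. (if c i = a then x i else 0) * (if c j = a then x j else 0)) =
          (\<Sum>a\<in>A. if c i = a then (if c j = c i then x i * x j else 0) else 0)"
        by (intro sum.cong) auto
      also have "\<dots> = (if c j = c i then x i * x j else 0)"
        using ij by (simp add: A_def)
      finally show "partition_matrix n c $$ (i, j) * x i * x j =
          (\<Sum>a\<in>A. (if c i = a then x i else 0) * (if c j = a then x j else 0))"
        using ij by (simp add: partition_matrix_def)
    qed
    also have "\<dots> = (\<Sum>i<n. \<Sum>a\<in>A. \<Sum>j<n. (if c i = a then x i else 0) * (if c j = a then x j else 0))"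
      by (intro sum.cong refl sum.swap)
    also have "\<dots> = (\<Sum>a\<in>A. \<Sum>i<n. \<Sum>j<n. (if c i = a then x i else 0) * (if c j = a then x j else 0))"
      by (rule sum.swap)
    also have "\<dots> = (\<Sum>a\<in>A. (\<Sum>i<n. if c i = a then x i else 0)\<^sup>2)"
      by (simp add: power2_eq_square sum_product)
    also have "\<dots> \<ge> 0" by (intro sum_nonneg) simp
    finally show ?thesis .
  qed
  then have "psd n (partition_matrix n c)"
    using carr by (auto simp: psd_def partition_matrix_def intro!: eq_matI)
  then show ?thesis by (auto simp: feasible_def partition_matrix_def)
qed

section \<open>Signal and noise of the objective for a good graph\<close>

context dcsbm_recovery
begin

definition "adj \<omega> = sym_entry (\<lambda>e. of_bool (\<omega> e))"

definition "deg \<omega> i = (\<Sum>j<n. adj \<omega> i j)"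

definition "ystar i j = (if c i = c j then 1 else (0::real))"

lemma adjacency_entry: "i < n \<Longrightarrow> j < n \<Longrightarrow> adjacency n \<omega> $$ (i, j) = adj \<omega> i j"
  by (simp add: adjacency_def adj_def sym_entry_def sym_edge_def)

lemma objective_eq:
  assumes "Y \<in> carrier_mat n n"
  shows "objective lam (adjacency n \<omega>) Y = (\<Sum>i<n. \<Sum>j<n. Y $$ (i, j) * (adj \<omega> i j - lam * (deg \<omega> i * deg \<omega> j)))"
proof -
  have d: "degree_vec (adjacency n \<omega>) = vec n (deg \<omega>)"
    by (rule eq_vecI) (auto simp: degree_vec_def deg_def adjacency_def adj_def sym_entry_def sym_edge_def intro!: sum.cong)
  have A: "adjacency n \<omega> \<in> carrier_mat n n" by (simp add: adjacency_def)
  have M: "adjacency n \<omega> - lam \<cdot>\<^sub>m outer_prod (vec n (deg \<omega>)) (vec n (deg \<omega>)) \<in> carrier_mat n n"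
    by (intro minus_carrier_mat smult_carrier_mat) (simp add: outer_prod_def)
  show ?thesis unfolding objective_def d trace_inner_eq[OF assms M]
    using A by (intro sum.cong refl) (auto simp: outer_prod_def adjacency_entry)
qed

lemma adj_eq: "adj \<omega> i j = W \<omega> i j + \<theta> i * \<theta> j * B (c i) (c j)" if "i < n" "j < n" "i \<noteq> j"
  using that by (simp add: adj_def W_def sym_entry_def prb_edge)

lemma deg_eq: "deg \<omega> j = (\<Sum>i<n. W \<omega> i j) + \<theta> j * h j - \<theta> j * \<theta> j * p" if j: "j < n"
proof -
  have "deg \<omega> j = (\<Sum>i<n. W \<omega> i j + (if i = j then 0 else \<theta> i * \<theta> j * B (c i) (c j)))"
    unfolding deg_def
  proof (intro sum.cong refl)
    fix i assume "i \<in> {..<n}"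
    then show "adj \<omega> j i = W \<omega> i j + (if i = j then 0 else \<theta> i * \<theta> j * B (c i) (c j))"
      using adj_eq[of i j] j by (auto simp: adj_def W_def sym_entry_commute[of _ j i]) (simp add: sym_entry_def)
  qed
  also have "\<dots> = (\<Sum>i<n. W \<omega> i j) + (\<Sum>i<n. \<theta> i * \<theta> j * B (c i) (c j) - (if i = j then \<theta> j * \<theta> j * p else 0))"
    unfolding sum.distrib[symmetric] using B_diag c_less j by (intro sum.cong refl) auto
  also have "\<dots> = (\<Sum>i<n. W \<omega> i j) + \<theta> j * h j - \<theta> j * \<theta> j * p"
    using j by (simp add: sum_subtractf theta_h)
  finally show ?thesis .
qed

text \<open>Two errors share the bound equally: the random fluctuation, and the missing self-loop.
  The second is small relative to the degree by \<open>theta_p_le\<close> and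
  \<open>delta_lin\<close>.\<close>

lemma deg_bounds:
  assumes "good \<omega>" "j < n"
  shows "\<bar>deg \<omega> j - \<theta> j * h j\<bar> \<le> \<delta> / (6 * p) * (\<theta> j * h j)"
proof -
  have "\<bar>\<Sum>i<n. W \<omega> i j\<bar> \<le> \<delta> / (12 * p) * (\<theta> j * h j)"
    using assms by (auto simp: good_def less_imp_le)
  moreover have "\<theta> j * \<theta> j * p \<le> \<delta> / (12 * p) * (\<theta> j * h j)"
  proof -
    have "12 * (\<theta> j * p) \<le> 12 / tm" using theta_p_le[OF assms(2)] by simp
    also have "\<dots> \<le> \<delta> * Gm"
      using delta_lin L_ge_1 theta_min_pos by (simp add: pos_divide_le_eq mult_ac)
    also have "\<dots> \<le> \<delta> * g j" using Gm_le[OF assms(2)] delta_pos by simp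
    finally have "12 * (\<theta> j * p) * p \<le> \<delta> * g j * p" using p_pos by (intro mult_right_mono) auto
    also have "\<dots> \<le> \<delta> * h j" using h_ge[OF assms(2)] delta_pos by (simp add: mult_ac)
    finally have "\<theta> j * (12 * (\<theta> j * p) * p) \<le> \<theta> j * (\<delta> * h j)"
      using theta_pos[OF assms(2)] by (intro mult_left_mono) auto
    then show ?thesis using p_pos by (simp add: field_simps)
  qed
  moreover have "0 \<le> \<theta> j * \<theta> j * p" using p_pos by simp
  moreover have "\<delta> / (6 * p) * (\<theta> j * h j) = 2 * (\<delta> / (12 * p) * (\<theta> j * h j))" by simp
  ultimately show ?thesis unfolding deg_eq[OF assms(2)] by linarith
qed

text \<open>Relative degree errors of \<open>e = \<delta> / (6 * p)\<close> enlarge the product of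
  two degrees by at most \<open>1 + 3 * e\<close>. The cost \<open>3 * e * p\<close> = \<delta>/2 is
  half of the gap in \<open>lam_h_upper\<close>.\<close>

lemma signal_in:
  assumes "good \<omega>" "i < n" "j < n" "c i = c j"
  shows "lam * (deg \<omega> i * deg \<omega> j) \<le> \<theta> i * \<theta> j * (p - \<delta> / 2)"
proof -
  define e where "e = \<delta> / (6 * p)"
  have e: "0 \<le> e" "e \<le> 1" "6 * (e * p) = \<delta>" using delta_pos delta_less by (auto simp: e_def)
  have pos: "\<theta> i * h i > 0" "\<theta> j * h j > 0" "\<theta> i * \<theta> j > 0" using assms theta_pos h_pos by auto
  have db: "\<bar>deg \<omega> i - \<theta> i * h i\<bar> \<le> e * (\<theta> i * h i)" "\<bar>deg \<omega> j - \<theta> j * h j\<bar> \<le> e * (\<theta> j * h j)"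
    using deg_bounds[OF assms(1,2)] deg_bounds[OF assms(1,3)] by (auto simp: e_def)
  have "e * (\<theta> i * h i) \<le> \<theta> i * h i" "e * (\<theta> j * h j) \<le> \<theta> j * h j"
    using pos e by (auto intro: mult_left_le_one_le)
  then have d: "0 \<le> deg \<omega> i" "deg \<omega> i \<le> (1 + e) * (\<theta> i * h i)" "0 \<le> deg \<omega> j" "deg \<omega> j \<le> (1 + e) * (\<theta> j * h j)"
    using db by (auto simp: abs_le_iff algebra_simps)
  show ?thesis
  \<comment> \<open>A single cluster imposes no lower bound on \<open>lam\<close>, which may then be
    negative, and upper bounds for the degrees would not help.\<close>
  proof (cases "lam \<le> 0")
    case True
    have "lam * (deg \<omega> i * deg \<omega> j) \<le> 0" using True d by (simp add: mult_nonpos_nonneg)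
    also have "0 \<le> \<theta> i * \<theta> j * (p - \<delta> / 2)" using pos delta_pos delta_less by simp
    finally show ?thesis .
  next
    case False
    have hh: "lam * (h i * h j) \<le> p - \<delta>"
      using lam_h_upper[OF assms(2)] assms(4) by (simp add: power2_eq_square)
    have "lam * (deg \<omega> i * deg \<omega> j) \<le> lam * (((1 + e) * (\<theta> i * h i)) * ((1 + e) * (\<theta> j * h j)))"
      using False d pos e by (intro mult_left_mono mult_mono) auto
    also have "\<dots> = \<theta> i * \<theta> j * ((1 + e)\<^sup>2 * (lam * (h i * h j)))" by (simp add: power2_eq_square)
    also have "\<dots> \<le> \<theta> i * \<theta> j * (p - \<delta> / 2)"
    proof (intro mult_left_mono)
      have "e * e \<le> e" using e by (simp add: mult_left_le)
      have "(1 + e)\<^sup>2 * (lam * (h i * h j)) \<le> (1 + e)\<^sup>2 * (p - \<delta>)" by (intro mult_left_mono hh) simp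
      also have "\<dots> \<le> (1 + 3 * e) * (p - \<delta>)"
        using \<open>e * e \<le> e\<close> delta_less by (intro mult_right_mono) (auto simp: power2_eq_square algebra_simps)
      also have "\<dots> = p - \<delta> + 3 * (e * p) - 3 * e * \<delta>" by (simp add: algebra_simps)
      also have "\<dots> \<le> p - \<delta> / 2"
      proof -
        have "3 * e * \<delta> \<ge> 0" using e delta_pos by simp
        then show ?thesis using e(3) by linarith
      qed
      finally show "(1 + e)\<^sup>2 * (lam * (h i * h j)) \<le> p - \<delta> / 2" .
    qed (use pos in simp)
    finally show ?thesis .
  qed
qed

text \<open>The degree errors now cost at most the factor \<open>1 - 2 * e\<close>. As q + \<delta>
  is below p, the loss is at most \<open>2 * e * p\<close> = \<delta>/3, within the permitted
  \<delta>/2.\<close>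

lemma signal_out:
  assumes "good \<omega>" "i < n" "j < n" "c i \<noteq> c j"
  shows "\<theta> i * \<theta> j * (q + \<delta> / 2) \<le> lam * (deg \<omega> i * deg \<omega> j)"
proof -
  define e where "e = \<delta> / (6 * p)"
  have e: "0 \<le> e" "e \<le> 1" "6 * (e * p) = \<delta>" using delta_pos delta_less by (auto simp: e_def)
  have pos: "\<theta> i * h i > 0" "\<theta> j * h j > 0" "\<theta> i * \<theta> j > 0" using assms theta_pos h_pos by auto
  have db: "\<bar>deg \<omega> i - \<theta> i * h i\<bar> \<le> e * (\<theta> i * h i)" "\<bar>deg \<omega> j - \<theta> j * h j\<bar> \<le> e * (\<theta> j * h j)"
    using deg_bounds[OF assms(1,2)] deg_bounds[OF assms(1,3)] by (auto simp: e_def)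
  then have d: "(1 - e) * (\<theta> i * h i) \<le> deg \<omega> i" "(1 - e) * (\<theta> j * h j) \<le> deg \<omega> j"
    by (auto simp: abs_le_iff algebra_simps)
  have n0: "0 \<le> (1 - e) * (\<theta> i * h i)" "0 \<le> (1 - e) * (\<theta> j * h j)" using pos e by auto
  have lam: "lam > 0" "lam * (h i * h j) < p - \<delta>" using lam_h_cross[OF assms(2-4)] by auto
  have low: "q + \<delta> < lam * (h i * h j)" by (rule lam_h_lower[OF assms(2-4)])
  have "\<theta> i * \<theta> j * (q + \<delta> / 2) \<le> \<theta> i * \<theta> j * ((1 - e)\<^sup>2 * (lam * (h i * h j)))"
  proof (intro mult_left_mono)
    have "2 * (e * (q + \<delta>)) \<le> 2 * (e * p)"
      using low lam delta_pos e by (intro mult_left_mono) auto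
    then have "q + \<delta> / 2 \<le> (1 - 2 * e) * (q + \<delta>)" using e(3) delta_pos by (simp add: algebra_simps)
    also have "\<dots> \<le> (1 - e)\<^sup>2 * (q + \<delta>)"
      using q_nonneg delta_pos by (intro mult_right_mono) (auto simp: power2_eq_square algebra_simps)
    also have "\<dots> \<le> (1 - e)\<^sup>2 * (lam * (h i * h j))" using low by (intro mult_left_mono) auto
    finally show "q + \<delta> / 2 \<le> (1 - e)\<^sup>2 * (lam * (h i * h j))" .
  qed (use pos in simp)
  also have "\<dots> = lam * (((1 - e) * (\<theta> i * h i)) * ((1 - e) * (\<theta> j * h j)))" by (simp add: power2_eq_square)
  also have "\<dots> \<le> lam * (deg \<omega> i * deg \<omega> j)"
    using lam(1) d n0 by (intro mult_left_mono mult_mono) auto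
  finally show ?thesis .
qed

lemma sum_same_cluster:
  fixes F :: "nat \<Rightarrow> nat \<Rightarrow> real"
  shows "(\<Sum>i<n. \<Sum>j<n. if c i = c j then F i j else 0) =
    (\<Sum>a<r. \<Sum>i\<in>cluster n c a. \<Sum>j\<in>cluster n c a. F i j)"
proof -
  have "(\<Sum>i<n. \<Sum>j<n. if c i = c j then F i j else 0) = (\<Sum>a<r. \<Sum>i\<in>cluster n c a. \<Sum>j<n. if c i = c j then F i j else 0)"
    by (rule sum_clusters[symmetric])
  also have "\<dots> = (\<Sum>a<r. \<Sum>i\<in>cluster n c a. \<Sum>j\<in>cluster n c a. F i j)"
    by (intro sum.cong refl sum.mono_neutral_cong_right) (auto simp: cluster_def)
  finally show ?thesis .
qed

text \<open>The pairs across clusters use \<open>Gm \<le> g i\<close>; the pairs inside clusters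
  form a block diagonal matrix, so the bounds of its blocks add up, each with its own weight
  \<open>g\<close>.\<close>

lemma good_spectral:
  assumes "good \<omega>"
  shows "(\<Sum>i<n. \<Sum>j<n. W \<omega> i j * (z i * z j)) \<le> \<delta> / 8 * (\<Sum>i<n. g i * \<theta> i * (z i)\<^sup>2)"
proof -
  have "(\<Sum>i<n. \<Sum>j<n. W \<omega> i j * (z i * z j)) =
      (\<Sum>i<n. \<Sum>j<n. if c i \<noteq> c j then W \<omega> i j * (z i * z j) else 0) +
      (\<Sum>i<n. \<Sum>j<n. if c i = c j then W \<omega> i j * (z i * z j) else 0)"
    unfolding sum.distrib[symmetric] by (intro sum.cong refl) auto
  moreover have "(\<Sum>i<n. \<Sum>j<n. if c i \<noteq> c j then W \<omega> i j * (z i * z j) else 0) \<le> (\<Sum>i<n. \<delta> / 16 * (g i * \<theta> i * (z i)\<^sup>2))"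
  proof -
    have "(\<Sum>i<n. \<Sum>j<n. if c i \<noteq> c j then W \<omega> i j * (z i * z j) else 0) \<le> \<delta> * Gm / 16 * (\<Sum>i<n. \<theta> i * (z i)\<^sup>2)"
      using assms unfolding good_def by blast
    also have "\<dots> \<le> (\<Sum>i<n. \<delta> / 16 * (g i * \<theta> i * (z i)\<^sup>2))"
      unfolding sum_distrib_left
    proof (intro sum_mono)
      fix i assume "i \<in> {..<n}"
      then have "\<delta> / 16 * (\<theta> i * (z i)\<^sup>2) * Gm \<le> \<delta> / 16 * (\<theta> i * (z i)\<^sup>2) * g i"
        using Gm_le theta_pos[of i] delta_pos by (intro mult_left_mono) auto
      then show "\<delta> * Gm / 16 * (\<theta> i * (z i)\<^sup>2) \<le> \<delta> / 16 * (g i * \<theta> i * (z i)\<^sup>2)" by (simp add: mult_ac)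
    qed
    finally show ?thesis .
  qed
  moreover have "(\<Sum>i<n. \<Sum>j<n. if c i = c j then W \<omega> i j * (z i * z j) else 0) \<le> (\<Sum>i<n. \<delta> / 16 * (g i * \<theta> i * (z i)\<^sup>2))"
    unfolding sum_same_cluster unfolding sum_clusters[symmetric]
  proof (rule sum_mono)
    fix a assume "a \<in> {..<r}"
    then obtain k where k: "k < n" "a = c k" using labels by (metis imageE lessThan_iff)
    have "(\<Sum>i\<in>cluster n c a. \<Sum>j\<in>cluster n c a. W \<omega> i j * (z i * z j)) \<le> \<delta> * g k / 16 * (\<Sum>i\<in>cluster n c a. \<theta> i * (z i)\<^sup>2)"
      using assms k unfolding good_def by blast
    also have "\<dots> = (\<Sum>i\<in>cluster n c a. \<delta> / 16 * (g i * \<theta> i * (z i)\<^sup>2))"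
      unfolding sum_distrib_left by (intro sum.cong refl) (auto simp: cluster_def k(2))
    finally show "(\<Sum>i\<in>cluster n c a. \<Sum>j\<in>cluster n c a. W \<omega> i j * (z i * z j)) \<le>
        (\<Sum>i\<in>cluster n c a. \<delta> / 16 * (g i * \<theta> i * (z i)\<^sup>2))" .
  qed
  moreover have "(\<Sum>i<n. \<delta> / 16 * (g i * \<theta> i * (z i)\<^sup>2)) = \<delta> / 16 * (\<Sum>i<n. g i * \<theta> i * (z i)\<^sup>2)"
    by (simp only: sum_distrib_left)
  ultimately show ?thesis by linarith
qed

lemma objective_gap:
  assumes "good \<omega>" "Y \<in> feasible n"
  shows "objective lam (adjacency n \<omega>) Y - objective lam (adjacency n \<omega>) (partition_matrix n c) \<le>
    - (\<delta> / 4) * (\<Sum>i<n. \<Sum>j<n. \<theta> i * \<theta> j * \<bar>Y $$ (i, j) - ystar i j\<bar>)"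
proof -
  note Y = feasibleD[OF assms(2)]
  define y where "y = (\<lambda>i j. Y $$ (i, j))"
  define N where "N = (\<Sum>i<n. \<Sum>j<n. \<theta> i * \<theta> j * \<bar>y i j - ystar i j\<bar>)"
  obtain v where v: "\<forall>i<n. \<forall>j<n. y i j = (\<Sum>l<n. v l i * v l j)"
    using gram_decomposition[of n y] Y(2,3) unfolding y_def by blast
  have noise: "(\<Sum>i<n. \<Sum>j<n. W \<omega> i j * (y i j - ystar i j)) \<le> (3 * (\<delta> / 24) + \<delta> / 8) * N"
    unfolding N_def ystar_def
  proof (rule noise_bound[where v = v])
    show "\<bar>\<Sum>i<n. if c i = c k then W \<omega> i j else 0\<bar> \<le> \<delta> / 24 * (g k * \<theta> j)" if "k < n" "j < n" for k j
    proof -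
      have "(\<Sum>i<n. if c i = c k then W \<omega> i j else 0) = (\<Sum>i\<in>cluster n c (c k). W \<omega> i j)"
        unfolding cluster_def by (subst sum.inter_filter[symmetric]) auto
      then show ?thesis using assms(1) that by (simp add: good_def less_imp_le)
    qed
  qed (use v W_sym theta_pos good_spectral[OF assms(1)] delta_pos Y(5) in \<open>auto simp: y_def\<close>)
  have pm: "partition_matrix n c \<in> carrier_mat n n" "\<And>i j. i < n \<Longrightarrow> j < n \<Longrightarrow> partition_matrix n c $$ (i, j) = ystar i j"
    by (auto simp: partition_matrix_def ystar_def)
  have "objective lam (adjacency n \<omega>) Y - objective lam (adjacency n \<omega>) (partition_matrix n c) =
      (\<Sum>i<n. \<Sum>j<n. (y i j - ystar i j) * (adj \<omega> i j - lam * (deg \<omega> i * deg \<omega> j)))"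
    unfolding objective_eq[OF Y(1)] objective_eq[OF pm(1)] sum_subtractf[symmetric]
    by (intro sum.cong refl) (simp add: pm(2) y_def algebra_simps)
  also have "\<dots> \<le> (\<Sum>i<n. \<Sum>j<n. W \<omega> i j * (y i j - ystar i j) - \<delta> / 2 * (\<theta> i * \<theta> j * \<bar>y i j - ystar i j\<bar>))"
  proof (intro sum_mono)
    fix i j assume "i \<in> {..<n}" "j \<in> {..<n}"
    then have ij: "i < n" "j < n" by auto
    have yb: "0 \<le> y i j" "y i j \<le> 1" using Y(4)[OF ij] by (auto simp: y_def)
    define D where "D = y i j - ystar i j"
    define t where "t = \<theta> i * \<theta> j * B (c i) (c j) - lam * (deg \<omega> i * deg \<omega> j)"
    show "(y i j - ystar i j) * (adj \<omega> i j - lam * (deg \<omega> i * deg \<omega> j)) \<le>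
        W \<omega> i j * (y i j - ystar i j) - \<delta> / 2 * (\<theta> i * \<theta> j * \<bar>y i j - ystar i j\<bar>)"
    \<comment> \<open>On the diagonal the entry of \<open>adj\<close> is 0 instead of
      \<open>W\<close> plus the edge weight of the model, but there \<open>Y\<close> agrees with the
      partition matrix.\<close>
    proof (cases "i = j")
      case True
      then have "y i j - ystar i j = 0" using Y(5) ij by (simp add: y_def ystar_def)
      then show ?thesis by simp
    next
      case False
      have adj: "adj \<omega> i j - lam * (deg \<omega> i * deg \<omega> j) = W \<omega> i j + t"
        unfolding adj_eq[OF ij False] t_def by simp
      have "D * t \<le> - (\<delta> / 2) * (\<theta> i * \<theta> j * \<bar>D\<bar>)"
      proof (cases "c i = c j")
        case True
        have "B (c i) (c j) = p" using True B_diag c_less ij by simp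
        then have "\<theta> i * \<theta> j * (\<delta> / 2) \<le> t"
          using signal_in[OF assms(1) ij True] by (simp add: t_def algebra_simps)
        moreover have D: "D \<le> 0" using yb True by (simp add: D_def ystar_def)
        ultimately have "D * t \<le> D * (\<theta> i * \<theta> j * (\<delta> / 2))" by (intro mult_left_mono_neg)
        then show ?thesis using D by (simp add: mult_ac)
      next
        case False
        have "B (c i) (c j) = q" using False B_neq c_less ij by simp
        then have "t \<le> - (\<theta> i * \<theta> j * (\<delta> / 2))"
          using signal_out[OF assms(1) ij False] by (simp add: t_def algebra_simps)
        moreover have D: "D \<ge> 0" using yb False by (simp add: D_def ystar_def)
        ultimately have "D * t \<le> D * - (\<theta> i * \<theta> j * (\<delta> / 2))" by (intro mult_left_mono)
        then show ?thesis using D by (simp add: mult_ac)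
      qed
      then show ?thesis unfolding adj D_def[symmetric] by (simp add: algebra_simps)
    qed
  qed
  also have "\<dots> = (\<Sum>i<n. \<Sum>j<n. W \<omega> i j * (y i j - ystar i j)) - \<delta> / 2 * N"
    by (simp add: sum_subtractf N_def sum_distrib_left)
  also have "\<dots> \<le> - (\<delta> / 4) * N" using noise by (simp add: algebra_simps)
  finally show ?thesis unfolding N_def y_def .
qed

lemma recovery:
  assumes "good \<omega>"
  shows "solutions n lam (adjacency n \<omega>) = {partition_matrix n c}"
proof -
  have strict: "objective lam (adjacency n \<omega>) Y < objective lam (adjacency n \<omega>) (partition_matrix n c)"
    if Y: "Y \<in> feasible n" "Y \<noteq> partition_matrix n c" for Y
  proof -
    have "\<exists>i<n. \<exists>j<n. Y $$ (i, j) \<noteq> ystar i j"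
    proof (rule ccontr)
      assume "\<not> ?thesis"
      then have "Y = partition_matrix n c"
        using feasibleD(1)[OF Y(1)] by (intro eq_matI) (auto simp: partition_matrix_def ystar_def)
      then show False using Y(2) by simp
    qed
    then obtain i j where ij: "i < n" "j < n" "Y $$ (i, j) \<noteq> ystar i j" by blast
    have nonneg: "0 \<le> \<theta> i * \<theta> j * \<bar>Y $$ (i, j) - ystar i j\<bar>" if "i < n" "j < n" for i j
      using theta_pos that by (auto simp: less_imp_le)
    have "0 < \<theta> i * \<theta> j * \<bar>Y $$ (i, j) - ystar i j\<bar>" using theta_pos ij by simp
    then have "0 < (\<Sum>j<n. \<theta> i * \<theta> j * \<bar>Y $$ (i, j) - ystar i j\<bar>)"
      using ij nonneg by (intro sum_pos2[of _ j]) auto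
    then have "0 < (\<Sum>i<n. \<Sum>j<n. \<theta> i * \<theta> j * \<bar>Y $$ (i, j) - ystar i j\<bar>)"
      by (rule sum_pos2[of "{..<n}" i, rotated 2]) (use ij nonneg in \<open>auto intro!: sum_nonneg\<close>)
    then have "- (\<delta> / 4) * (\<Sum>i<n. \<Sum>j<n. \<theta> i * \<theta> j * \<bar>Y $$ (i, j) - ystar i j\<bar>) < 0"
      using delta_pos by (simp add: mult_neg_pos)
    then show ?thesis using objective_gap[OF assms Y(1)] by linarith
  qed
  show ?thesis
  proof (intro equalityI subsetI)
    fix Y assume Y: "Y \<in> solutions n lam (adjacency n \<omega>)"
    then have "objective lam (adjacency n \<omega>) (partition_matrix n c) \<le> objective lam (adjacency n \<omega>) Y"
      using partition_matrix_feasible by (simp add: solutions_def)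
    then show "Y \<in> {partition_matrix n c}" using strict[of Y] Y by (force simp: solutions_def)
  next
    fix Y assume "Y \<in> {partition_matrix n c}"
    moreover have "objective lam (adjacency n \<omega>) Z \<le> objective lam (adjacency n \<omega>) (partition_matrix n c)"
      if "Z \<in> feasible n" for Z
      using strict[OF that] by (cases "Z = partition_matrix n c") auto
    ultimately show "Y \<in> solutions n lam (adjacency n \<omega>)"
      using partition_matrix_feasible[of n c] by (simp add: solutions_def)
  qed
qed

end

theorem theorem3:
  shows "\<exists>C0::real. C0 > 0 \<and>
    (\<forall>(n::nat) (r::nat) (c::nat \<Rightarrow> nat) (\<theta>::nat \<Rightarrow> real) (B::nat \<Rightarrow> nat \<Rightarrow> real)
        (p::real) (q::real) (\<delta>::real) (lam::real).
      dcsbm_params n r c \<theta> B \<longrightarrow>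
      singleton_blocks_bounded n c \<theta> B \<longrightarrow>
      (\<forall>a<r. B a a = p) \<longrightarrow>
      (\<forall>a b. a < b \<and> b < r \<longrightarrow> B a b = q) \<longrightarrow>
      q \<ge> 0 \<longrightarrow>
      theta_min n \<theta> > 0 \<longrightarrow>
      \<delta> > 0 \<longrightarrow>
      \<delta> < p \<longrightarrow>
      (\<forall>a b. a < b \<and> b < r \<longrightarrow> (q + \<delta>) / (H n r c \<theta> B a * H n r c \<theta> B b) < lam) \<longrightarrow>
      (\<forall>a<r. lam < (p - \<delta>) / (H n r c \<theta> B a)\<^sup>2) \<longrightarrow>
      \<delta> > C0 * (sqrt (q * real n) / G_min n r c \<theta>
               + sqrt (p * ln (real n) / (G_min n r c \<theta> * theta_min n \<theta>))) \<longrightarrow>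
      measure_pmf.prob (dcsbm n c \<theta> B)
        {A. solutions n lam A = {partition_matrix n c}} \<ge> 1 - 10 / real n)"
proof (intro exI[of _ "2 ^ 50"] conjI allI impI)
  fix n r c \<theta> B p q \<delta> lam
  assume *: "dcsbm_params n r c \<theta> B" "singleton_blocks_bounded n c \<theta> B"
    "\<forall>a<r. B a a = p" "\<forall>a b. a < b \<and> b < r \<longrightarrow> B a b = q" "0 \<le> q" "0 < theta_min n \<theta>"
    "0 < \<delta>" "\<delta> < p"
    "\<forall>a b. a < b \<and> b < r \<longrightarrow> (q + \<delta>) / (H n r c \<theta> B a * H n r c \<theta> B b) < lam"
    "\<forall>a<r. lam < (p - \<delta>) / (H n r c \<theta> B a)\<^sup>2"
    "2 ^ 50 * (sqrt (q * real n) / G_min n r c \<theta>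
       + sqrt (p * ln (real n) / (G_min n r c \<theta> * theta_min n \<theta>))) < \<delta>"
  show "1 - 10 / real n \<le> measure_pmf.prob (dcsbm n c \<theta> B) {A. solutions n lam A = {partition_matrix n c}}"
  proof (cases "n \<ge> 3")
    \<comment> \<open>For fewer than three nodes the claimed probability is negative; from three
      nodes on, \<open>ln n\<close> is at least 1, which absorbs constants throughout.\<close>
    case False
    have "n > 0" using *(1) by (simp add: dcsbm_params_def)
    then have "1 - 10 / real n \<le> 0" using False by simp
    also have "0 \<le> measure_pmf.prob (dcsbm n c \<theta> B) {A. solutions n lam A = {partition_matrix n c}}" by simp
    finally show ?thesis .
  next
    case True
    interpret dcsbm_recovery n r c \<theta> B p q \<delta> lam
      by unfold_locales (use * True in auto)
    have "1 - 10 / real n \<le> measure_pmf.prob law {\<omega>. good \<omega>}" by (rule good_prob)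
    also have "\<dots> \<le> measure_pmf.prob law (adjacency n -` {A. solutions n lam A = {partition_matrix n c}})"
      by (intro measure_pmf.finite_measure_mono) (auto simp: recovery)
    also have "law = Pi_pmf (node_pairs n) False (\<lambda>(i, j). bernoulli_pmf (\<theta> i * \<theta> j * B (c i) (c j)))"
      by (intro arg_cong[where f = "Pi_pmf (node_pairs n) False"] ext) (auto simp: prb_def split: prod.splits)
    finally show ?thesis by (simp add: dcsbm_def)
  qed
qed simp

end
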